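(* Let $n\ge 5$ and let $G=\mathsf{A}_n$ (the alternating group) or $G=\mathsf{S}_n$ (the symmetric group) of degree $n$. Then for any faithful irreducible complex character $\alpha$ of $G$, we have $$\mathrm{diam}\,\mathcal{M}(G,\alpha)\le 4n-4 .$$
   Context: For a finite group $G$, $\mathrm{Irr}(G)$ is the set of irreducible complex characters of $G$. For a complex character $\alpha$ of $G$, the McKay graph $\mathcal{M}(G,\alpha)$ is the directed graph with vertex set $\mathrm{Irr}(G)$, with an edge from $\chi_1$ to $\chi_2$ if and only if $\chi_2$ is a constituent of $\alpha\chi_1$. Its diameter $\mathrm{diam}\,\mathcal{M}(G,\alpha)$ is the smallest $d$ such that for any two vertices $\chi_1,\chi_2$ there is a directed path from $\chi_1$ to $\chi_2$ of length at most $d$. *)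

theory Defs
  imports
    "HOL-Algebra.Sym_Groups"
    "HOL-Library.Extended_Nat"
    "Jordan_Normal_Form.VS_Connect"
    "Graph_Theory.Arc_Walk"
begin

section \<open>Complex representations and characters of finite groups\<close>

definition general_linear :: "nat \<Rightarrow> complex mat monoid"
  where "general_linear d = units_of (ring_mat TYPE(complex) d ())"

definition representation ::
  "('a, 'b) monoid_scheme \<Rightarrow> nat \<Rightarrow> ('a \<Rightarrow> complex mat) \<Rightarrow> bool"
  where "representation G d \<rho> \<longleftrightarrow> \<rho> \<in> hom G (general_linear d)"

definition irreducible_representation ::
  "('a, 'b) monoid_scheme \<Rightarrow> nat \<Rightarrow> ('a \<Rightarrow> complex mat) \<Rightarrow> bool"
  where "irreducible_representation G d \<rho> \<longleftrightarrow>
    representation G d \<rho> \<and> d > 0 \<and>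
    (\<forall>W. VectorSpace.subspace class_ring W (module_vec TYPE(complex) d) \<and>
         (\<forall>g\<in>carrier G. \<forall>w\<in>W. \<rho> g *\<^sub>v w \<in> W) \<longrightarrow>
         W = {0\<^sub>v d} \<or> W = carrier_vec d)"

definition mat_trace :: "complex mat \<Rightarrow> complex"
  where "mat_trace A = (\<Sum>i<dim_row A. A $$ (i, i))"

text \<open>
  Class functions on \<open>G\<close> are total functions on the ambient type that vanish outside
  \<open>carrier G\<close>. Hence equality of characters is equality of functions, and pointwise sums and
  products stay within this normal form.
\<close>

definition character_of ::
  "('a, 'b) monoid_scheme \<Rightarrow> ('a \<Rightarrow> complex mat) \<Rightarrow> 'a \<Rightarrow> complex"
  where "character_of G \<rho> = (\<lambda>g. if g \<in> carrier G then mat_trace (\<rho> g) else 0)"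

definition characters :: "('a, 'b) monoid_scheme \<Rightarrow> ('a \<Rightarrow> complex) set"
  where "characters G = {character_of G \<rho> | d \<rho>. representation G d \<rho> \<and> d > 0}"

definition Irr :: "('a, 'b) monoid_scheme \<Rightarrow> ('a \<Rightarrow> complex) set"
  where "Irr G = {character_of G \<rho> | d \<rho>. irreducible_representation G d \<rho>}"

definition character_kernel :: "('a, 'b) monoid_scheme \<Rightarrow> ('a \<Rightarrow> complex) \<Rightarrow> 'a set"
  where "character_kernel G \<chi> = {g \<in> carrier G. \<chi> g = \<chi> \<one>\<^bsub>G\<^esub>}"

definition faithful_character :: "('a, 'b) monoid_scheme \<Rightarrow> ('a \<Rightarrow> complex) \<Rightarrow> bool"
  where "faithful_character G \<chi> \<longleftrightarrow> character_kernel G \<chi> = {\<one>\<^bsub>G\<^esub>}"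

text \<open>
  As in Isaacs, \<open>Character Theory of Finite Groups\<close>: a character \<open>\<chi>\<close> is a constituent of \<open>\<psi>\<close>
  if \<open>\<psi> - \<chi>\<close> is a character or zero.
\<close>

definition constituent ::
  "('a, 'b) monoid_scheme \<Rightarrow> ('a \<Rightarrow> complex) \<Rightarrow> ('a \<Rightarrow> complex) \<Rightarrow> bool"
  where "constituent G \<chi> \<psi> \<longleftrightarrow>
    \<chi> \<in> characters G \<and>
    (\<exists>\<theta>. (\<theta> \<in> characters G \<or> \<theta> = (\<lambda>g. 0)) \<and> \<psi> = (\<lambda>g. \<chi> g + \<theta> g))"

section \<open>McKay graphs\<close>

definition mckay_graph ::
  "('a, 'b) monoid_scheme \<Rightarrow> ('a \<Rightarrow> complex) \<Rightarrow>
   ('a \<Rightarrow> complex, ('a \<Rightarrow> complex) \<times> ('a \<Rightarrow> complex)) pre_digraph"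
  where "mckay_graph G \<alpha> =
    \<lparr>verts = Irr G,
     arcs = {(\<chi>\<^sub>1, \<chi>\<^sub>2). \<chi>\<^sub>1 \<in> Irr G \<and> \<chi>\<^sub>2 \<in> Irr G \<and>
                       constituent G \<chi>\<^sub>2 (\<lambda>g. \<alpha> g * \<chi>\<^sub>1 g)},
     tail = fst, head = snd\<rparr>"

text \<open>The diameter is \<open>\<infinity>\<close> if no bound on the path lengths exists.\<close>

definition digraph_diameter :: "('v, 'e) pre_digraph \<Rightarrow> enat"
  where "digraph_diameter \<Gamma> =
    Inf {enat d | d. \<forall>u\<in>verts \<Gamma>. \<forall>v\<in>verts \<Gamma>.
                       \<exists>p. pre_digraph.apath \<Gamma> u p v \<and> length p \<le> d}"

end

theory Submission
  imports Defs "Jordan_Normal_Form.Spectral_Radius" "Jordan_Normal_Form.DL_Rank"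
begin

text \<open>
  Let \<open>\<gamma> = fix - 1\<close> be the deleted permutation character; it is irreducible since \<open>G\<close> is doubly
  transitive. It takes at most \<open>n\<close> values, the value \<open>n - 1\<close> only at the identity, so by the
  Vandermonde argument of Burnside and Brauer every \<open>\<psi>\<close> is a constituent of \<open>\<gamma>\<^sup>k \<chi>\<close> for some
  \<open>k \<le> n - 1\<close>. Hence it suffices that \<open>\<gamma>\<close> is a constituent of \<open>\<alpha>\<^sup>4\<close>: each step by \<open>\<gamma>\<close> is then
  replaced by four steps by \<open>\<alpha>\<close>.

  If \<open>\<gamma>\<close> does not occur in \<open>\<alpha>\<^sup>4\<close>, then every tensor in \<open>V\<^sup>\<otimes>\<^sup>4\<close> fixed by a point stabiliser is fixed by
  \<open>G\<close>. If \<open>\<alpha>\<close> is real, apply this to the operators on \<open>End V\<close> that conjugate by all three-cycles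
  through a point \<open>x\<close> and add up: the result is independent of \<open>x\<close>. Evaluating at \<open>\<rho>(abc)\<close> gives linear
  relations which force \<open>\<rho>(abc) + \<rho>(acb)\<close> not to depend on \<open>a, b, c\<close> (for \<open>n \<noteq> 6\<close>), or
  \<open>\<rho>(abc) = \<rho>(acb)\<close> (for \<open>n = 6\<close>); both contradict faithfulness. If \<open>\<alpha>\<close> is not real, then
  \<open>G = A\<^sub>n\<close> and the dual of \<open>\<alpha>\<close> is its conjugate by a transposition, so odd permutations act as
  maps \<open>V\<^sup>* \<rightarrow> V\<close>, and the same argument works with transpositions in place of three-cycles.
\<close>

section \<open>Complex matrices\<close>

text \<open>The permutation character on points is 1 + \<gamma>. By Frobenius reciprocity the
  multiplicity of \<gamma> in a representation is therefore the dimension of the space fixed by a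
  point stabiliser minus the dimension of the space fixed by G. If it is zero, every family of
  tensors \<open>Y x\<close> that G permutes along with the points x is constant. Degree four is
  where operators on operators live: End (End V) has character \<alpha>^4 when \<alpha> is real, and
  so has the space of maps from bilinear forms on V to V \<otimes> V, whether \<alpha> is real or
  not. The exception n = 6 comes from a common factor (n - 3)(n - 6) in the linear relation for the
  symmetric part \<rho>(abc) + \<rho>(acb). At n = 6 that relation is empty, while the one for the
  antisymmetric part is not. For the other n, let M be the common value of all \<rho>(abc) +
  \<rho>(acb). Comparing M^2 = M + 2 with the product of two such sums on four points makes the sum
  of any two of the three double transpositions on these points act as 2, so each acts
  trivially.\<close>

definition msum :: "nat \<Rightarrow> nat \<Rightarrow> ('b \<Rightarrow> complex mat) \<Rightarrow> 'b set \<Rightarrow> complex mat"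
  where "msum r c f S = mat r c (\<lambda>(i, j). \<Sum>s\<in>S. f s $$ (i, j))"

lemma msum_carrier [simp, intro]: "msum r c f S \<in> carrier_mat r c"
  by (simp add: msum_def)

lemma msum_dim [simp]: "dim_row (msum r c f S) = r" "dim_col (msum r c f S) = c"
  by (simp_all add: msum_def)

lemma msum_index [simp]:
  "i < r \<Longrightarrow> j < c \<Longrightarrow> msum r c f S $$ (i, j) = (\<Sum>s\<in>S. f s $$ (i, j))"
  by (simp add: msum_def)

lemma msum_cong: "S = T \<Longrightarrow> (\<And>s. s \<in> T \<Longrightarrow> f s = g s) \<Longrightarrow> msum r c f S = msum r c g T"
  by (simp add: msum_def cong: sum.cong)

lemma msum_reindex:
  "bij_betw h S T \<Longrightarrow> msum r c (\<lambda>s. f (h s)) S = msum r c f T"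
  by (rule eq_matI) (auto simp: sum.reindex_bij_betw[where g = "\<lambda>s. f s $$ (_, _)"])

lemma mult_index:
  assumes "A \<in> carrier_mat r m" "B \<in> carrier_mat m c" "i < r" "j < c"
  shows "(A * B) $$ (i, j) = (\<Sum>k<m. A $$ (i, k) * B $$ (k, j))"
  using assms by (auto simp: scalar_prod_def atLeast0LessThan intro!: sum.cong)

lemma mult_mat_vec_index:
  assumes "A \<in> carrier_mat r m" "v \<in> carrier_vec m" "i < r"
  shows "(A *\<^sub>v v) $ i = (\<Sum>k<m. A $$ (i, k) * v $ k)"
  using assms by (auto simp: scalar_prod_def atLeast0LessThan intro!: sum.cong)

lemma mult_msum:
  assumes A: "A \<in> carrier_mat k r" and f: "\<And>s. s \<in> S \<Longrightarrow> f s \<in> carrier_mat r c"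
  shows "A * msum r c f S = msum k c (\<lambda>s. A * f s) S"
proof (rule eq_matI)
  fix i j assume "i < dim_row (msum k c (\<lambda>s. A * f s) S)" "j < dim_col (msum k c (\<lambda>s. A * f s) S)"
  hence ij: "i < k" "j < c" by auto
  have "(A * msum r c f S) $$ (i, j) = (\<Sum>l<r. \<Sum>s\<in>S. A $$ (i, l) * f s $$ (l, j))"
    using ij by (simp add: mult_index[OF A msum_carrier] sum_distrib_left)
  also have "\<dots> = (\<Sum>s\<in>S. \<Sum>l<r. A $$ (i, l) * f s $$ (l, j))"
    by (rule sum.swap)
  also have "\<dots> = msum k c (\<lambda>s. A * f s) S $$ (i, j)"
    using ij by (simp add: mult_index[OF A f] cong: sum.cong)
  finally show "(A * msum r c f S) $$ (i, j) = msum k c (\<lambda>s. A * f s) S $$ (i, j)" .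
qed (use A in auto)

lemma msum_mult:
  assumes A: "A \<in> carrier_mat c k" and f: "\<And>s. s \<in> S \<Longrightarrow> f s \<in> carrier_mat r c"
  shows "msum r c f S * A = msum r k (\<lambda>s. f s * A) S"
proof (rule eq_matI)
  fix i j assume "i < dim_row (msum r k (\<lambda>s. f s * A) S)" "j < dim_col (msum r k (\<lambda>s. f s * A) S)"
  hence ij: "i < r" "j < k" by auto
  have "(msum r c f S * A) $$ (i, j) = (\<Sum>l<c. \<Sum>s\<in>S. f s $$ (i, l) * A $$ (l, j))"
    using ij by (simp add: mult_index[OF msum_carrier A] sum_distrib_right)
  also have "\<dots> = (\<Sum>s\<in>S. \<Sum>l<c. f s $$ (i, l) * A $$ (l, j))"
    by (rule sum.swap)
  also have "\<dots> = msum r k (\<lambda>s. f s * A) S $$ (i, j)"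
    using ij by (simp add: mult_index[OF f A] cong: sum.cong)
  finally show "(msum r c f S * A) $$ (i, j) = msum r k (\<lambda>s. f s * A) S $$ (i, j)" .
qed (use A in auto)

lemma msum_mult_vec:
  assumes v: "v \<in> carrier_vec c" and f: "\<And>s. s \<in> S \<Longrightarrow> f s \<in> carrier_mat r c"
  shows "msum r c f S *\<^sub>v v = vec r (\<lambda>i. \<Sum>s\<in>S. (f s *\<^sub>v v) $ i)"
proof (rule eq_vecI)
  fix i assume "i < dim_vec (vec r (\<lambda>i. \<Sum>s\<in>S. (f s *\<^sub>v v) $ i))"
  hence i: "i < r" by simp
  have "(msum r c f S *\<^sub>v v) $ i = (\<Sum>l<c. \<Sum>s\<in>S. f s $$ (i, l) * v $ l)"
    using i by (simp add: mult_mat_vec_index[OF msum_carrier v] sum_distrib_right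
        del: index_mult_mat_vec)
  also have "\<dots> = (\<Sum>s\<in>S. \<Sum>l<c. f s $$ (i, l) * v $ l)"
    by (rule sum.swap)
  finally show "(msum r c f S *\<^sub>v v) $ i = vec r (\<lambda>i. \<Sum>s\<in>S. (f s *\<^sub>v v) $ i) $ i"
    using i by (simp add: mult_mat_vec_index[OF f v] del: index_mult_mat_vec cong: sum.cong)
qed auto

lemma mat_trace_msum: "mat_trace (msum r r f S) = (\<Sum>s\<in>S. \<Sum>i<r. f s $$ (i, i))"
  by (simp add: mat_trace_def sum.swap[of _ S])

lemma mat_trace_mult_commute:
  assumes A: "A \<in> carrier_mat r c" and B: "B \<in> carrier_mat c r"
  shows "mat_trace (A * B) = mat_trace (B * A)"
proof -
  have "mat_trace (A * B) = (\<Sum>i<r. \<Sum>j<c. A $$ (i, j) * B $$ (j, i))"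
    using assms by (simp add: mat_trace_def mult_index[OF A B] del: index_mult_mat(1))
  also have "\<dots> = (\<Sum>j<c. \<Sum>i<r. B $$ (j, i) * A $$ (i, j))"
    by (subst sum.swap) (simp add: mult.commute)
  also have "\<dots> = mat_trace (B * A)"
    using assms by (simp add: mat_trace_def mult_index[OF B A] del: index_mult_mat(1))
  finally show ?thesis .
qed

lemma mat_trace_one [simp]: "mat_trace (1\<^sub>m d) = of_nat d"
  by (simp add: mat_trace_def)

lemma mat_trace_conj:
  assumes "A \<in> carrier_mat d d" "P \<in> carrier_mat d d" "Q \<in> carrier_mat d d" "P * Q = 1\<^sub>m d"
  shows "mat_trace (Q * A * P) = mat_trace A"
proof -
  have "mat_trace (Q * A * P) = mat_trace (P * (Q * A))"
    using assms by (intro mat_trace_mult_commute) auto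
  also have "P * (Q * A) = A"
    using assms by (metis assoc_mult_mat left_mult_one_mat)
  finally show ?thesis .
qed

lemma mat_trace_diff:
  assumes "A \<in> carrier_mat d d" "B \<in> carrier_mat d d"
  shows "mat_trace (A - B) = mat_trace A - mat_trace B"
  using assms by (simp add: mat_trace_def sum_subtractf)

lemma mat_trace_similar:
  assumes "similar_mat A B" "A \<in> carrier_mat d d"
  shows "mat_trace A = mat_trace B"
proof -
  obtain P Q where "similar_mat_wit A B P Q"
    using assms(1) by (auto simp: similar_mat_def)
  from similar_mat_witD2[OF assms(2) this]
  have "A = P * B * Q" "Q * P = 1\<^sub>m d" "P \<in> carrier_mat d d" "Q \<in> carrier_mat d d" "B \<in> carrier_mat d d"
    by auto
  thus ?thesis using mat_trace_conj by metis
qed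

text \<open>The eigenvalues of \<open>A\<close> are \<open>0\<close> or \<open>1\<close> and sum to zero, so they all vanish and \<open>1 - A\<close> is
  invertible.\<close>

lemma idempotent_trace_zero:
  fixes A :: "complex mat"
  assumes A: "A \<in> carrier_mat d d" and idem: "A * A = A" and tr: "mat_trace A = 0"
  shows "A = 0\<^sub>m d d"
proof -
  from char_poly_factorized[OF A] obtain es where
    es: "char_poly A = (\<Prod>a\<leftarrow>es. [:- a, 1:])" by auto
  from schur_decomposition_exists[OF A es] obtain B where
    B: "B \<in> carrier_mat d d" and ut: "upper_triangular B" and sim: "similar_mat A B" by auto
  obtain P Q where "similar_mat_wit A B P Q"
    using sim by (auto simp: similar_mat_def)
  from similar_mat_witD2[OF A this]
  have PQ: "A = P * B * Q" "P * Q = 1\<^sub>m d" "Q * P = 1\<^sub>m d"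
    and c: "P \<in> carrier_mat d d" "Q \<in> carrier_mat d d"
    by auto
  have "B = (Q * P) * B * (Q * P)" using PQ B by simp
  also have "\<dots> = Q * A * P" using PQ(1) B c by (simp add: assoc_mult_mat[of _ d d _ d _ d])
  finally have BA: "B = Q * A * P" .
  have "B * B = Q * A * ((P * Q) * A * P)"
    unfolding BA using A c by (simp add: assoc_mult_mat[of _ d d _ d _ d])
  also have "\<dots> = Q * (A * A) * P" unfolding PQ(2) using A c by (simp add: assoc_mult_mat[of _ d d _ d _ d])
  finally have BB: "B * B = B" using idem BA by simp
  have sq: "B $$ (i, i) * B $$ (i, i) = B $$ (i, i)" if i: "i < d" for i
  proof -
    have "B $$ (i, i) = (\<Sum>k<d. B $$ (i, k) * B $$ (k, i))"
      using mult_index[OF B B i i] BB by simp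
    also have "\<dots> = (\<Sum>k<d. if k = i then B $$ (i, i) * B $$ (i, i) else 0)"
    proof (rule sum.cong[OF refl])
      fix k assume "k \<in> {..<d}"
      thus "B $$ (i, k) * B $$ (k, i) = (if k = i then B $$ (i, i) * B $$ (i, i) else 0)"
        using ut B i by (cases "k < i"; cases "i < k") (auto dest: upper_triangularD)
    qed
    also have "\<dots> = B $$ (i, i) * B $$ (i, i)" using i by simp
    finally show ?thesis by simp
  qed
  \<comment> \<open>Written as natural numbers, the diagonal entries cannot cancel: a zero trace
    makes each of them zero.\<close>
  have b01: "B $$ (i, i) = of_nat (if B $$ (i, i) = 0 then 0 else 1)" if "i < d" for i
    using sq[OF that] by auto
  have "mat_trace B = 0" using mat_trace_similar[OF sim A] tr by simp
  hence "(\<Sum>i<d. B $$ (i, i)) = 0" using B by (simp add: mat_trace_def)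
  also have "(\<Sum>i<d. B $$ (i, i)) = of_nat (\<Sum>i<d. if B $$ (i, i) = 0 then 0 else 1)"
    unfolding of_nat_sum by (rule sum.cong[OF refl], rule b01) simp
  finally have "(\<Sum>i<d. if B $$ (i, i) = 0 then 0 else 1 :: nat) = 0"
    unfolding of_nat_eq_0_iff .
  hence z: "B $$ (i, i) = 0" if "i < d" for i using that by (auto split: if_splits)
  define M where "M = 1\<^sub>m d - B"
  have M: "M \<in> carrier_mat d d" unfolding M_def by (intro minus_carrier_mat B)
  have "upper_triangular M" using ut B by (auto simp: upper_triangular_def M_def)
  hence "det M = prod_list (diag_mat M)" by (rule det_upper_triangular[OF _ M])
  also have "diag_mat M = replicate d 1"
    using B z by (intro nth_equalityI) (auto simp: diag_mat_def M_def)
  finally have "det M \<noteq> 0" by simp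
  from det_non_zero_imp_unit[OF M \<open>det M \<noteq> 0\<close>] obtain N where
    N: "N \<in> carrier_mat d d" "N * M = 1\<^sub>m d"
    by (auto simp: Units_def ring_mat_def)
  have "M * B = 0\<^sub>m d d" using B BB by (simp add: M_def minus_mult_distrib_mat[of _ d d])
  moreover have "N * M * B = N * (M * B)" using N M B by (intro assoc_mult_mat) auto
  ultimately have "N * M * B = 0\<^sub>m d d" using N by simp
  hence "B = 0\<^sub>m d d" using N B by simp
  thus ?thesis using PQ c by simp
qed

subsection \<open>Kronecker products\<close>

definition kron :: "complex mat \<Rightarrow> complex mat \<Rightarrow> complex mat"
  where "kron A B = mat (dim_row A * dim_row B) (dim_col A * dim_col B)
    (\<lambda>(i, j). A $$ (i div dim_row B, j div dim_col B) * B $$ (i mod dim_row B, j mod dim_col B))"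

lemma kron_carrier [simp, intro]:
  "A \<in> carrier_mat r c \<Longrightarrow> B \<in> carrier_mat r' c' \<Longrightarrow> kron A B \<in> carrier_mat (r * r') (c * c')"
  by (auto simp: kron_def)

lemma kron_index:
  assumes "A \<in> carrier_mat r c" "B \<in> carrier_mat r' c'" "i < r * r'" "j < c * c'"
  shows "kron A B $$ (i, j) = A $$ (i div r', j div c') * B $$ (i mod r', j mod c')"
  using assms by (auto simp: kron_def)

lemma div_mod_less:
  fixes k :: nat assumes "k < a * b" shows "k div b < a" "k mod b < b"
proof -
  have "b > 0" using assms by (cases b) auto
  thus "k mod b < b" by simp
  show "k div b < a" using assms by (simp add: less_mult_imp_div_less)
qed

lemma sum_div_mod:
  fixes f :: "nat \<Rightarrow> nat \<Rightarrow> 'b :: comm_monoid_add"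
  shows "(\<Sum>k<a * b. f (k div b) (k mod b)) = (\<Sum>p<a. \<Sum>q<b. f p q)"
proof -
  have "(\<Sum>k<a * b. f (k div b) (k mod b)) = (\<Sum>(p, q)\<in>{..<a} \<times> {..<b}. f p q)"
  proof (rule sum.reindex_bij_witness[where i = "\<lambda>(p, q). p * b + q" and j = "\<lambda>k. (k div b, k mod b)"])
    fix x assume "x \<in> {..<a} \<times> {..<b}"
    then obtain p q where x: "x = (p, q)" "p < a" "q < b" by auto
    have "p * b + q < (p + 1) * b" using x by simp
    also have "\<dots> \<le> a * b" using x by (intro mult_le_mono1) auto
    finally show "(case x of (p, q) \<Rightarrow> p * b + q) \<in> {..<a * b}" using x by simp
    show "((case x of (p, q) \<Rightarrow> p * b + q) div b, (case x of (p, q) \<Rightarrow> p * b + q) mod b) = x"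
      using x by simp
  qed (auto simp: div_mod_less)
  thus ?thesis by (simp add: sum.cartesian_product)
qed

lemma kron_mult:
  assumes A: "A \<in> carrier_mat r m" and A': "A' \<in> carrier_mat m c"
    and B: "B \<in> carrier_mat r' m'" and B': "B' \<in> carrier_mat m' c'"
  shows "kron A B * kron A' B' = kron (A * A') (B * B')"
proof (rule eq_matI)
  have c: "kron (A * A') (B * B') \<in> carrier_mat (r * r') (c * c')" using assms by auto
  fix i j assume "i < dim_row (kron (A * A') (B * B'))" "j < dim_col (kron (A * A') (B * B'))"
  hence ij: "i < r * r'" "j < c * c'" using c by auto
  note d = div_mod_less[OF ij(1)] div_mod_less[OF ij(2)]
  have "(kron A B * kron A' B') $$ (i, j) = (\<Sum>k<m * m'. kron A B $$ (i, k) * kron A' B' $$ (k, j))"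
    using assms ij by (intro mult_index) auto
  also have "\<dots> = (\<Sum>k<m * m'. (A $$ (i div r', k div m') * A' $$ (k div m', j div c')) *
      (B $$ (i mod r', k mod m') * B' $$ (k mod m', j mod c')))"
    using ij by (intro sum.cong) (auto simp: kron_index[OF A B] kron_index[OF A' B'])
  also have "\<dots> = (\<Sum>p<m. \<Sum>q<m'. (A $$ (i div r', p) * A' $$ (p, j div c')) *
      (B $$ (i mod r', q) * B' $$ (q, j mod c')))"
    by (rule sum_div_mod)
  also have "\<dots> = (A * A') $$ (i div r', j div c') * (B * B') $$ (i mod r', j mod c')"
    using d by (simp add: mult_index[OF A A'] mult_index[OF B B'] sum_product del: index_mult_mat(1))
  also have "\<dots> = kron (A * A') (B * B') $$ (i, j)"
    by (rule kron_index[symmetric]) (use assms ij in auto)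
  finally show "(kron A B * kron A' B') $$ (i, j) = kron (A * A') (B * B') $$ (i, j)" .
qed (use assms in \<open>auto simp: kron_def\<close>)

lemma kron_one [simp]: "kron (1\<^sub>m a) (1\<^sub>m b) = 1\<^sub>m (a * b)"
proof (rule eq_matI)
  fix i j assume "i < dim_row (1\<^sub>m (a * b))" "j < dim_col (1\<^sub>m (a * b) :: complex mat)"
  hence ij: "i < a * b" "j < a * b" by auto
  have "i = j" if "i div b = j div b" "i mod b = j mod b" by (metis that div_mult_mod_eq)
  thus "kron (1\<^sub>m a) (1\<^sub>m b) $$ (i, j) = 1\<^sub>m (a * b) $$ (i, j)"
    using ij div_mod_less[OF ij(1)] div_mod_less[OF ij(2)]
    by (auto simp: kron_index[of _ a a _ b b])
qed (auto simp: kron_def)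

lemma mat_trace_kron:
  assumes A: "A \<in> carrier_mat a a" and B: "B \<in> carrier_mat b b"
  shows "mat_trace (kron A B) = mat_trace A * mat_trace B"
proof -
  have "mat_trace (kron A B) = (\<Sum>k<a * b. A $$ (k div b, k div b) * B $$ (k mod b, k mod b))"
    using assms by (auto simp: mat_trace_def kron_index[OF A B] kron_def)
  also have "\<dots> = (\<Sum>p<a. \<Sum>q<b. A $$ (p, p) * B $$ (q, q))"
    by (rule sum_div_mod)
  finally show ?thesis using assms by (simp add: mat_trace_def sum_product)
qed

text \<open>Row-major vectorisation, the convention matching \<open>kron\<close>.\<close>

definition vectorise :: "complex mat \<Rightarrow> complex vec"
  where "vectorise X = vec (dim_row X * dim_col X) (\<lambda>k. X $$ (k div dim_col X, k mod dim_col X))"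

lemma vectorise_carrier [simp, intro]: "X \<in> carrier_mat r c \<Longrightarrow> vectorise X \<in> carrier_vec (r * c)"
  by (auto simp: vectorise_def)

lemma vectorise_index:
  "X \<in> carrier_mat r c \<Longrightarrow> k < r * c \<Longrightarrow> vectorise X $ k = X $$ (k div c, k mod c)"
  by (auto simp: vectorise_def)

lemma vectorise_inj:
  assumes X: "X \<in> carrier_mat r c" and Y: "Y \<in> carrier_mat r c" and eq: "vectorise X = vectorise Y"
  shows "X = Y"
proof (rule eq_matI)
  fix i j assume "i < dim_row Y" "j < dim_col Y"
  hence ij: "i < r" "j < c" using Y by auto
  have "i * c + j < (i + 1) * c" using ij by simp
  also have "\<dots> \<le> r * c" using ij by (intro mult_le_mono1) auto
  finally have k: "i * c + j < r * c" .
  show "X $$ (i, j) = Y $$ (i, j)"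
    using vectorise_index[OF X k] vectorise_index[OF Y k] eq ij by simp
qed (use X Y in auto)

text \<open>The bridge between tensors and operators: a tensor product of representations acts on a
  vectorised matrix by multiplication from both sides, so that fixed tensors become equivariant
  maps. The transpose appears because the second factor acts on the column index.\<close>

lemma kron_vectorise:
  assumes A: "A \<in> carrier_mat r m" and B: "B \<in> carrier_mat r' m'" and X: "X \<in> carrier_mat m m'"
  shows "kron A B *\<^sub>v vectorise X = vectorise (A * X * B\<^sup>T)"
proof (rule eq_vecI)
  have AX: "A * X \<in> carrier_mat r m'" and BT: "B\<^sup>T \<in> carrier_mat m' r'" using assms by auto
  have c: "A * X * B\<^sup>T \<in> carrier_mat r r'" using AX BT by auto
  fix i assume "i < dim_vec (vectorise (A * X * B\<^sup>T))"
  hence i: "i < r * r'" using c A B by (auto simp: vectorise_def)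
  note d = div_mod_less[OF i]
  have "(kron A B *\<^sub>v vectorise X) $ i = (\<Sum>k<m * m'. kron A B $$ (i, k) * vectorise X $ k)"
    using assms i by (intro mult_mat_vec_index) auto
  also have "\<dots> = (\<Sum>k<m * m'. A $$ (i div r', k div m') * X $$ (k div m', k mod m') * B $$ (i mod r', k mod m'))"
    using i by (intro sum.cong) (auto simp: kron_index[OF A B] vectorise_index[OF X])
  also have "\<dots> = (\<Sum>p<m. \<Sum>q<m'. A $$ (i div r', p) * X $$ (p, q) * B $$ (i mod r', q))"
    by (rule sum_div_mod)
  also have "\<dots> = (\<Sum>q<m'. \<Sum>p<m. A $$ (i div r', p) * X $$ (p, q) * B $$ (i mod r', q))"
    by (rule sum.swap)
  also have "\<dots> = (A * X * B\<^sup>T) $$ (i div r', i mod r')"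
    using d B by (simp add: mult_index[OF AX BT] mult_index[OF A X] sum_distrib_right del: index_mult_mat(1))
  also have "\<dots> = vectorise (A * X * B\<^sup>T) $ i" by (rule vectorise_index[OF c i, symmetric])
  finally show "(kron A B *\<^sub>v vectorise X) $ i = vectorise (A * X * B\<^sup>T) $ i" .
qed (use assms in \<open>auto simp: kron_def vectorise_def\<close>)

lemma mat_eqI_mult_vec:
  assumes A: "A \<in> carrier_mat r c" and B: "(B :: complex mat) \<in> carrier_mat r c"
    and eq: "\<And>v. v \<in> carrier_vec c \<Longrightarrow> A *\<^sub>v v = B *\<^sub>v v"
  shows "A = B"
proof (rule mat_col_eqI)
  have col: "M *\<^sub>v unit_vec c j = col M j" if "M \<in> carrier_mat r c" "j < c" for M :: "complex mat" and j
    using that by (intro eq_vecI) auto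
  fix j assume "j < dim_col B"
  hence j: "j < c" using B by simp
  show "col A j = col B j"
    using eq[of "unit_vec c j"] col[OF A j] col[OF B j] by simp
qed (use A B in auto)

subsection \<open>Invariant subspaces and block triangular form\<close>

lemma maximal_weaken:
  assumes "maximal C P" "Q C" "\<And>S. C \<subseteq> S \<Longrightarrow> Q S \<Longrightarrow> P S"
  shows "maximal C Q"
  using assms unfolding maximal_def by blast

text \<open>The columns of \<open>P\<close> are a basis of \<open>W\<close> followed by an extension
  to the whole space, and \<open>k\<close> is the dimension of \<open>W\<close>. In these
  coordinates a matrix that preserves \<open>W\<close> has a zero block at the lower left.\<close>

lemma subspace_adapted_basis:
  assumes W: "VectorSpace.subspace class_ring W (module_vec TYPE(complex) d)"
    and nz: "W \<noteq> {0\<^sub>v d}" and nf: "W \<noteq> carrier_vec d"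
  obtains P Q k where "0 < k" "k < d" "P \<in> carrier_mat d d" "Q \<in> carrier_mat d d"
    "P * Q = 1\<^sub>m d" "Q * P = 1\<^sub>m d"
    "\<And>A i j. A \<in> carrier_mat d d \<Longrightarrow> (\<And>w. w \<in> W \<Longrightarrow> A *\<^sub>v w \<in> W) \<Longrightarrow>
       k \<le> i \<Longrightarrow> i < d \<Longrightarrow> j < k \<Longrightarrow> (Q * A * P) $$ (i, j) = 0"
proof -
  interpret vec_space "TYPE(complex)" d .
  have sub: "submodule class_ring W V" using W by (simp add: subspace_def)
  have Wc: "W \<subseteq> carrier_vec d" and W0: "0\<^sub>v d \<in> W"
    using submodule.subset[OF sub] submodule.zero_closed[OF sub] by auto
  have fin: "finite S \<and> card S \<le> d" if "S \<subseteq> carrier_vec d" "lin_indpt S" for S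
    using li_le_dim[OF fin_dim] that dim_is_n by auto
  \<comment> \<open>Independent sets have at most d elements, so maximal ones exist. One that is
    maximal inside \<open>W\<close> spans \<open>W\<close>, and one that is maximal above it is a
    basis of the whole space.\<close>
  have "\<exists>B. finite B \<and> maximal B (\<lambda>S. S \<subseteq> W \<and> lin_indpt S)"
  proof (rule maximal_exists)
    show "finite A \<and> card A \<le> d" if "A \<subseteq> W \<and> lin_indpt A" for A
      using fin that Wc by auto
    show "{} \<subseteq> W \<and> lin_indpt {}" by (auto simp: lin_dep_def)
  qed
  then obtain B where "finite B" and Bmax: "maximal B (\<lambda>S. S \<subseteq> W \<and> lin_indpt S)" by auto
  hence BW: "B \<subseteq> W" and Bli: "lin_indpt B" by (auto simp: maximal_def)
  have "W \<subseteq> span B"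
  proof
    fix w assume w: "w \<in> W"
    show "w \<in> span B"
    proof (rule ccontr)
      assume ns: "w \<notin> span B"
      have wB: "w \<notin> B" using ns in_own_span[of B] BW Wc by auto
      from lin_dep_iff_in_span[of B w] have "lin_indpt (B \<union> {w})"
        using ns BW Wc w Bli wB by auto
      with w BW have "B \<union> {w} = B" using Bmax unfolding maximal_def by blast
      with wB show False by auto
    qed
  qed
  moreover have "span B \<subseteq> W" using span_is_subset[OF BW] sub by simp
  ultimately have span: "span B = W" by auto
  have "\<exists>C. finite C \<and> maximal C (\<lambda>S. S \<subseteq> carrier_vec d \<and> lin_indpt S \<and> B \<subseteq> S)"
  proof (rule maximal_exists)
    show "finite A \<and> card A \<le> d" if "A \<subseteq> carrier_vec d \<and> lin_indpt A \<and> B \<subseteq> A" for A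
      using fin that by auto
    show "B \<subseteq> carrier_vec d \<and> lin_indpt B \<and> B \<subseteq> B" using BW Wc Bli by auto
  qed
  then obtain C where finC: "finite C"
    and Cmax: "maximal C (\<lambda>S. S \<subseteq> carrier_vec d \<and> lin_indpt S \<and> B \<subseteq> S)" by auto
  hence Cc: "C \<subseteq> carrier_vec d" and Cli: "lin_indpt C" and BC: "B \<subseteq> C" by (auto simp: maximal_def)
  have "basis C"
  proof (rule max_li_is_basis)
    show "maximal C (\<lambda>S. S \<subseteq> carrier_vec d \<and> lin_indpt S)"
    proof (rule maximal_weaken[OF Cmax])
      show "C \<subseteq> carrier_vec d \<and> lin_indpt C" using Cc Cli by simp
      show "S \<subseteq> carrier_vec d \<and> lin_indpt S \<and> B \<subseteq> S"
        if "C \<subseteq> S" "S \<subseteq> carrier_vec d \<and> lin_indpt S" for S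
        using that subset_trans[OF BC that(1)] by simp
    qed
  qed
  have cardC: "card C = d" using dim_basis[OF finC \<open>basis C\<close>] unfolding dim_is_n by (rule sym)
  have Cspan: "span C = carrier_vec d" using \<open>basis C\<close> unfolding basis_def by simp
  define k where "k = card B"
  have k0: "0 < k"
  proof (rule ccontr)
    assume "\<not> 0 < k"
    hence "B = {}" using \<open>finite B\<close> by (simp add: k_def)
    hence "W = {0\<^sub>v d}" using span span_empty by auto
    with nz show False by simp
  qed
  have kd: "k < d"
  proof -
    have "B \<noteq> C" using span Cspan nf by auto
    with BC have "B \<subset> C" by auto
    from psubset_card_mono[OF finC this] show ?thesis by (simp add: k_def cardC)
  qed
  obtain ws where ws: "set ws = B" "distinct ws" using finite_distinct_list[OF \<open>finite B\<close>] by auto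
  obtain us where us: "set us = C - B" "distinct us" using finite_distinct_list[of "C - B"] finC by auto
  have lws: "length ws = k" using distinct_card[OF ws(2)] ws(1) by (simp add: k_def)
  have dist: "distinct (ws @ us)" and setC: "set (ws @ us) = C" using ws us BC by auto
  have len: "length (ws @ us) = d" using distinct_card[OF dist] setC cardC by simp
  define P where "P = mat_of_cols d (ws @ us)"
  have P: "P \<in> carrier_mat d d" using len by (simp add: P_def mat_of_cols_def)
  have colsP: "cols P = ws @ us" unfolding P_def using setC Cc by (intro cols_mat_of_cols) auto
  have colP: "col P i = (ws @ us) ! i" if "i < d" for i
    using colsP that P by (metis cols_nth carrier_matD(2))
  have "rank P = d" using lin_indpt_full_rank[OF P] colsP dist setC Cli by simp
  hence "det P \<noteq> 0" using det_rank_iff[OF P] by simp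
  from det_non_zero_imp_unit[OF P this, where b = "()"]
  obtain Q where Q: "Q \<in> carrier_mat d d" and PQ: "P * Q = 1\<^sub>m d" "Q * P = 1\<^sub>m d"
    by (auto simp: Units_def ring_mat_def)
  show thesis
  proof (rule that[OF k0 kd P Q PQ])
    fix A :: "complex mat" and i j
    assume A: "A \<in> carrier_mat d d" and inv: "\<And>w. w \<in> W \<Longrightarrow> A *\<^sub>v w \<in> W"
      and ij: "k \<le> i" "i < d" "j < k"
    have "col P j \<in> B" using colP[of j] ij kd lws ws by (auto simp: nth_append)
    hence "A *\<^sub>v col P j \<in> span B" using inv BW span by auto
    then obtain a where a: "A *\<^sub>v col P j = lincomb a B"
      using finite_in_span[OF \<open>finite B\<close>, of "A *\<^sub>v col P j"] subset_trans[OF BW Wc] by metis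
    \<comment> \<open>Extending the coefficients by zero to all of \<open>C\<close> makes the
      coordinates from position k onwards vanish visibly.\<close>
    define a' where "a' = (\<lambda>x. if x \<in> B then a x else 0)"
    have "lincomb a B = lincomb a' C"
    proof (rule eq_vecI)
      show "dim_vec (lincomb a B) = dim_vec (lincomb a' C)"
        using lincomb_dim[OF \<open>finite B\<close> subset_trans[OF BW Wc]] lincomb_dim[OF finC Cc] by simp
      fix l assume "l < dim_vec (lincomb a' C)"
      hence l: "l < d" using lincomb_dim[OF finC Cc] by simp
      have "B \<subseteq> carrier_vec d" using BW Wc by auto
      from lincomb_index[OF l this] lincomb_index[OF l Cc]
      show "lincomb a B $ l = lincomb a' C $ l"
        using BC finC by (auto simp: a'_def intro!: sum.mono_neutral_cong_left)
    qed
    also have "\<dots> = P *\<^sub>v vec d (\<lambda>i. a' (col P i))"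
      using mat_mult_eq_lincomb[OF P, of a'] colsP dist setC by simp
    finally have eq: "A *\<^sub>v col P j = P *\<^sub>v vec d (\<lambda>i. a' (col P i))" using a by simp
    have "(Q * A * P) $$ (i, j) = col (Q * A * P) j $ i" using ij kd P Q A by simp
    also have "col (Q * A * P) j = (Q * A) *\<^sub>v col P j"
      using ij kd by (intro col_mult2[OF mult_carrier_mat[OF Q A] P]) simp
    also have "\<dots> = Q *\<^sub>v (A *\<^sub>v col P j)"
      using P by (intro assoc_mult_mat_vec[OF Q A] carrier_vecI) simp
    also have "\<dots> = (Q * P) *\<^sub>v vec d (\<lambda>i. a' (col P i))"
      unfolding eq by (intro assoc_mult_mat_vec[OF Q P, symmetric]) simp
    also have "\<dots> = vec d (\<lambda>i. a' (col P i))" unfolding PQ by simp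
    also have "\<dots> $ i = a' (col P i)" using ij by simp
    also have "col P i = us ! (i - k)" "i - k < length us"
      using colP[OF ij(2)] ij lws len by (auto simp: nth_append)
    hence "col P i \<notin> B" using us(1) nth_mem[of "i - k" us] by auto
    hence "a' (col P i) = 0" by (simp add: a'_def)
    finally show "(Q * A * P) $$ (i, j) = 0" .
  qed
qed

section \<open>Characters of finite groups\<close>

locale finite_group = group G for G (structure) +
  assumes fin: "finite (carrier G)"
begin

text \<open>The image of the neutral element is an invertible idempotent, hence the identity matrix;
  conversely the image of the inverse element provides the inverse matrix.\<close>

lemma representation_iff:
  "representation G d \<rho> \<longleftrightarrow> (\<forall>g\<in>carrier G. \<rho> g \<in> carrier_mat d d) \<and>
     (\<forall>g\<in>carrier G. \<forall>h\<in>carrier G. \<rho> (g \<otimes> h) = \<rho> g * \<rho> h) \<and> \<rho> \<one> = 1\<^sub>m d"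
proof
  assume r: "representation G d \<rho>"
  have u: "\<rho> g \<in> Units (ring_mat TYPE(complex) d ())" if "g \<in> carrier G" for g
    using r that by (auto simp: representation_def general_linear_def units_of_def hom_def)
  have c: "\<rho> g \<in> carrier_mat d d" if "g \<in> carrier G" for g
    using u[OF that] by (auto simp: Units_def ring_mat_def)
  have m: "\<rho> (g \<otimes> h) = \<rho> g * \<rho> h" if "g \<in> carrier G" "h \<in> carrier G" for g h
    using r that by (auto simp: representation_def general_linear_def units_of_def hom_def ring_mat_def)
  obtain B where B: "B \<in> carrier_mat d d" "B * \<rho> \<one> = 1\<^sub>m d"
    using u[of \<one>] by (auto simp: Units_def ring_mat_def)
  have "\<rho> \<one> = (B * \<rho> \<one>) * \<rho> \<one>" using B c[of \<one>] by simp
  also have "\<dots> = B * (\<rho> \<one> * \<rho> \<one>)" using B c[of \<one>] by (intro assoc_mult_mat) auto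
  also have "\<rho> \<one> * \<rho> \<one> = \<rho> \<one>" using m[of \<one> \<one>] by simp
  finally have "\<rho> \<one> = 1\<^sub>m d" using B by simp
  thus "(\<forall>g\<in>carrier G. \<rho> g \<in> carrier_mat d d) \<and>
     (\<forall>g\<in>carrier G. \<forall>h\<in>carrier G. \<rho> (g \<otimes> h) = \<rho> g * \<rho> h) \<and> \<rho> \<one> = 1\<^sub>m d"
    using c m by auto
next
  assume r: "(\<forall>g\<in>carrier G. \<rho> g \<in> carrier_mat d d) \<and>
     (\<forall>g\<in>carrier G. \<forall>h\<in>carrier G. \<rho> (g \<otimes> h) = \<rho> g * \<rho> h) \<and> \<rho> \<one> = 1\<^sub>m d"
  have "\<rho> g \<in> Units (ring_mat TYPE(complex) d ())" if g: "g \<in> carrier G" for g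
  proof -
    have "\<rho> g * \<rho> (inv g) = 1\<^sub>m d" "\<rho> (inv g) * \<rho> g = 1\<^sub>m d"
      using r g by (metis inv_closed r_inv l_inv)+
    thus ?thesis using r g by (auto simp: Units_def ring_mat_def intro!: bexI[of _ "\<rho> (inv g)"])
  qed
  thus "representation G d \<rho>" using r
    by (auto simp: representation_def general_linear_def units_of_def hom_def ring_mat_def)
qed

lemma representationI:
  assumes "\<And>g. g \<in> carrier G \<Longrightarrow> \<rho> g \<in> carrier_mat d d"
    "\<And>g h. g \<in> carrier G \<Longrightarrow> h \<in> carrier G \<Longrightarrow> \<rho> (g \<otimes> h) = \<rho> g * \<rho> h" "\<rho> \<one> = 1\<^sub>m d"
  shows "representation G d \<rho>"
  using assms by (simp add: representation_iff)

lemma representationD: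
  assumes "representation G d \<rho>"
  shows "g \<in> carrier G \<Longrightarrow> \<rho> g \<in> carrier_mat d d"
    "g \<in> carrier G \<Longrightarrow> h \<in> carrier G \<Longrightarrow> \<rho> (g \<otimes> h) = \<rho> g * \<rho> h" "\<rho> \<one> = 1\<^sub>m d"
  using assms by (simp_all add: representation_iff)

lemma representation_inverse:
  assumes "representation G d \<rho>" "g \<in> carrier G"
  shows "\<rho> g * \<rho> (inv g) = 1\<^sub>m d" "\<rho> (inv g) * \<rho> g = 1\<^sub>m d"
  using representationD[OF assms(1)] assms(2) by (metis inv_closed r_inv l_inv)+

abbreviation char :: "('a \<Rightarrow> complex mat) \<Rightarrow> 'a \<Rightarrow> complex"
  where "char \<equiv> character_of G"

lemma character_of_apply: "g \<in> carrier G \<Longrightarrow> char \<rho> g = mat_trace (\<rho> g)"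
  by (simp add: character_of_def)

lemma representation_kron:
  assumes "representation G d \<rho>" "representation G e \<sigma>"
  shows "representation G (d * e) (\<lambda>g. kron (\<rho> g) (\<sigma> g))"
  using representationD[OF assms(1)] representationD[OF assms(2)]
  by (intro representationI) (auto simp: kron_mult[of _ d d _ d _ e e _ e])

lemma character_of_kron:
  assumes "representation G d \<rho>" "representation G e \<sigma>"
  shows "char (\<lambda>g. kron (\<rho> g) (\<sigma> g)) = (\<lambda>g. char \<rho> g * char \<sigma> g)"
  using mat_trace_kron[OF representationD(1)[OF assms(1)] representationD(1)[OF assms(2)]]
  by (simp add: character_of_def fun_eq_iff)

lemma characters_mult:
  assumes "\<phi> \<in> characters G" "\<psi> \<in> characters G"
  shows "(\<lambda>g. \<phi> g * \<psi> g) \<in> characters G"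
proof -
  obtain d \<rho> e \<sigma> where r: "representation G d \<rho>" "d > 0" "representation G e \<sigma>" "e > 0"
    and eq: "\<phi> = char \<rho>" "\<psi> = char \<sigma>"
    using assms by (auto simp: characters_def)
  have "(\<lambda>g. \<phi> g * \<psi> g) = char (\<lambda>g. kron (\<rho> g) (\<sigma> g))"
    unfolding eq by (rule character_of_kron[OF r(1,3), symmetric])
  thus ?thesis using representation_kron[OF r(1,3)] r unfolding characters_def by force
qed

text \<open>The sum belongs to the direct sum of the representations, written with block diagonal
  matrices.\<close>

lemma characters_add:
  assumes "\<phi> \<in> characters G" "\<psi> \<in> characters G"
  shows "(\<lambda>g. \<phi> g + \<psi> g) \<in> characters G"
proof -
  obtain d \<rho> e \<sigma> where r: "representation G d \<rho>" "d > 0" "representation G e \<sigma>" "e > 0"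
    and eq: "\<phi> = char \<rho>" "\<psi> = char \<sigma>"
    using assms by (auto simp: characters_def)
  note R = representationD[OF r(1)] and S = representationD[OF r(3)]
  define \<tau> where "\<tau> = (\<lambda>g. four_block_mat (\<rho> g) (0\<^sub>m d e) (0\<^sub>m e d) (\<sigma> g))"
  have "\<tau> (g \<otimes> h) = \<tau> g * \<tau> h" if "g \<in> carrier G" "h \<in> carrier G" for g h
  proof -
    have "\<tau> g * \<tau> h = four_block_mat (\<rho> g * \<rho> h + 0\<^sub>m d e * 0\<^sub>m e d) (\<rho> g * 0\<^sub>m d e + 0\<^sub>m d e * \<sigma> h)
       (0\<^sub>m e d * \<rho> h + \<sigma> g * 0\<^sub>m e d) (0\<^sub>m e d * 0\<^sub>m d e + \<sigma> g * \<sigma> h)"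
      unfolding \<tau>_def using R(1)[OF that(1)] R(1)[OF that(2)] S(1)[OF that(1)] S(1)[OF that(2)]
      by (intro mult_four_block_mat) auto
    also have "\<dots> = \<tau> (g \<otimes> h)"
      using R(1)[OF that(1)] R(1)[OF that(2)] S(1)[OF that(1)] S(1)[OF that(2)] R(2)[OF that] S(2)[OF that]
      by (simp add: \<tau>_def)
    finally show ?thesis by simp
  qed
  hence "representation G (d + e) \<tau>"
    using R S by (intro representationI) (auto simp: \<tau>_def)
  moreover have "mat_trace (\<tau> g) = mat_trace (\<rho> g) + mat_trace (\<sigma> g)" if "g \<in> carrier G" for g
  proof -
    have "mat_trace (\<tau> g) = (\<Sum>i\<in>{..<d + e}. \<tau> g $$ (i, i))"
      using R(1)[OF that] S(1)[OF that] by (simp add: mat_trace_def \<tau>_def)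
    also have "{..<d + e} = {..<d} \<union> {d..<d + e}" by auto
    also have "(\<Sum>i\<in>{..<d} \<union> {d..<d + e}. \<tau> g $$ (i, i)) =
      (\<Sum>i<d. \<tau> g $$ (i, i)) + (\<Sum>i\<in>{d..<d + e}. \<tau> g $$ (i, i))"
      by (rule sum.union_disjoint) auto
    also have "(\<Sum>i\<in>{d..<d + e}. \<tau> g $$ (i, i)) = (\<Sum>i<e. \<tau> g $$ (i + d, i + d))"
      using sum.shift_bounds_nat_ivl[of "\<lambda>i. \<tau> g $$ (i, i)" 0 d e] by (simp add: atLeast0LessThan add.commute)
    finally show ?thesis
      using R(1)[OF that] S(1)[OF that] by (simp add: mat_trace_def \<tau>_def)
  qed
  hence "(\<lambda>g. \<phi> g + \<psi> g) = char \<tau>"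
    by (auto simp: eq character_of_def)
  ultimately show ?thesis using r unfolding characters_def by force
qed

text \<open>In an adapted basis all matrices are block upper triangular, so each diagonal block is
  multiplicative on its own: \<open>\<sigma>\<close> is the action on \<open>W\<close> and
  \<open>\<tau>\<close> the action on the quotient. Both dimensions drop strictly, which is what
  induction on the degree uses.\<close>

lemma character_of_invariant_subspace:
  assumes \<rho>: "representation G d \<rho>"
    and W: "VectorSpace.subspace class_ring W (module_vec TYPE(complex) d)"
    and inv: "\<And>g w. g \<in> carrier G \<Longrightarrow> w \<in> W \<Longrightarrow> \<rho> g *\<^sub>v w \<in> W"
    and nz: "W \<noteq> {0\<^sub>v d}" and nf: "W \<noteq> carrier_vec d"
  obtains k l \<sigma> \<tau> where "0 < k" "k < d" "0 < l" "l < d"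
    "representation G k \<sigma>" "representation G l \<tau>"
    "char \<rho> = (\<lambda>g. char \<sigma> g + char \<tau> g)"
proof -
  note R = representationD[OF \<rho>]
  obtain P Q k where k: "0 < k" "k < d" and PQ: "P \<in> carrier_mat d d" "Q \<in> carrier_mat d d"
    "P * Q = 1\<^sub>m d" "Q * P = 1\<^sub>m d"
    and block: "\<And>A i j. A \<in> carrier_mat d d \<Longrightarrow> (\<And>w. w \<in> W \<Longrightarrow> A *\<^sub>v w \<in> W) \<Longrightarrow>
       k \<le> i \<Longrightarrow> i < d \<Longrightarrow> j < k \<Longrightarrow> (Q * A * P) $$ (i, j) = 0"
    using subspace_adapted_basis[OF W nz nf] by metis
  define M where "M g = Q * \<rho> g * P" for g
  have M: "M g \<in> carrier_mat d d" if "g \<in> carrier G" for g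
    using R(1)[OF that] PQ by (auto simp: M_def)
  have M0: "M g $$ (i, j) = 0" if "g \<in> carrier G" "k \<le> i" "i < d" "j < k" for g i j
    unfolding M_def using that R inv by (intro block) auto
  have Mmult: "M (g \<otimes> h) = M g * M h" if "g \<in> carrier G" "h \<in> carrier G" for g h
  proof -
    have "M g * M h = Q * \<rho> g * ((P * Q) * \<rho> h * P)"
      using R(1)[OF that(1)] R(1)[OF that(2)] PQ(1,2) by (simp add: M_def assoc_mult_mat[of _ d d _ d _ d])
    also have "\<dots> = Q * (\<rho> g * \<rho> h) * P"
      unfolding PQ(3) using R(1)[OF that(1)] R(1)[OF that(2)] PQ(1,2) by (simp add: assoc_mult_mat[of _ d d _ d _ d])
    finally show ?thesis using R(2)[OF that] by (simp add: M_def)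
  qed
  define \<sigma> where "\<sigma> g = mat k k (\<lambda>(i, j). M g $$ (i, j))" for g
  define \<tau> where "\<tau> g = mat (d - k) (d - k) (\<lambda>(i, j). M g $$ (i + k, j + k))" for g
  have split: "(\<Sum>i<d. f i) = (\<Sum>i<k. f i) + (\<Sum>i<d - k. f (i + k))" for f :: "nat \<Rightarrow> complex"
  proof -
    have "{..<d} = {..<k} \<union> {k..<d}" using k by auto
    hence "(\<Sum>i<d. f i) = (\<Sum>i<k. f i) + (\<Sum>i\<in>{k..<d}. f i)"
      by (simp add: sum.union_disjoint ivl_disj_int)
    thus ?thesis using sum.shift_bounds_nat_ivl[of f 0 k "d - k"] k by (simp add: atLeast0LessThan)
  qed
  have Mi: "M (g \<otimes> h) $$ (i, j) = (\<Sum>l<k. M g $$ (i, l) * M h $$ (l, j)) +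
      (\<Sum>l<d - k. M g $$ (i, l + k) * M h $$ (l + k, j))"
    if "g \<in> carrier G" "h \<in> carrier G" "i < d" "j < d" for g h i j
    using that mult_index[OF M M] Mmult split by simp
  have M1: "M \<one> = 1\<^sub>m d" using R(3) PQ by (simp add: M_def)
  have "representation G k \<sigma>"
  proof (rule representationI)
    show "\<sigma> \<one> = 1\<^sub>m k" using k by (intro eq_matI) (auto simp: \<sigma>_def M1)
    fix g h assume gh: "g \<in> carrier G" "h \<in> carrier G"
    show "\<sigma> (g \<otimes> h) = \<sigma> g * \<sigma> h"
    proof (rule eq_matI)
      fix i j assume "i < dim_row (\<sigma> g * \<sigma> h)" "j < dim_col (\<sigma> g * \<sigma> h)"
      hence ij: "i < k" "j < k" by (auto simp: \<sigma>_def)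
      hence "M (g \<otimes> h) $$ (i, j) = (\<Sum>l<k. M g $$ (i, l) * M h $$ (l, j))"
        using Mi[OF gh, of i j] k M0[OF gh(2)] by simp
      thus "\<sigma> (g \<otimes> h) $$ (i, j) = (\<sigma> g * \<sigma> h) $$ (i, j)"
        using ij by (simp add: mult_index[of _ k k _ k] \<sigma>_def del: index_mult_mat(1))
    qed (auto simp: \<sigma>_def)
  qed (auto simp: \<sigma>_def)
  moreover have "representation G (d - k) \<tau>"
  proof (rule representationI)
    show "\<tau> \<one> = 1\<^sub>m (d - k)" using k by (intro eq_matI) (auto simp: \<tau>_def M1)
    fix g h assume gh: "g \<in> carrier G" "h \<in> carrier G"
    show "\<tau> (g \<otimes> h) = \<tau> g * \<tau> h"
    proof (rule eq_matI)
      fix i j assume "i < dim_row (\<tau> g * \<tau> h)" "j < dim_col (\<tau> g * \<tau> h)"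
      hence ij: "i < d - k" "j < d - k" by (auto simp: \<tau>_def)
      hence "M (g \<otimes> h) $$ (i + k, j + k) = (\<Sum>l<d - k. M g $$ (i + k, l + k) * M h $$ (l + k, j + k))"
        using Mi[OF gh, of "i + k" "j + k"] k M0[OF gh(1)] by simp
      thus "\<tau> (g \<otimes> h) $$ (i, j) = (\<tau> g * \<tau> h) $$ (i, j)"
        using ij by (simp add: mult_index[of _ "d - k" "d - k" _ "d - k"] \<tau>_def del: index_mult_mat(1))
    qed (auto simp: \<tau>_def)
  qed (auto simp: \<tau>_def)
  moreover have "mat_trace (\<rho> g) = mat_trace (\<sigma> g) + mat_trace (\<tau> g)" if "g \<in> carrier G" for g
  proof -
    have "mat_trace (\<rho> g) = mat_trace (M g)"
      unfolding M_def using mat_trace_conj[OF R(1)[OF that] PQ(1,2,3)] by simp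
    also have "\<dots> = mat_trace (\<sigma> g) + mat_trace (\<tau> g)"
      using M[OF that] split by (simp add: mat_trace_def \<sigma>_def \<tau>_def)
    finally show ?thesis .
  qed
  hence "char \<rho> = (\<lambda>g. char \<sigma> g + char \<tau> g)"
    by (auto simp: character_of_def)
  ultimately show thesis using k by (intro that[of k "d - k" \<sigma> \<tau>]) auto
qed

text \<open>Passing to subspace and quotient suffices at the level of characters: no complement is needed.\<close>

lemma character_irr_decomposition:
  assumes "\<phi> \<in> characters G"
  obtains L where "set L \<subseteq> Irr G" "\<phi> = (\<lambda>g. \<Sum>\<chi>\<leftarrow>L. \<chi> g)"
proof -
  obtain d \<rho> where "representation G d \<rho>" "d > 0" "\<phi> = char \<rho>"
    using assms by (auto simp: characters_def)
  hence "\<exists>L. set L \<subseteq> Irr G \<and> char \<rho> = (\<lambda>g. \<Sum>\<chi>\<leftarrow>L. \<chi> g)"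
  proof (induction d arbitrary: \<rho> \<phi> rule: less_induct)
    case (less d)
    show ?case
    proof (cases "irreducible_representation G d \<rho>")
      case True
      thus ?thesis by (intro exI[of _ "[char \<rho>]"]) (auto simp: Irr_def)
    next
      case False
      then obtain W where W: "VectorSpace.subspace class_ring W (module_vec TYPE(complex) d)"
        "\<forall>g\<in>carrier G. \<forall>w\<in>W. \<rho> g *\<^sub>v w \<in> W" "W \<noteq> {0\<^sub>v d}" "W \<noteq> carrier_vec d"
        using less.prems by (auto simp: irreducible_representation_def)
      obtain k l \<sigma> \<tau> where kl: "0 < k" "k < d" "0 < l" "l < d"
        "representation G k \<sigma>" "representation G l \<tau>"
        and eq: "char \<rho> = (\<lambda>g. char \<sigma> g + char \<tau> g)"
        using character_of_invariant_subspace[OF less.prems(1) W(1) _ W(3,4)] W(2) by metis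
      from less.IH[OF kl(2,5,1) refl] less.IH[OF kl(4,6,3) refl] obtain L1 L2 where
        "set L1 \<subseteq> Irr G" "char \<sigma> = (\<lambda>g. \<Sum>\<chi>\<leftarrow>L1. \<chi> g)"
        "set L2 \<subseteq> Irr G" "char \<tau> = (\<lambda>g. \<Sum>\<chi>\<leftarrow>L2. \<chi> g)" by blast
      thus ?thesis unfolding eq by (intro exI[of _ "L1 @ L2"]) auto
    qed
  qed
  thus thesis using that \<open>\<phi> = _\<close> by auto
qed

end

lemma subspaceI:
  assumes "W \<subseteq> carrier_vec d" "0\<^sub>v d \<in> W" "\<And>v w. v \<in> W \<Longrightarrow> w \<in> W \<Longrightarrow> v + w \<in> W"
    "\<And>c v. v \<in> W \<Longrightarrow> c \<cdot>\<^sub>v v \<in> W"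
  shows "VectorSpace.subspace class_ring W (module_vec TYPE(complex) d)"
  unfolding VectorSpace.subspace_def LinearCombinations.submodule_def
  using assms by (auto simp: vec_vs vec_module module_vec_simps)

lemma mult_mat_zero_vec [simp]:
  "A \<in> carrier_mat r c \<Longrightarrow> A *\<^sub>v 0\<^sub>v c = (0\<^sub>v r :: 'a :: semiring_0 vec)"
  by (intro eq_vecI) auto

context finite_group
begin

subsection \<open>Schur's lemma and the orthogonality relations\<close>

text \<open>Kernel and image of \<open>T\<close> are invariant. As \<open>T\<close> is not zero,
  irreducibility leaves only the zero kernel and the full image. The equality of the degrees is then
  read off from the traces of the two products of \<open>T\<close> with its inverse.\<close>

lemma schur:
  assumes \<rho>: "irreducible_representation G d \<rho>" and \<sigma>: "irreducible_representation G e \<sigma>"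
    and T: "T \<in> carrier_mat e d" and int: "\<And>g. g \<in> carrier G \<Longrightarrow> \<sigma> g * T = T * \<rho> g"
    and nz: "T \<noteq> 0\<^sub>m e d"
  obtains S where "S \<in> carrier_mat d e" "T * S = 1\<^sub>m e" "S * T = 1\<^sub>m d" "d = e"
proof -
  have r\<rho>: "representation G d \<rho>" and r\<sigma>: "representation G e \<sigma>"
    using \<rho> \<sigma> by (auto simp: irreducible_representation_def)
  note R = representationD[OF r\<rho>] and S = representationD[OF r\<sigma>]
  have irr: "W = {0\<^sub>v k} \<or> W = carrier_vec k"
    if "irreducible_representation G k \<tau>" "VectorSpace.subspace class_ring W (module_vec TYPE(complex) k)"
      "\<And>g w. g \<in> carrier G \<Longrightarrow> w \<in> W \<Longrightarrow> \<tau> g *\<^sub>v w \<in> W" for W k \<tau>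
    using that unfolding irreducible_representation_def by blast
  have comm: "\<sigma> g *\<^sub>v (T *\<^sub>v w) = T *\<^sub>v (\<rho> g *\<^sub>v w)" if "g \<in> carrier G" "w \<in> carrier_vec d" for g w
    using int[OF that(1)] assoc_mult_mat_vec[OF S(1)[OF that(1)] T that(2)]
      assoc_mult_mat_vec[OF T R(1)[OF that(1)] that(2)] by simp
  have ex: "\<exists>v\<in>carrier_vec d. T *\<^sub>v v \<noteq> 0\<^sub>v e"
  proof (rule ccontr)
    assume "\<not> ?thesis"
    hence "T *\<^sub>v v = 0\<^sub>m e d *\<^sub>v v" if "v \<in> carrier_vec d" for v using that by auto
    hence "T = 0\<^sub>m e d" using T by (intro mat_eqI_mult_vec) auto
    with nz show False by simp
  qed
  define K where "K = {v \<in> carrier_vec d. T *\<^sub>v v = 0\<^sub>v e}"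
  have "VectorSpace.subspace class_ring K (module_vec TYPE(complex) d)"
    using T by (intro subspaceI) (auto simp: K_def mult_add_distrib_mat_vec mult_mat_vec)
  moreover have "\<rho> g *\<^sub>v w \<in> K" if "g \<in> carrier G" "w \<in> K" for g w
    using that R(1)[OF that(1)] S(1)[OF that(1)] comm[OF that(1), of w] by (auto simp: K_def)
  ultimately have "K = {0\<^sub>v d} \<or> K = carrier_vec d" by (rule irr[OF \<rho>])
  hence K: "K = {0\<^sub>v d}" using ex by (auto simp: K_def)
  define I where "I = (\<lambda>v. T *\<^sub>v v) ` carrier_vec d"
  have "VectorSpace.subspace class_ring I (module_vec TYPE(complex) e)"
  proof (rule subspaceI)
    show "0\<^sub>v e \<in> I" using T unfolding I_def by (intro image_eqI[of _ _ "0\<^sub>v d"]) auto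
    show "v + w \<in> I" if "v \<in> I" "w \<in> I" for v w
    proof -
      from that obtain a b where "a \<in> carrier_vec d" "b \<in> carrier_vec d" "v = T *\<^sub>v a" "w = T *\<^sub>v b"
        by (auto simp: I_def)
      thus ?thesis using T unfolding I_def
        by (intro image_eqI[of _ _ "a + b"]) (auto simp: mult_add_distrib_mat_vec)
    qed
    show "c \<cdot>\<^sub>v v \<in> I" if "v \<in> I" for c v
    proof -
      from that obtain a where "a \<in> carrier_vec d" "v = T *\<^sub>v a" by (auto simp: I_def)
      thus ?thesis using T unfolding I_def
        by (intro image_eqI[of _ _ "c \<cdot>\<^sub>v a"]) (auto simp: mult_mat_vec)
    qed
  qed (use T in \<open>auto simp: I_def\<close>)
  moreover have "\<sigma> g *\<^sub>v w \<in> I" if "g \<in> carrier G" "w \<in> I" for g w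
    using that R(1)[OF that(1)] comm[OF that(1)] unfolding I_def by auto
  ultimately have "I = {0\<^sub>v e} \<or> I = carrier_vec e" by (rule irr[OF \<sigma>])
  hence I: "I = carrier_vec e" using ex by (auto simp: I_def)
  have "\<forall>j<e. \<exists>v\<in>carrier_vec d. T *\<^sub>v v = unit_vec e j"
    using I unfolding I_def by (metis imageE unit_vec_carrier)
  then obtain f where f: "\<And>j. j < e \<Longrightarrow> f j \<in> carrier_vec d" "\<And>j. j < e \<Longrightarrow> T *\<^sub>v f j = unit_vec e j"
    by metis
  \<comment> \<open>The columns are chosen preimages of the unit vectors, which gives a right
    inverse.\<close>
  define S' where "S' = mat d e (\<lambda>(i, j). f j $ i)"
  have S': "S' \<in> carrier_mat d e" by (simp add: S'_def)
  have colS: "col S' j = f j" if "j < e" for j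
    using that f(1)[OF that] by (intro eq_vecI) (auto simp: S'_def)
  have TS: "T * S' = 1\<^sub>m e"
  proof (rule mat_col_eqI)
    fix j assume "j < dim_col (1\<^sub>m e :: complex mat)"
    hence j: "j < e" by simp
    show "col (T * S') j = col (1\<^sub>m e) j"
      using j f(2)[OF j] colS[OF j] by (simp add: col_mult2[OF T S' j])
  qed (use T S' in auto)
  \<comment> \<open>\<open>T\<close> kills the difference of S' T v and v, because
    \<open>T * S'\<close> is the identity; the kernel is trivial.\<close>
  have ST: "S' * T = 1\<^sub>m d"
  proof (rule mat_eqI_mult_vec)
    fix v :: "complex vec" assume v: "v \<in> carrier_vec d"
    define w where "w = (S' * T) *\<^sub>v v - v"
    have STv: "(S' * T) *\<^sub>v v \<in> carrier_vec d" using S' T v by auto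
    have w: "w \<in> carrier_vec d" using STv v by (simp add: w_def)
    have "T *\<^sub>v ((S' * T) *\<^sub>v v) = (T * (S' * T)) *\<^sub>v v"
      using S' T v by (intro assoc_mult_mat_vec[symmetric]) auto
    also have "T * (S' * T) = (T * S') * T" using S' T by (intro assoc_mult_mat[symmetric]) auto
    also have "\<dots> = T" using TS T by simp
    finally have "T *\<^sub>v w = 0\<^sub>v e"
      unfolding w_def using mult_minus_distrib_mat_vec[OF T STv v] T v by simp
    hence "w = 0\<^sub>v d" using K w by (auto simp: K_def)
    hence "w $ i = 0" if "i < d" for i using that by simp
    hence "(S' * T *\<^sub>v v) $ i = v $ i" if "i < d" for i
      using that v unfolding w_def by (metis carrier_vecD eq_iff_diff_eq_0 index_minus_vec(1))
    hence "(S' * T) *\<^sub>v v = v" using S' v by (intro eq_vecI) auto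
    thus "(S' * T) *\<^sub>v v = 1\<^sub>m d *\<^sub>v v" using v by simp
  qed (use S' T in auto)
  have "of_nat e = (of_nat d :: complex)"
    using mat_trace_mult_commute[OF T S'] TS ST by simp
  hence "d = e" by simp
  with S' TS ST show thesis by (rule that)
qed

text \<open>The usual projection of \<open>A\<close> to the intertwiners, without the factor 1/|G|,
  which is supplied by \<open>ip\<close>.\<close>

definition average :: "nat \<Rightarrow> nat \<Rightarrow> ('a \<Rightarrow> complex mat) \<Rightarrow> ('a \<Rightarrow> complex mat) \<Rightarrow> complex mat \<Rightarrow> complex mat"
  where "average e d \<sigma> \<rho> A = msum e d (\<lambda>g. \<sigma> g * A * \<rho> (inv g)) (carrier G)"

lemma average_carrier [simp, intro]: "average e d \<sigma> \<rho> A \<in> carrier_mat e d"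
  by (simp add: average_def)

lemma bij_betw_mult_left: "h \<in> carrier G \<Longrightarrow> bij_betw (\<lambda>g. h \<otimes> g) (carrier G) (carrier G)"
  by (rule bij_betw_byWitness[where f' = "\<lambda>g. inv h \<otimes> g"]) (auto simp: m_assoc[symmetric])

lemma average_intertwines:
  assumes r\<rho>: "representation G d \<rho>" and r\<sigma>: "representation G e \<sigma>" and A: "A \<in> carrier_mat e d"
    and h: "h \<in> carrier G"
  shows "\<sigma> h * average e d \<sigma> \<rho> A = average e d \<sigma> \<rho> A * \<rho> h"
proof -
  note R = representationD[OF r\<rho>] and S = representationD[OF r\<sigma>]
  let ?f = "\<lambda>g. \<sigma> g * A * \<rho> (inv g)"
  have c: "?f g \<in> carrier_mat e d" if "g \<in> carrier G" for g
    using that R(1)[of "inv g"] S(1)[OF that] A by auto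
  have "\<sigma> h * average e d \<sigma> \<rho> A = msum e d (\<lambda>g. \<sigma> h * ?f g) (carrier G)"
    unfolding average_def by (rule mult_msum) (use c S h in auto)
  also have "\<dots> = msum e d (\<lambda>g. ?f (h \<otimes> g) * \<rho> h) (carrier G)"
  proof (rule msum_cong[OF refl])
    fix g assume g: "g \<in> carrier G"
    have gi: "inv g \<in> carrier G" and hi: "inv (h \<otimes> g) \<in> carrier G" using g h by auto
    have "?f (h \<otimes> g) * \<rho> h = \<sigma> h * \<sigma> g * A * (\<rho> (inv (h \<otimes> g)) * \<rho> h)"
      using S(1)[OF g] S(1)[OF h] R(1)[OF h] R(1)[OF hi] A S(2)[OF h g]
      by (simp add: assoc_mult_mat[of _ e e _ d _ d] assoc_mult_mat[of _ e e _ e _ d] assoc_mult_mat[of _ e d _ d _ d])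
    also have "\<rho> (inv (h \<otimes> g)) * \<rho> h = \<rho> (inv g)"
      using R(2)[OF hi h] g h by (simp add: inv_mult_group m_assoc)
    also have "\<sigma> h * \<sigma> g * A * \<rho> (inv g) = \<sigma> h * ?f g"
      using S(1)[OF g] S(1)[OF h] R(1)[OF gi] A
      by (simp add: assoc_mult_mat[of _ e e _ d _ d] assoc_mult_mat[of _ e e _ e _ d])
    finally show "\<sigma> h * ?f g = ?f (h \<otimes> g) * \<rho> h" by simp
  qed
  also have "\<dots> = msum e d (\<lambda>g. ?f g * \<rho> h) (carrier G)"
    by (rule msum_reindex[OF bij_betw_mult_left[OF h], where f = "\<lambda>g. ?f g * \<rho> h"])
  also have "\<dots> = average e d \<sigma> \<rho> A * \<rho> h"
    unfolding average_def by (rule msum_mult[symmetric]) (use c R h in auto)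
  finally show ?thesis .
qed

definition unit_mat :: "nat \<Rightarrow> nat \<Rightarrow> nat \<Rightarrow> nat \<Rightarrow> complex mat"
  where "unit_mat e d p q = mat e d (\<lambda>(i, j). if i = p \<and> j = q then 1 else 0)"

lemma unit_mat_carrier [simp, intro]: "unit_mat e d p q \<in> carrier_mat e d"
  by (simp add: unit_mat_def)

lemma unit_mat_mult_index:
  assumes "A \<in> carrier_mat e e" "B \<in> carrier_mat d d" "p < e" "q < d" "i < e" "j < d"
  shows "(A * unit_mat e d p q * B) $$ (i, j) = A $$ (i, p) * B $$ (q, j)"
proof -
  have AU: "A * unit_mat e d p q \<in> carrier_mat e d" using assms by auto
  have "(A * unit_mat e d p q) $$ (i, l) = (if l = q then A $$ (i, p) else 0)" if "l < d" for l
  proof -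
    have "(A * unit_mat e d p q) $$ (i, l) = (\<Sum>k<e. if k = p then if l = q then A $$ (i, p) else 0 else 0)"
      using assms that by (subst mult_index[of _ e e _ d]) (auto simp: unit_mat_def if_distrib[of "(*) _"] cong: if_cong)
    thus ?thesis using assms by simp
  qed
  hence "(A * unit_mat e d p q * B) $$ (i, j) = (\<Sum>l<d. if l = q then A $$ (i, p) * B $$ (q, j) else 0)"
    using assms by (subst mult_index[OF AU]) (auto simp: if_distrib[of "\<lambda>x. x * _"] cong: if_cong)
  thus ?thesis using assms by simp
qed

text \<open>The inner product of class functions with the inverse element in place of complex
  conjugation. On characters both forms agree; this one is bilinear and symmetric, and it fits
  averaging over matrices directly.\<close>

definition ip :: "('a \<Rightarrow> complex) \<Rightarrow> ('a \<Rightarrow> complex) \<Rightarrow> complex"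
  where "ip f h = (\<Sum>g\<in>carrier G. f g * h (inv g)) / of_nat (card (carrier G))"

lemma card_pos: "card (carrier G) > 0"
  using fin one_closed by (auto simp: card_gt_0_iff)

text \<open>The (p, q) entry of \<sigma>(g) E \<rho>(inv g), for the unit matrix E at (p, q), is the
  product of the diagonal entries \<sigma>(g) at p and \<rho>(inv g) at q. Summing over p and q
  gives the product of the traces, so orthogonality becomes a statement about averaged unit
  matrices.\<close>

lemma ip_character_of:
  assumes r\<rho>: "representation G d \<rho>" and r\<sigma>: "representation G e \<sigma>"
  shows "ip (char \<sigma>) (char \<rho>) =
    (\<Sum>p<e. \<Sum>q<d. average e d \<sigma> \<rho> (unit_mat e d p q) $$ (p, q)) / of_nat (card (carrier G))"
proof -
  note R = representationD[OF r\<rho>] and S = representationD[OF r\<sigma>]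
  have "(\<Sum>g\<in>carrier G. char \<sigma> g * char \<rho> (inv g)) =
    (\<Sum>g\<in>carrier G. \<Sum>p<e. \<Sum>q<d. \<sigma> g $$ (p, p) * \<rho> (inv g) $$ (q, q))"
  proof (rule sum.cong[OF refl])
    fix g assume g: "g \<in> carrier G"
    hence "inv g \<in> carrier G" by simp
    from g S(1)[OF g] R(1)[OF this]
    show "char \<sigma> g * char \<rho> (inv g) = (\<Sum>p<e. \<Sum>q<d. \<sigma> g $$ (p, p) * \<rho> (inv g) $$ (q, q))"
      by (simp add: character_of_def mat_trace_def sum_product)
  qed
  also have "\<dots> = (\<Sum>p<e. \<Sum>q<d. \<Sum>g\<in>carrier G. \<sigma> g $$ (p, p) * \<rho> (inv g) $$ (q, q))"
    by (subst sum.swap, intro sum.cong refl, rule sum.swap)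
  also have "\<dots> = (\<Sum>p<e. \<Sum>q<d. average e d \<sigma> \<rho> (unit_mat e d p q) $$ (p, q))"
    using R(1) S(1) by (auto simp: average_def unit_mat_mult_index intro!: sum.cong)
  finally show ?thesis by (simp add: ip_def)
qed

lemma nonzero_intertwiner:
  assumes r\<rho>: "representation G d \<rho>" and r\<sigma>: "representation G e \<sigma>"
    and "ip (char \<sigma>) (char \<rho>) \<noteq> 0"
  obtains T where "T \<in> carrier_mat e d" "T \<noteq> 0\<^sub>m e d"
    "\<And>g. g \<in> carrier G \<Longrightarrow> \<sigma> g * T = T * \<rho> g"
proof -
  have "\<exists>p<e. \<exists>q<d. average e d \<sigma> \<rho> (unit_mat e d p q) $$ (p, q) \<noteq> 0"
  proof (rule ccontr)
    assume "\<not> ?thesis"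
    hence "(\<Sum>p<e. \<Sum>q<d. average e d \<sigma> \<rho> (unit_mat e d p q) $$ (p, q)) = 0"
      by (intro sum.neutral ballI) auto
    thus False using assms(3) ip_character_of[OF r\<rho> r\<sigma>] by simp
  qed
  then obtain p q where "p < e" "q < d" "average e d \<sigma> \<rho> (unit_mat e d p q) $$ (p, q) \<noteq> 0" by auto
  thus thesis
    using average_intertwines[OF r\<rho> r\<sigma>, of "unit_mat e d p q"]
    by (intro that[of "average e d \<sigma> \<rho> (unit_mat e d p q)"]) auto
qed

text \<open>\<open>T\<close> has a complex eigenvalue c. The matrix T - c also commutes with the
  representation and kills an eigenvector, so it is not invertible and vanishes by Schur's
  lemma.\<close>

lemma irreducible_commutant:
  assumes irr: "irreducible_representation G d \<rho>" and T: "T \<in> carrier_mat d d"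
    and int: "\<And>g. g \<in> carrier G \<Longrightarrow> \<rho> g * T = T * \<rho> g"
  obtains c where "T = c \<cdot>\<^sub>m 1\<^sub>m d"
proof -
  have r: "representation G d \<rho>" and d: "d > 0"
    using irr by (auto simp: irreducible_representation_def)
  note R = representationD[OF r]
  have "spectrum T \<noteq> {}" using spectrum_non_empty[OF T] d by auto
  then obtain c v where "eigenvector T v c" by (auto simp: spectrum_def eigenvalue_def)
  hence v: "v \<in> carrier_vec d" "v \<noteq> 0\<^sub>v d" "T *\<^sub>v v = c \<cdot>\<^sub>v v" using T by (auto simp: eigenvector_def)
  define U where "U = T - c \<cdot>\<^sub>m 1\<^sub>m d"
  have U: "U \<in> carrier_mat d d" using T by (auto simp: U_def intro: minus_carrier_mat)
  have "U *\<^sub>v v = T *\<^sub>v v - (c \<cdot>\<^sub>m 1\<^sub>m d) *\<^sub>v v"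
    unfolding U_def using T v by (intro minus_mult_distrib_mat_vec) auto
  also have "(c \<cdot>\<^sub>m 1\<^sub>m d) *\<^sub>v v = c \<cdot>\<^sub>v v" using v by auto
  finally have Uv: "U *\<^sub>v v = 0\<^sub>v d" using v by simp
  have "\<rho> g * U = U * \<rho> g" if g: "g \<in> carrier G" for g
    using int[OF g] R(1)[OF g] T
    by (simp add: U_def mult_minus_distrib_mat[of _ d d _ d] minus_mult_distrib_mat[of _ d d _ _ d]
        mult_smult_distrib[of _ d d _ d] mult_smult_assoc_mat[of _ d d _ d])
  note int' = this
  have "U = 0\<^sub>m d d"
  proof (rule ccontr)
    assume "U \<noteq> 0\<^sub>m d d"
    from schur[OF irr irr U int' this] obtain S where S: "S \<in> carrier_mat d d" "S * U = 1\<^sub>m d" by metis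
    have "v = (S * U) *\<^sub>v v" using S v by simp
    also have "\<dots> = S *\<^sub>v (U *\<^sub>v v)" using S U v by (intro assoc_mult_mat_vec) auto
    also have "\<dots> = 0\<^sub>v d" using S Uv by auto
    finally show False using v by simp
  qed
  hence "T $$ (i, j) = (c \<cdot>\<^sub>m 1\<^sub>m d) $$ (i, j)" if "i < d" "j < d" for i j
  proof -
    have "U $$ (i, j) = 0" using \<open>U = 0\<^sub>m d d\<close> that by simp
    thus ?thesis using that T by (simp add: U_def)
  qed
  hence "T = c \<cdot>\<^sub>m 1\<^sub>m d" using T by (intro eq_matI) auto
  thus thesis by (rule that)
qed

lemma ip_irreducible_self:
  assumes irr: "irreducible_representation G d \<rho>"
  shows "ip (char \<rho>) (char \<rho>) = 1"
proof -
  have r: "representation G d \<rho>" and d: "d > 0"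
    using irr by (auto simp: irreducible_representation_def)
  note R = representationD[OF r]
  let ?n = "of_nat (card (carrier G)) :: complex"
  \<comment> \<open>The averaged unit matrix is a scalar c. Each conjugate of the unit matrix at (p,
    q) has trace 1 if p = q and 0 otherwise, so c d is |G| or 0.\<close>
  have "average d d \<rho> \<rho> (unit_mat d d p q) $$ (p, q) = (if p = q then ?n / of_nat d else 0)"
    if pq: "p < d" "q < d" for p q
  proof -
    let ?T = "average d d \<rho> \<rho> (unit_mat d d p q)"
    obtain c where c: "?T = c \<cdot>\<^sub>m 1\<^sub>m d"
      by (rule irreducible_commutant[OF irr average_carrier])
        (use average_intertwines[OF r r unit_mat_carrier] in auto)
    have "mat_trace ?T = (\<Sum>g\<in>carrier G. \<Sum>i<d. (\<rho> g * unit_mat d d p q * \<rho> (inv g)) $$ (i, i))"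
      unfolding average_def by (rule mat_trace_msum)
    also have "\<dots> = (\<Sum>g\<in>carrier G. if p = q then 1 else 0)"
    proof (rule sum.cong[OF refl])
      fix g assume g: "g \<in> carrier G"
      hence gi: "inv g \<in> carrier G" by simp
      have "(\<Sum>i<d. (\<rho> g * unit_mat d d p q * \<rho> (inv g)) $$ (i, i)) = (\<Sum>i<d. \<rho> (inv g) $$ (q, i) * \<rho> g $$ (i, p))"
        using R(1)[OF g] R(1)[OF gi] pq by (intro sum.cong) (auto simp: unit_mat_mult_index simp del: index_mult_mat(1))
      also have "\<dots> = (\<rho> (inv g) * \<rho> g) $$ (q, p)"
        by (rule mult_index[symmetric]) (use R(1)[OF g] R(1)[OF gi] pq in auto)
      finally show "(\<Sum>i<d. (\<rho> g * unit_mat d d p q * \<rho> (inv g)) $$ (i, i)) = (if p = q then 1 else 0)"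
        using representation_inverse[OF r g] pq by auto
    qed
    finally have "mat_trace ?T = (if p = q then ?n else 0)" by simp
    moreover have "mat_trace ?T = c * of_nat d" unfolding c by (simp add: mat_trace_def mult.commute)
    ultimately have "c = (if p = q then ?n / of_nat d else 0)" using d by (auto simp: field_simps)
    thus ?thesis using c pq by auto
  qed
  hence "(\<Sum>p<d. \<Sum>q<d. average d d \<rho> \<rho> (unit_mat d d p q) $$ (p, q)) =
    (\<Sum>p<d. \<Sum>q<d. if p = q then ?n / of_nat d else 0)"
    by (intro sum.cong) auto
  also have "\<dots> = ?n" using d by (simp add: sum.delta')
  finally show ?thesis using ip_character_of[OF r r] card_pos by simp
qed

lemma character_of_equivalent:
  assumes r\<rho>: "representation G d \<rho>" and r\<sigma>: "representation G d \<sigma>"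
    and T: "T \<in> carrier_mat d d" "S \<in> carrier_mat d d" "S * T = 1\<^sub>m d"
    and int: "\<And>g. g \<in> carrier G \<Longrightarrow> \<sigma> g * T = T * \<rho> g"
  shows "char \<sigma> = char \<rho>"
proof
  fix g
  note R = representationD[OF r\<rho>] and S = representationD[OF r\<sigma>]
  show "char \<sigma> g = char \<rho> g"
  proof (cases "g \<in> carrier G")
    case True
    have TS: "T * S = 1\<^sub>m d" using mat_mult_left_right_inverse[OF T(2,1,3)] .
    have "mat_trace (\<sigma> g) = mat_trace (S * \<sigma> g * T)"
      by (rule mat_trace_conj[symmetric]) (use S(1)[OF True] T TS in auto)
    also have "S * \<sigma> g * T = S * (\<sigma> g * T)"
      by (rule assoc_mult_mat[OF T(2) S(1)[OF True] T(1)])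
    also have "\<dots> = S * T * \<rho> g"
      unfolding int[OF True] by (rule assoc_mult_mat[OF T(2,1) R(1)[OF True], symmetric])
    also have "\<dots> = \<rho> g" using T(3) R(1)[OF True] by simp
    finally show ?thesis using True by (simp add: character_of_apply)
  qed (simp add: character_of_def)
qed

lemma ip_Irr:
  assumes "\<chi> \<in> Irr G" "\<psi> \<in> Irr G"
  shows "ip \<chi> \<psi> = (if \<chi> = \<psi> then 1 else 0)"
proof -
  obtain e \<sigma> d \<rho> where \<sigma>: "irreducible_representation G e \<sigma>" "\<chi> = char \<sigma>"
    and \<rho>: "irreducible_representation G d \<rho>" "\<psi> = char \<rho>"
    using assms by (auto simp: Irr_def)
  have r\<rho>: "representation G d \<rho>" and r\<sigma>: "representation G e \<sigma>"
    using \<rho> \<sigma> by (auto simp: irreducible_representation_def)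
  have "\<chi> = \<psi>" if nz: "ip \<chi> \<psi> \<noteq> 0"
  proof -
    obtain T where T: "T \<in> carrier_mat e d" "T \<noteq> 0\<^sub>m e d"
      "\<And>g. g \<in> carrier G \<Longrightarrow> \<sigma> g * T = T * \<rho> g"
      by (rule nonzero_intertwiner[OF r\<rho> r\<sigma>]) (use \<rho> \<sigma> nz in auto)
    obtain S where S: "S \<in> carrier_mat d e" "T * S = 1\<^sub>m e" "S * T = 1\<^sub>m d" "d = e"
      using schur[OF \<rho>(1) \<sigma>(1) T(1) T(3) T(2)] by metis
    note e = S(4)[symmetric]
    have "char \<sigma> = char \<rho>"
      by (rule character_of_equivalent[OF r\<rho> r\<sigma>[unfolded e] T(1)[unfolded e] S(1)[unfolded e] S(3) T(3)])
    thus ?thesis using \<rho> \<sigma> by simp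
  qed
  thus ?thesis using ip_irreducible_self[OF \<rho>(1)] \<rho>(2) by auto
qed

lemma ip_sum_list_left: "ip (\<lambda>g. \<Sum>\<chi>\<leftarrow>L. f \<chi> g) h = (\<Sum>\<chi>\<leftarrow>L. ip (f \<chi>) h)"
proof (induction L)
  case Nil
  show ?case by (simp add: ip_def)
next
  case (Cons a L)
  have "ip (\<lambda>g. f a g + k g) h = ip (f a) h + ip k h" for k
    by (simp add: ip_def ring_distribs sum.distrib add_divide_distrib)
  thus ?case using Cons by simp
qed

lemma ip_add_left: "ip (\<lambda>g. f g + k g) h = ip f h + ip k h"
  by (simp add: ip_def ring_distribs sum.distrib add_divide_distrib)

lemma ip_add_right: "ip h (\<lambda>g. f g + k g) = ip h f + ip h k"
  by (simp add: ip_def ring_distribs sum.distrib add_divide_distrib)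

lemma ip_commute: "ip f h = ip h f"
proof -
  have "bij_betw (\<lambda>g. inv g) (carrier G) (carrier G)"
    by (rule bij_betw_byWitness[where f' = "\<lambda>g. inv g"]) auto
  from sum.reindex_bij_betw[OF this, of "\<lambda>g. h g * f (inv g)"]
  have "(\<Sum>g\<in>carrier G. h (inv g) * f (inv (inv g))) = (\<Sum>g\<in>carrier G. h g * f (inv g))" .
  moreover have "(\<Sum>g\<in>carrier G. h (inv g) * f (inv (inv g))) = (\<Sum>g\<in>carrier G. f g * h (inv g))"
    by (intro sum.cong) auto
  ultimately show ?thesis by (simp add: ip_def)
qed

lemma ip_sum_list_Irr:
  assumes "set L \<subseteq> Irr G" "\<psi> \<in> Irr G"
  shows "ip (\<lambda>g. \<Sum>\<chi>\<leftarrow>L. \<chi> g) \<psi> = of_nat (count_list L \<psi>)"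
  unfolding ip_sum_list_left using assms
  by (induction L) (auto simp: ip_Irr)

lemma Irr_characters: "Irr G \<subseteq> characters G"
  by (auto simp: Irr_def characters_def irreducible_representation_def)

lemma ip_character_Irr:
  assumes "\<phi> \<in> characters G" "\<psi> \<in> Irr G"
  obtains m :: nat where "ip \<phi> \<psi> = of_nat m"
  using character_irr_decomposition[OF assms(1)] ip_sum_list_Irr[OF _ assms(2)] by metis

text \<open>\<open>L\<close> lists the constituents with repetition, so the right-hand side is the
  sum of the squared multiplicities.\<close>

lemma ip_sum_list_self:
  assumes "set L \<subseteq> Irr G"
  shows "ip (\<lambda>g. \<Sum>\<chi>\<leftarrow>L. \<chi> g) (\<lambda>g. \<Sum>\<chi>\<leftarrow>L. \<chi> g) = of_nat (\<Sum>\<chi>\<leftarrow>L. count_list L \<chi>)"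
proof -
  have "ip (\<lambda>g. \<Sum>\<chi>\<leftarrow>M. \<chi> g) (\<lambda>g. \<Sum>\<chi>\<leftarrow>L. \<chi> g) = of_nat (\<Sum>\<chi>\<leftarrow>M. count_list L \<chi>)" if "set M \<subseteq> Irr G" for M
    using that assms
  proof (induction M)
    case (Cons \<chi> M)
    thus ?case using ip_sum_list_Irr[of L \<chi>] ip_commute[of \<chi>] by (simp add: ip_add_left)
  qed (simp add: ip_def)
  thus ?thesis using assms by simp
qed

lemma sum_count_list_ge: "set M \<subseteq> set L \<Longrightarrow> (\<Sum>\<chi>\<leftarrow>M. count_list L \<chi>) \<ge> length M"
proof (induction M)
  case (Cons a M)
  have "count_list L a \<noteq> 0" using Cons.prems count_list_0_iff[of L a] by (metis list.set_intros(1) subsetD)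
  hence "count_list L a > 0" by simp
  thus ?case using Cons by simp
qed auto

lemma sum_list_Irr_characters:
  assumes "set L \<subseteq> Irr G"
  shows "(\<lambda>g. \<Sum>\<chi>\<leftarrow>L. \<chi> g) \<in> characters G \<or> (\<lambda>g. \<Sum>\<chi>\<leftarrow>L. \<chi> g) = (\<lambda>g. 0)"
  using assms
proof (induction L)
  case (Cons \<chi> L)
  hence "\<chi> \<in> characters G" using Irr_characters by auto
  thus ?case using Cons characters_add[of \<chi> "\<lambda>g. \<Sum>\<chi>\<leftarrow>L. \<chi> g"] by (auto simp: fun_eq_iff)
qed auto

lemma character_one_nonzero:
  assumes "\<phi> \<in> characters G"
  shows "\<phi> \<one> \<noteq> 0"
proof -
  obtain d \<rho> where "representation G d \<rho>" "d > 0" "\<phi> = char \<rho>"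
    using assms by (auto simp: characters_def)
  thus ?thesis using representationD(3)[of d \<rho>] by (simp add: character_of_apply)
qed

text \<open>A nonzero pairing puts \<open>\<psi>\<close> into any decomposition of
  \<open>\<phi>\<close> into irreducibles. Deleting one occurrence leaves a sum of irreducibles,
  possibly the empty one.\<close>

lemma constituentI:
  assumes "\<phi> \<in> characters G" "\<psi> \<in> Irr G" "ip \<phi> \<psi> \<noteq> 0"
  shows "constituent G \<psi> \<phi>"
proof -
  obtain L where L: "set L \<subseteq> Irr G" "\<phi> = (\<lambda>g. \<Sum>\<chi>\<leftarrow>L. \<chi> g)"
    using character_irr_decomposition[OF assms(1)] by metis
  have "count_list L \<psi> \<noteq> 0" using ip_sum_list_Irr[OF L(1) assms(2)] L(2) assms(3) by auto
  hence "\<psi> \<in> set L" by (metis count_list_0_iff)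
  hence "\<phi> = (\<lambda>g. \<psi> g + (\<Sum>\<chi>\<leftarrow>remove1 \<psi> L. \<chi> g))"
    unfolding L(2) by (auto simp: sum_list_map_remove1)
  moreover have "set (remove1 \<psi> L) \<subseteq> Irr G" using L(1) set_remove1_subset by fast
  ultimately show ?thesis
    using sum_list_Irr_characters[of "remove1 \<psi> L"] assms(2) Irr_characters
    unfolding constituent_def by blast
qed

text \<open>A proper nonzero invariant subspace splits the character into two nonzero ones, so that
  at least two irreducibles occur, counted with multiplicity. The sum of the squared multiplicities
  is then at least two.\<close>

lemma irreducible_if_ip_self:
  assumes r: "representation G d \<rho>" and d: "d > 0"
    and one: "ip (char \<rho>) (char \<rho>) = 1"
  shows "irreducible_representation G d \<rho>"
proof (rule ccontr)
  assume "\<not> ?thesis"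
  then obtain W where W: "VectorSpace.subspace class_ring W (module_vec TYPE(complex) d)"
    "\<forall>g\<in>carrier G. \<forall>w\<in>W. \<rho> g *\<^sub>v w \<in> W" "W \<noteq> {0\<^sub>v d}" "W \<noteq> carrier_vec d"
    using r d by (auto simp: irreducible_representation_def)
  obtain k l \<sigma> \<tau> where kl: "0 < k" "k < d" "0 < l" "l < d"
    "representation G k \<sigma>" "representation G l \<tau>"
    and eq: "char \<rho> = (\<lambda>g. char \<sigma> g + char \<tau> g)"
    using character_of_invariant_subspace[OF r W(1) _ W(3,4)] W(2) by metis
  have "char \<sigma> \<in> characters G" "char \<tau> \<in> characters G"
    using kl by (auto simp: characters_def)
  then obtain L M where L: "set L \<subseteq> Irr G" "char \<sigma> = (\<lambda>g. \<Sum>\<chi>\<leftarrow>L. \<chi> g)"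
    and M: "set M \<subseteq> Irr G" "char \<tau> = (\<lambda>g. \<Sum>\<chi>\<leftarrow>M. \<chi> g)"
    using character_irr_decomposition by metis
  have nz: "char \<sigma> \<one> \<noteq> 0" "char \<tau> \<one> \<noteq> 0"
    using \<open>char \<sigma> \<in> _\<close> \<open>char \<tau> \<in> _\<close> character_one_nonzero by blast+
  have "L \<noteq> []" "M \<noteq> []" using nz L(2) M(2) by auto
  hence "length (L @ M) \<ge> 2" by (cases L; cases M) auto
  moreover have LM: "set (L @ M) \<subseteq> Irr G" "char \<rho> = (\<lambda>g. \<Sum>\<chi>\<leftarrow>L @ M. \<chi> g)"
    using L M eq by auto
  have "of_nat (\<Sum>\<chi>\<leftarrow>L @ M. count_list (L @ M) \<chi>) = (of_nat 1 :: complex)"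
    using ip_sum_list_self[OF LM(1)] one unfolding LM(2) by simp
  hence "(\<Sum>\<chi>\<leftarrow>L @ M. count_list (L @ M) \<chi>) = 1" unfolding of_nat_eq_iff .
  ultimately show False using sum_count_list_ge[of "L @ M" "L @ M"] by simp
qed

lemma Irr_if_ip_self:
  assumes "\<phi> \<in> characters G" "ip \<phi> \<phi> = 1"
  shows "\<phi> \<in> Irr G"
proof -
  obtain d \<rho> where "representation G d \<rho>" "d > 0" "\<phi> = char \<rho>"
    using assms(1) by (auto simp: characters_def)
  thus ?thesis using irreducible_if_ip_self[of d \<rho>] assms(2) unfolding Irr_def by blast
qed

text \<open>This is the contragredient representation, the matrix form of the dual space; through it
  spaces of linear maps become tensor products.\<close>

lemma character_inv_apply:
  assumes "representation G d \<rho>"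
  shows "representation G d (\<lambda>g. (\<rho> (inv g))\<^sup>T)"
    and "g \<in> carrier G \<Longrightarrow> char (\<lambda>g. (\<rho> (inv g))\<^sup>T) g = char \<rho> (inv g)"
proof -
  note R = representationD[OF assms]
  show "representation G d (\<lambda>g. (\<rho> (inv g))\<^sup>T)"
  proof (rule representationI)
    fix g h assume gh: "g \<in> carrier G" "h \<in> carrier G"
    have "\<rho> (inv (g \<otimes> h)) = \<rho> (inv h) * \<rho> (inv g)"
      using R(2)[of "inv h" "inv g"] gh by (simp add: inv_mult_group)
    thus "(\<rho> (inv (g \<otimes> h)))\<^sup>T = (\<rho> (inv g))\<^sup>T * (\<rho> (inv h))\<^sup>T"
      using R(1)[of "inv g"] R(1)[of "inv h"] gh by (simp add: transpose_mult[of _ d d _ d])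
  qed (use R in auto)
  show "char (\<lambda>g. (\<rho> (inv g))\<^sup>T) g = char \<rho> (inv g)" if "g \<in> carrier G"
    using that R(1)[of "inv g"] by (simp add: character_of_apply mat_trace_def)
qed

lemma character_of_conj:
  assumes "representation G d \<rho>" "g \<in> carrier G" "h \<in> carrier G"
  shows "char \<rho> (h \<otimes> g \<otimes> inv h) = char \<rho> g"
proof -
  note R = representationD[OF assms(1)]
  have "\<rho> (h \<otimes> g \<otimes> inv h) = \<rho> h * \<rho> g * \<rho> (inv h)"
    using R(2) assms by simp
  thus ?thesis
    using mat_trace_conj[OF R(1)[OF assms(2)], of "\<rho> (inv h)" "\<rho> h"] R(1)[of h] R(1)[of "inv h"] assms
      representation_inverse[OF assms(1,3)] by (simp add: character_of_apply)
qed

subsection \<open>Walks in the McKay graph\<close>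

text \<open>The pairing of \<open>\<gamma> \<phi>\<close> with \<open>\<psi>\<close> is the sum of
  the pairings over a decomposition of \<open>\<phi>\<close>, so some irreducible of
  \<open>\<phi>\<close> contributes. It serves as the vertex before \<open>\<psi>\<close> on a
  walk.\<close>

lemma power_step:
  assumes \<gamma>: "\<gamma> \<in> characters G" and \<phi>: "\<phi> \<in> characters G" and \<psi>: "\<psi> \<in> Irr G"
    and nz: "ip (\<lambda>g. \<gamma> g * \<phi> g) \<psi> \<noteq> 0"
  obtains \<chi> where "\<chi> \<in> Irr G" "ip \<phi> \<chi> \<noteq> 0" "ip (\<lambda>g. \<gamma> g * \<chi> g) \<psi> \<noteq> 0"
proof -
  obtain L where L: "set L \<subseteq> Irr G" "\<phi> = (\<lambda>g. \<Sum>\<chi>\<leftarrow>L. \<chi> g)"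
    using character_irr_decomposition[OF \<phi>] by metis
  have "ip (\<lambda>g. \<gamma> g * \<phi> g) \<psi> = (\<Sum>\<chi>\<leftarrow>L. ip (\<lambda>g. \<gamma> g * \<chi> g) \<psi>)"
    using ip_sum_list_left[where f = "\<lambda>\<chi> g. \<gamma> g * \<chi> g"] by (simp add: L(2) sum_list_const_mult)
  have "\<exists>\<chi>\<in>set L. ip (\<lambda>g. \<gamma> g * \<chi> g) \<psi> \<noteq> 0"
  proof (rule ccontr)
    assume "\<not> ?thesis"
    hence "(\<Sum>\<chi>\<leftarrow>L. ip (\<lambda>g. \<gamma> g * \<chi> g) \<psi>) = 0" by (intro sum_list_neutral) auto
    with nz \<open>ip (\<lambda>g. \<gamma> g * \<phi> g) \<psi> = _\<close> show False by simp
  qed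
  then obtain \<chi> where \<chi>: "\<chi> \<in> set L" "ip (\<lambda>g. \<gamma> g * \<chi> g) \<psi> \<noteq> 0" by auto
  have "ip \<phi> \<chi> = of_nat (count_list L \<chi>)" using ip_sum_list_Irr[OF L(1)] L \<chi> by auto
  moreover have "count_list L \<chi> \<noteq> 0" using \<chi>(1) by (metis count_list_0_iff)
  ultimately show thesis using \<chi> L(1) by (intro that) auto
qed

lemma characters_power_mult:
  "\<gamma> \<in> characters G \<Longrightarrow> \<phi> \<in> characters G \<Longrightarrow> (\<lambda>g. \<gamma> g ^ k * \<phi> g) \<in> characters G"
  by (induction k) (use characters_mult[of \<gamma>] in \<open>auto simp: mult.assoc\<close>)

lemma wf_mckay_graph: "wf_digraph (mckay_graph G \<alpha>)"
  by unfold_locales (auto simp: mckay_graph_def)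

text \<open>The length m of the walk that realises one factor \<open>\<gamma>\<close> is kept
  general: m = 1 with \<open>\<gamma> = \<alpha>\<close> gives ordinary walks, and m = 4 serves the
  diameter bound.\<close>

lemma walk_of_steps:
  assumes \<gamma>: "\<gamma> \<in> characters G" and \<chi>: "\<chi> \<in> Irr G" and "\<psi> \<in> Irr G"
    and "ip (\<lambda>g. \<gamma> g ^ k * \<chi> g) \<psi> \<noteq> 0"
    and step: "\<And>\<theta> \<psi>. \<theta> \<in> Irr G \<Longrightarrow> \<psi> \<in> Irr G \<Longrightarrow> ip (\<lambda>g. \<gamma> g * \<theta> g) \<psi> \<noteq> 0 \<Longrightarrow>
      \<exists>p. pre_digraph.awalk (mckay_graph G \<alpha>) \<theta> p \<psi> \<and> length p = m"
  shows "\<exists>p. pre_digraph.awalk (mckay_graph G \<alpha>) \<chi> p \<psi> \<and> length p = m * k"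
  using assms(3,4)
proof (induction k arbitrary: \<psi>)
  case 0
  hence "\<chi> = \<psi>" using ip_Irr[OF \<chi> 0(1)] by (auto split: if_splits)
  thus ?case using \<chi> by (auto simp: pre_digraph.awalk_def pre_digraph.cas.simps mckay_graph_def)
next
  case (Suc k)
  interpret wf_digraph "mckay_graph G \<alpha>" by (rule wf_mckay_graph)
  have \<chi>c: "\<chi> \<in> characters G" using \<chi> Irr_characters by auto
  have "ip (\<lambda>g. \<gamma> g * (\<gamma> g ^ k * \<chi> g)) \<psi> \<noteq> 0" using Suc.prems(2) by (simp add: mult.assoc)
  then obtain \<theta> where \<theta>: "\<theta> \<in> Irr G" "ip (\<lambda>g. \<gamma> g ^ k * \<chi> g) \<theta> \<noteq> 0" "ip (\<lambda>g. \<gamma> g * \<theta> g) \<psi> \<noteq> 0"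
    using power_step[OF \<gamma> characters_power_mult[OF \<gamma> \<chi>c] Suc.prems(1)] by metis
  from Suc.IH[OF \<theta>(1,2)] obtain p where p: "awalk \<chi> p \<theta>" "length p = m * k" by auto
  from step[OF \<theta>(1) Suc.prems(1) \<theta>(3)] obtain q where q: "awalk \<theta> q \<psi>" "length q = m" by auto
  from awalk_appendI[OF p(1) q(1)] p(2) q(2) show ?case by (intro exI[of _ "p @ q"]) auto
qed

lemma mckay_walk:
  assumes \<alpha>: "\<alpha> \<in> characters G" and "\<chi> \<in> Irr G" "\<psi> \<in> Irr G" "ip (\<lambda>g. \<alpha> g ^ k * \<chi> g) \<psi> \<noteq> 0"
  shows "\<exists>p. pre_digraph.awalk (mckay_graph G \<alpha>) \<chi> p \<psi> \<and> length p = k"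
proof -
  interpret wf_digraph "mckay_graph G \<alpha>" by (rule wf_mckay_graph)
  have "\<exists>p. awalk \<theta> p \<psi> \<and> length p = 1"
    if \<theta>: "\<theta> \<in> Irr G" "\<psi> \<in> Irr G" "ip (\<lambda>g. \<alpha> g * \<theta> g) \<psi> \<noteq> 0" for \<theta> \<psi>
  proof -
    have "constituent G \<psi> (\<lambda>g. \<alpha> g * \<theta> g)"
      using \<theta> Irr_characters characters_mult[OF \<alpha>] by (intro constituentI) auto
    hence "(\<theta>, \<psi>) \<in> arcs (mckay_graph G \<alpha>)" "tail (mckay_graph G \<alpha>) (\<theta>, \<psi>) = \<theta>"
      "head (mckay_graph G \<alpha>) (\<theta>, \<psi>) = \<psi>" "\<psi> \<in> verts (mckay_graph G \<alpha>)"
      using \<theta>(1,2) by (auto simp: mckay_graph_def)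
    hence "awalk \<theta> [(\<theta>, \<psi>)] \<psi>" by (simp add: awalk_Cons_iff awalk_Nil_iff)
    thus ?thesis by (intro exI[of _ "[(\<theta>, \<psi>)]"]) simp
  qed
  from walk_of_steps[OF assms this] show ?thesis by simp
qed

text \<open>Multiplicities are natural numbers, so what \<open>\<gamma>\<close> contributes to a
  multiplicity in \<open>\<alpha> ^ m\<close> cannot be cancelled by the remainder
  \<open>\<beta>\<close>.\<close>

lemma mckay_walk_power:
  assumes \<alpha>: "\<alpha> \<in> characters G" and \<gamma>: "\<gamma> \<in> characters G"
    and \<beta>: "\<beta> \<in> characters G \<or> \<beta> = (\<lambda>g. 0)" and dec: "(\<lambda>g. \<alpha> g ^ m) = (\<lambda>g. \<gamma> g + \<beta> g)"
    and \<chi>: "\<chi> \<in> Irr G" "\<psi> \<in> Irr G" "ip (\<lambda>g. \<gamma> g ^ k * \<chi> g) \<psi> \<noteq> 0"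
  shows "\<exists>p. pre_digraph.awalk (mckay_graph G \<alpha>) \<chi> p \<psi> \<and> length p = m * k"
proof (rule walk_of_steps[OF \<gamma> \<chi>])
  fix \<theta> \<psi> assume \<theta>: "\<theta> \<in> Irr G" "\<psi> \<in> Irr G" "ip (\<lambda>g. \<gamma> g * \<theta> g) \<psi> \<noteq> 0"
  have \<theta>c: "\<theta> \<in> characters G" using \<theta> Irr_characters by auto
  obtain a :: nat where a: "ip (\<lambda>g. \<gamma> g * \<theta> g) \<psi> = of_nat a"
    using ip_character_Irr[OF characters_mult[OF \<gamma> \<theta>c] \<theta>(2)] by metis
  obtain b :: nat where b: "ip (\<lambda>g. \<beta> g * \<theta> g) \<psi> = of_nat b"
  proof (cases "\<beta> = (\<lambda>g. 0)")
    case True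
    thus thesis using that[of 0] by (simp add: ip_def)
  next
    case False
    thus thesis using \<beta> ip_character_Irr[OF characters_mult[OF _ \<theta>c] \<theta>(2)] that by metis
  qed
  have "ip (\<lambda>g. \<alpha> g ^ m * \<theta> g) \<psi> = ip (\<lambda>g. \<gamma> g * \<theta> g + \<beta> g * \<theta> g) \<psi>"
    using fun_cong[OF dec] by (simp add: ring_distribs)
  also have "\<dots> = of_nat (a + b)" by (simp add: ip_add_left a b)
  also have "\<dots> \<noteq> (0 :: complex)" using \<theta>(3) a by (simp only: of_nat_eq_0_iff)
  finally show "\<exists>p. pre_digraph.awalk (mckay_graph G \<alpha>) \<theta> p \<psi> \<and> length p = m"
    by (rule mckay_walk[OF \<alpha> \<theta>(1,2)])
qed

end

text \<open>The diameter is defined by paths without repeated vertices, whereas composing steps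
  produces walks. Cutting out closed subwalks only shortens them.\<close>

lemma (in wf_digraph) shorter_apath:
  assumes "awalk u p v"
  shows "\<exists>q. apath u q v \<and> length q \<le> length p"
  using assms
proof (induct rule: awalk_to_apath_induct)
  case (path p)
  thus ?case by (auto simp: apath_def)
next
  case (decomp p q r s)
  have "p = q @ r @ s"
    using awalk_cyc_decomp_has_prop[OF decomp(1,3)] decomp(2) by auto
  thus ?case using decomp(4) by auto
qed

context finite_group
begin

section \<open>Averaging projections, fixed vectors and orbit counting\<close>

definition mat_average :: "nat \<Rightarrow> ('a \<Rightarrow> complex mat) \<Rightarrow> 'a set \<Rightarrow> complex mat"
  where "mat_average N S K = (1 / of_nat (card K)) \<cdot>\<^sub>m msum N N S K"

lemma mat_average_carrier [simp, intro]: "mat_average N S K \<in> carrier_mat N N"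
  by (simp add: mat_average_def)

lemma msum_const:
  assumes "M \<in> carrier_mat r c" "\<And>k. k \<in> K \<Longrightarrow> f k = M"
  shows "msum r c f K = of_nat (card K) \<cdot>\<^sub>m M"
  using assms by (intro eq_matI) (auto simp: msum_def)

lemma mat_average_absorb:
  assumes S: "\<And>k. k \<in> K \<Longrightarrow> S k \<in> carrier_mat N N" and K: "finite K" "K \<noteq> {}"
    and M: "M \<in> carrier_mat N N"
  shows "(\<And>k. k \<in> K \<Longrightarrow> S k * M = M) \<Longrightarrow> mat_average N S K * M = M"
    and "(\<And>k. k \<in> K \<Longrightarrow> M * S k = M) \<Longrightarrow> M * mat_average N S K = M"
proof -
  have c: "of_nat (card K) \<noteq> (0 :: complex)" using K by auto
  have unscale: "(1 / of_nat (card K)) \<cdot>\<^sub>m (of_nat (card K) \<cdot>\<^sub>m M) = M"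
    using c by (intro eq_matI) auto
  show "mat_average N S K * M = M" if a: "\<And>k. k \<in> K \<Longrightarrow> S k * M = M"
  proof -
    have "mat_average N S K * M = (1 / of_nat (card K)) \<cdot>\<^sub>m (msum N N S K * M)"
      unfolding mat_average_def by (rule mult_smult_assoc_mat[OF msum_carrier M])
    also have "msum N N S K * M = msum N N (\<lambda>k. S k * M) K" by (rule msum_mult[OF M S])
    also have "\<dots> = of_nat (card K) \<cdot>\<^sub>m M" by (rule msum_const[OF M a])
    finally show ?thesis unfolding unscale .
  qed
  show "M * mat_average N S K = M" if a: "\<And>k. k \<in> K \<Longrightarrow> M * S k = M"
  proof -
    have "M * mat_average N S K = (1 / of_nat (card K)) \<cdot>\<^sub>m (M * msum N N S K)"
      unfolding mat_average_def by (rule mult_smult_distrib[OF M msum_carrier])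
    also have "M * msum N N S K = msum N N (\<lambda>k. M * S k) K" by (rule mult_msum[OF M S])
    also have "\<dots> = of_nat (card K) \<cdot>\<^sub>m M" by (rule msum_const[OF M a])
    finally show ?thesis unfolding unscale .
  qed
qed

lemma mat_average_fixes:
  assumes S: "\<And>k. k \<in> K \<Longrightarrow> S k \<in> carrier_mat N N" and K: "finite K" "K \<noteq> {}"
    and v: "v \<in> carrier_vec N" and fix_v: "\<And>k. k \<in> K \<Longrightarrow> S k *\<^sub>v v = v"
  shows "mat_average N S K *\<^sub>v v = v"
proof -
  have "msum N N S K *\<^sub>v v = vec N (\<lambda>i. \<Sum>s\<in>K. (S s *\<^sub>v v) $ i)"
    by (rule msum_mult_vec[OF v S])
  also have "\<dots> = of_nat (card K) \<cdot>\<^sub>v v"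
    using v fix_v by (intro eq_vecI) auto
  finally have e: "msum N N S K *\<^sub>v v = of_nat (card K) \<cdot>\<^sub>v v" .
  have "mat_average N S K *\<^sub>v v = (1 / of_nat (card K)) \<cdot>\<^sub>v (msum N N S K *\<^sub>v v)"
    unfolding mat_average_def using v by (intro eq_vecI) (auto simp: mult_mat_vec_index[OF _ v])
  also have "\<dots> = v" unfolding e using K by (intro eq_vecI) auto
  finally show ?thesis .
qed

lemma mat_average_subgroup:
  assumes r: "representation G N S" and K: "subgroup K G" and k: "k \<in> K"
  shows "S k * mat_average N S K = mat_average N S K"
    and "mat_average N S K * S k = mat_average N S K"
proof -
  note R = representationD[OF r]
  have KG: "K \<subseteq> carrier G" using K by (rule subgroup.subset)
  have c: "S h \<in> carrier_mat N N" if "h \<in> K" for h using R KG that by auto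
  have bl: "bij_betw (\<lambda>g. k \<otimes> g) K K"
    by (rule bij_betw_byWitness[where f' = "\<lambda>g. inv k \<otimes> g"])
      (use K k KG in \<open>auto simp: m_assoc[symmetric] subsetD subgroup.m_closed subgroup.m_inv_closed\<close>)
  have br: "bij_betw (\<lambda>g. g \<otimes> k) K K"
    by (rule bij_betw_byWitness[where f' = "\<lambda>g. g \<otimes> inv k"])
      (use K k KG in \<open>auto simp: m_assoc subsetD subgroup.m_closed subgroup.m_inv_closed\<close>)
  have "S k * msum N N S K = msum N N (\<lambda>g. S k * S g) K" by (rule mult_msum[OF c[OF k] c])
  also have "\<dots> = msum N N (\<lambda>g. S (k \<otimes> g)) K" by (intro msum_cong refl R(2)[symmetric] subsetD[OF KG] k)
  also have "\<dots> = msum N N S K" by (rule msum_reindex[OF bl])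
  finally show "S k * mat_average N S K = mat_average N S K"
    unfolding mat_average_def using mult_smult_distrib[OF c[OF k] msum_carrier[of N N S K]] by (simp only:)
  have "msum N N S K * S k = msum N N (\<lambda>g. S g * S k) K" by (rule msum_mult[OF c[OF k] c])
  also have "\<dots> = msum N N (\<lambda>g. S (g \<otimes> k)) K" by (intro msum_cong refl R(2)[symmetric] subsetD[OF KG] k)
  also have "\<dots> = msum N N S K" by (rule msum_reindex[OF br])
  finally show "mat_average N S K * S k = mat_average N S K"
    unfolding mat_average_def using mult_smult_assoc_mat[OF msum_carrier[of N N S K] c[OF k]] by (simp only:)
qed

text \<open>For a subgroup \<open>K\<close> the average is the projection onto the vectors fixed by
  \<open>K\<close>, so this number is the dimension of the fixed space.\<close>

lemma mat_trace_average:
  assumes r: "representation G N S" and K: "K \<subseteq> carrier G"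
  shows "mat_trace (mat_average N S K) = (\<Sum>g\<in>K. char S g) / of_nat (card K)"
proof -
  have "mat_trace (mat_average N S K) = (1 / of_nat (card K)) * mat_trace (msum N N S K)"
    by (simp add: mat_average_def mat_trace_def sum_distrib_left)
  also have "mat_trace (msum N N S K) = (\<Sum>g\<in>K. char S g)"
    unfolding mat_trace_msum using K representationD(1)[OF r]
    by (intro sum.cong refl) (auto simp: character_of_def mat_trace_def subset_iff)
  finally show ?thesis by simp
qed

text \<open>If \<open>P\<close> and \<open>Q\<close> are the averages over \<open>K\<close> and \<open>G\<close> then \<open>P - Q\<close> is an idempotent of
  trace zero.\<close>

lemma fixed_vector_transfer:
  assumes r: "representation G N S" and K: "subgroup K G"
    and eq: "(\<Sum>g\<in>K. char S g) / of_nat (card K) =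
      (\<Sum>g\<in>carrier G. char S g) / of_nat (card (carrier G))"
    and v: "v \<in> carrier_vec N" and fix_v: "\<And>k. k \<in> K \<Longrightarrow> S k *\<^sub>v v = v"
    and g: "g \<in> carrier G"
  shows "S g *\<^sub>v v = v"
proof -
  note R = representationD[OF r]
  have KG: "K \<subseteq> carrier G" using K by (rule subgroup.subset)
  have K': "finite K" "K \<noteq> {}" using KG fin finite_subset subgroup.one_closed[OF K] by auto
  have G': "finite (carrier G)" "carrier G \<noteq> {}" using fin one_closed by auto
  have cK: "S k \<in> carrier_mat N N" if "k \<in> K" for k using R KG that by auto
  define P where "P = mat_average N S K"
  define Q where "Q = mat_average N S (carrier G)"
  have P: "P \<in> carrier_mat N N" and Q: "Q \<in> carrier_mat N N" by (auto simp: P_def Q_def)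
  note aK = mat_average_subgroup[OF r K] and aG = mat_average_subgroup[OF r subgroup_self]
  have PP: "P * P = P" unfolding P_def
    by (rule mat_average_absorb(1)[OF cK K' mat_average_carrier aK(1)])
  have QQ: "Q * Q = Q" unfolding Q_def
    by (rule mat_average_absorb(1)[OF R(1) G' mat_average_carrier aG(1)])
  \<comment> \<open>\<open>Q\<close> absorbs \<open>P\<close> on both sides because \<open>K\<close>
    is contained in G; this is what makes the difference of the two projections idempotent.\<close>
  have PQ: "P * Q = Q" unfolding P_def Q_def
    by (rule mat_average_absorb(1)[OF cK K' mat_average_carrier aG(1)]) (use KG in auto)
  have QP: "Q * P = Q" unfolding P_def Q_def
    by (rule mat_average_absorb(2)[OF cK K' mat_average_carrier aG(2)]) (use KG in auto)
  have d: "P - Q \<in> carrier_mat N N" using Q by (rule minus_carrier_mat)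
  have "(P - Q) * (P - Q) = (P * P - Q * P) - (P * Q - Q * Q)"
    using P Q d by (simp add: mult_minus_distrib_mat[of _ N N _ N] minus_mult_distrib_mat[of _ N N _ _ N])
  also have "\<dots> = P - Q" unfolding PP QQ PQ QP using P Q by (intro eq_matI) auto
  finally have idem: "(P - Q) * (P - Q) = P - Q" .
  have "mat_trace (P - Q) = 0"
    using mat_trace_diff[OF P Q] mat_trace_average[OF r KG] mat_trace_average[OF r subset_refl] eq
    by (simp add: P_def Q_def)
  hence zero: "P - Q = 0\<^sub>m N N" by (rule idempotent_trace_zero[OF d idem])
  have "P $$ (i, j) = Q $$ (i, j)" if "i < N" "j < N" for i j
  proof -
    have "(P - Q) $$ (i, j) = 0" using zero that by simp
    thus ?thesis using that P Q by simp
  qed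
  hence "P = Q" using P Q by (intro eq_matI) auto
  moreover have "P *\<^sub>v v = v"
    unfolding P_def by (rule mat_average_fixes[OF _ K' v]) (use cK fix_v in auto)
  ultimately have Qv: "Q *\<^sub>v v = v" by simp
  have "S g *\<^sub>v v = (S g * Q) *\<^sub>v v" using assoc_mult_mat_vec[OF R(1)[OF g] Q v] Qv by simp
  also have "\<dots> = v" using aG(1)[OF g] Qv by (simp add: Q_def)
  finally show ?thesis .
qed

text \<open>Orbit counting for a transitive action, with the orbit-stabiliser formula as second
  part. The elements that carry w to w' form a coset of the stabiliser of w, so these sets all have
  the same size; then the pairs (g, w) with w fixed by g are counted in two ways.\<close>

lemma sum_card_fixed_points:
  fixes act :: "'a \<Rightarrow> 'c \<Rightarrow> 'c"
  assumes \<Omega>: "finite \<Omega>" "\<Omega> \<noteq> {}"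
    and closed: "\<And>g w. g \<in> carrier G \<Longrightarrow> w \<in> \<Omega> \<Longrightarrow> act g w \<in> \<Omega>"
    and act_mult: "\<And>g h w. g \<in> carrier G \<Longrightarrow> h \<in> carrier G \<Longrightarrow> w \<in> \<Omega> \<Longrightarrow> act (g \<otimes> h) w = act g (act h w)"
    and act_one: "\<And>w. w \<in> \<Omega> \<Longrightarrow> act \<one> w = w"
    and trans: "\<And>w w'. w \<in> \<Omega> \<Longrightarrow> w' \<in> \<Omega> \<Longrightarrow> \<exists>g\<in>carrier G. act g w = w'"
  shows "(\<Sum>g\<in>carrier G. card {w \<in> \<Omega>. act g w = w}) = card (carrier G)"
    and "w \<in> \<Omega> \<Longrightarrow> card \<Omega> * card {g \<in> carrier G. act g w = w} = card (carrier G)"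
proof -
  have count: "(\<Sum>w'\<in>\<Omega>. card {g \<in> carrier G. act g w = w'}) = card (carrier G)" if w: "w \<in> \<Omega>" for w
  proof -
    have "carrier G = (\<Union>w'\<in>\<Omega>. {g \<in> carrier G. act g w = w'})" using closed w by auto
    also have "card \<dots> = (\<Sum>w'\<in>\<Omega>. card {g \<in> carrier G. act g w = w'})"
      using \<Omega> fin by (intro card_UN_disjoint) auto
    finally show ?thesis by simp
  qed
  have orbit: "card \<Omega> * card {g \<in> carrier G. act g w = w} = card (carrier G)" if w: "w \<in> \<Omega>" for w
  proof -
    have "card {g \<in> carrier G. act g w = w'} = card {g \<in> carrier G. act g w = w}" if w': "w' \<in> \<Omega>" for w'
    proof -
      obtain h where h: "h \<in> carrier G" "act h w = w'" using trans[OF w w'] by blast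
      have h': "act (inv h) w' = w"
        using act_mult[of "inv h" h w] h w act_one by simp
      have "bij_betw (\<lambda>g. h \<otimes> g) {g \<in> carrier G. act g w = w} {g \<in> carrier G. act g w = w'}"
      proof (rule bij_betw_byWitness[where f' = "\<lambda>g. inv h \<otimes> g"])
        show "(\<lambda>g. h \<otimes> g) ` {g \<in> carrier G. act g w = w} \<subseteq> {g \<in> carrier G. act g w = w'}"
          using h act_mult[OF h(1) _ w] by auto
        show "(\<lambda>g. inv h \<otimes> g) ` {g \<in> carrier G. act g w = w'} \<subseteq> {g \<in> carrier G. act g w = w}"
          using h h' act_mult[OF inv_closed[OF h(1)] _ w] by auto
      qed (use h in \<open>simp_all add: m_assoc[symmetric]\<close>)
      thus ?thesis by (rule bij_betw_same_card[symmetric])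
    qed
    hence "(\<Sum>w'\<in>\<Omega>. card {g \<in> carrier G. act g w = w'}) = (\<Sum>w'\<in>\<Omega>. card {g \<in> carrier G. act g w = w})"
      by (intro sum.cong) auto
    thus ?thesis using count[OF w] by simp
  qed
  obtain w0 where w0: "w0 \<in> \<Omega>" using \<Omega> by auto
  have "(\<Sum>g\<in>carrier G. card {w \<in> \<Omega>. act g w = w}) = (\<Sum>g\<in>carrier G. \<Sum>w\<in>\<Omega>. if act g w = w then 1 else 0)"
    unfolding card_eq_sum sum.inter_filter[OF \<Omega>(1)] ..
  also have "\<dots> = (\<Sum>w\<in>\<Omega>. \<Sum>g\<in>carrier G. if act g w = w then 1 else 0)" by (rule sum.swap)
  also have "\<dots> = (\<Sum>w\<in>\<Omega>. card {g \<in> carrier G. act g w = w})"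
    unfolding card_eq_sum sum.inter_filter[OF fin] ..
  also have "\<dots> = (\<Sum>w\<in>\<Omega>. card {g \<in> carrier G. act g w0 = w0})"
  proof (rule sum.cong[OF refl])
    fix w assume "w \<in> \<Omega>"
    from orbit[OF this] orbit[OF w0]
    have "card \<Omega> * card {g \<in> carrier G. act g w = w} = card \<Omega> * card {g \<in> carrier G. act g w0 = w0}"
      by simp
    thus "card {g \<in> carrier G. act g w = w} = card {g \<in> carrier G. act g w0 = w0}"
      using \<Omega> by simp
  qed
  also have "\<dots> = card (carrier G)" using orbit[OF w0] by simp
  finally show "(\<Sum>g\<in>carrier G. card {w \<in> \<Omega>. act g w = w}) = card (carrier G)" .
  show "w \<in> \<Omega> \<Longrightarrow> card \<Omega> * card {g \<in> carrier G. act g w = w} = card (carrier G)" by (rule orbit)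
qed

end

section \<open>Alternating and symmetric groups\<close>

text \<open>Both groups are treated at once. The arguments rest on two shared features: every even
  permutation of the points lies in G, and conjugation by a fixed transposition maps G to
  itself.\<close>

locale alt_or_sym =
  fixes n :: nat and G :: "(nat \<Rightarrow> nat) monoid" (structure)
  assumes n5: "n \<ge> 5" and G_cases: "G = alt_group n \<or> G = sym_group n"
begin

lemma mult_eq [simp]: "g \<otimes> h = g \<circ> h" and one_eq [simp]: "\<one> = id"
  using G_cases alt_group_mult alt_group_one sym_group_mult sym_group_one by auto

lemma carrier_permutes: "g \<in> carrier G \<Longrightarrow> g permutes {1..n}"
  using G_cases by (auto simp: alt_group_carrier sym_group_carrier)

lemma even_carrier: "g permutes {1..n} \<Longrightarrow> evenperm g \<Longrightarrow> g \<in> carrier G"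
  using G_cases by (auto simp: alt_group_carrier sym_group_carrier)

end

sublocale alt_or_sym \<subseteq> finite_group
proof -
  have "finite (carrier G)"
    by (rule finite_subset[OF _ finite_permutations[of "{1..n}"]]) (auto dest: carrier_permutes)
  moreover have "group G" using G_cases alt_group_is_group sym_group_is_group by auto
  ultimately show "finite_group G" by (simp add: finite_group_def finite_group_axioms_def)
qed

context alt_or_sym
begin

lemma inv_eq: "g \<in> carrier G \<Longrightarrow> inv g = inv' g"
proof (rule inv_equality)
  assume g: "g \<in> carrier G"
  have p: "g permutes {1..n}" by (rule carrier_permutes[OF g])
  show "inv' g \<otimes> g = \<one>" using permutes_inv_o(2)[OF p] by simp
  have "permutation g" using p permutation_permutes by blast
  with g p permutes_inv[OF p] show "inv' g \<in> carrier G"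
    using G_cases by (auto simp: alt_group_carrier sym_group_carrier evenperm_inv)
qed auto

lemma carrier_in: "g \<in> carrier G \<Longrightarrow> g x \<in> {1..n} \<longleftrightarrow> x \<in> {1..n}"
  by (rule permutes_in_image[OF carrier_permutes])

lemma carrier_inj: "g \<in> carrier G \<Longrightarrow> g x = g y \<longleftrightarrow> x = y"
  using permutes_inj[OF carrier_permutes] by (auto dest: injD)

lemma inv_apply: "g \<in> carrier G \<Longrightarrow> (inv g) (g x) = x" "g \<in> carrier G \<Longrightarrow> g ((inv g) x) = x"
  using r_inv[of g] l_inv[of g] by (simp_all del: r_inv l_inv add: fun_eq_iff)

text \<open>A product \<open>t\<close> of at most two transpositions moves (a, b) to (c, d). If it
  is odd, it is first composed with a transposition of two points other than a and b, which corrects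
  the sign and leaves the images of a and b alone.\<close>

lemma two_transitive:
  assumes "a \<in> {1..n}" "b \<in> {1..n}" "c \<in> {1..n}" "d \<in> {1..n}" "a \<noteq> b" "c \<noteq> d"
  obtains g where "g \<in> carrier G" "g a = c" "g b = d"
proof -
  define s where "s = Transposition.transpose a c"
  define t where "t = Transposition.transpose (s b) d \<circ> s"
  have s: "s permutes {1..n}" using assms by (simp add: s_def permutes_swap_id)
  have "s b \<in> {1..n}" using permutes_in_image[OF s] assms by simp
  hence t: "t permutes {1..n}" unfolding t_def
    by (intro permutes_compose[OF s]) (use assms in \<open>auto intro: permutes_swap_id\<close>)
  have "s a = c" by (simp add: s_def)
  moreover have "s b \<noteq> c" using permutes_inj[OF s] assms \<open>s a = c\<close> by (metis injD)
  ultimately have ta: "t a = c" and tb: "t b = d" using assms by (auto simp: t_def Transposition.transpose_def)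
  have "\<not> card ({1..n} - {a, b}) \<le> Suc 0" using assms n5 by (simp add: card_Diff_subset)
  then obtain x y where xy: "x \<in> {1..n} - {a, b}" "y \<in> {1..n} - {a, b}" "x \<noteq> y"
    unfolding card_le_Suc0_iff_eq[OF finite_Diff[OF finite_atLeastAtMost]] by blast
  define u where "u = t \<circ> Transposition.transpose x y"
  have u: "u permutes {1..n}" unfolding u_def
    by (rule permutes_compose[OF _ t]) (use xy in \<open>auto intro: permutes_swap_id\<close>)
  have "permutation t" using t permutation_permutes by blast
  hence ev: "evenperm u \<longleftrightarrow> \<not> evenperm t" unfolding u_def
    using xy by (simp add: evenperm_comp permutation_swap_id evenperm_swap)
  have "u a = c" "u b = d" using xy ta tb by (auto simp: u_def Transposition.transpose_def)
  with ta tb ev t u show thesis using that even_carrier by (cases "evenperm t") auto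
qed

lemma transitive:
  assumes "a \<in> {1..n}" "c \<in> {1..n}"
  obtains g where "g \<in> carrier G" "g a = c"
proof -
  define b where "b = (if a = 1 then 2 else 1 :: nat)"
  define d where "d = (if c = 1 then 2 else 1 :: nat)"
  have "b \<in> {1..n}" "d \<in> {1..n}" "a \<noteq> b" "c \<noteq> d" using n5 by (auto simp: b_def d_def)
  with assms show thesis using two_transitive that by metis
qed

section \<open>The deleted permutation character\<close>

definition fixp :: "(nat \<Rightarrow> nat) \<Rightarrow> nat"
  where "fixp g = card {x \<in> {1..n}. g x = x}"

definition \<gamma> :: "(nat \<Rightarrow> nat) \<Rightarrow> complex"
  where "\<gamma> g = (if g \<in> carrier G then of_nat (fixp g) - 1 else 0)"

lemma sum_fixp: "(\<Sum>g\<in>carrier G. fixp g) = card (carrier G)"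
  unfolding fixp_def
proof (rule sum_card_fixed_points(1)[where act = "\<lambda>g. g" and \<Omega> = "{1..n}"])
  show "\<exists>g\<in>carrier G. g w = w'" if "w \<in> {1..n}" "w' \<in> {1..n}" for w w'
    using transitive[OF that] by metis
  show "g w \<in> {1..n}" if "g \<in> carrier G" "w \<in> {1..n}" for g w
    using carrier_in[OF that(1)] that by simp
qed (use n5 in auto)

abbreviation stab :: "nat \<Rightarrow> (nat \<Rightarrow> nat) set"
  where "stab x \<equiv> {g \<in> carrier G. g x = x}"

lemma card_stabiliser:
  assumes "x \<in> {1..n}"
  shows "n * card (stab x) = card (carrier G)"
proof -
  have "card {1..n} * card {g \<in> carrier G. g x = x} = card (carrier G)"
  proof (rule sum_card_fixed_points(2)[where act = "\<lambda>g. g" and \<Omega> = "{1..n}"])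
    show "\<exists>g\<in>carrier G. g w = w'" if "w \<in> {1..n}" "w' \<in> {1..n}" for w w'
      using transitive[OF that] by metis
    show "g w \<in> {1..n}" if "g \<in> carrier G" "w \<in> {1..n}" for g w
      using carrier_in[OF that(1)] that by simp
  qed (use n5 assms in auto)
  thus ?thesis by simp
qed

text \<open>The square counts fixed ordered pairs. The diagonal pairs and, by double transitivity,
  the off-diagonal pairs form one orbit each, and each orbit contributes |G|.\<close>

lemma sum_fixp_square: "(\<Sum>g\<in>carrier G. fixp g * fixp g) = 2 * card (carrier G)"
proof -
  define \<Omega> where "\<Omega> = {w \<in> {1..n} \<times> {1..n}. fst w \<noteq> snd w}"
  have "(1, 2) \<in> \<Omega>" using n5 by (auto simp: \<Omega>_def)
  have *: "(\<Sum>g\<in>carrier G. card {w \<in> \<Omega>. map_prod g g w = w}) = card (carrier G)"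
  proof (rule sum_card_fixed_points(1)[where act = "\<lambda>g. map_prod g g"])
    show "\<exists>g\<in>carrier G. map_prod g g w = w'" if "w \<in> \<Omega>" "w' \<in> \<Omega>" for w w'
    proof -
      obtain g where "g \<in> carrier G" "g (fst w) = fst w'" "g (snd w) = snd w'"
        using two_transitive[of "fst w" "snd w" "fst w'" "snd w'"] \<open>w \<in> \<Omega>\<close> \<open>w' \<in> \<Omega>\<close> unfolding \<Omega>_def
        by (auto simp: mem_Times_iff)
      thus ?thesis by (intro bexI[of _ g]) (auto simp: prod_eq_iff)
    qed
    show "map_prod g g w \<in> \<Omega>" if "g \<in> carrier G" "w \<in> \<Omega>" for g w
      using carrier_in[OF that(1)] carrier_inj[OF that(1)] that(2) by (cases w) (auto simp: \<Omega>_def)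
    show "finite \<Omega>" by (auto simp: \<Omega>_def)
  qed (use \<open>(1, 2) \<in> \<Omega>\<close> in \<open>auto simp: map_prod_def split: prod.splits\<close>)
  have "fixp g * fixp g = card {w \<in> \<Omega>. map_prod g g w = w} + fixp g" for g
  proof -
    let ?F = "{x \<in> {1..n}. g x = x}"
    have "fixp g * fixp g = card (?F \<times> ?F)" by (simp add: fixp_def card_cartesian_product)
    also have "?F \<times> ?F = {w \<in> \<Omega>. map_prod g g w = w} \<union> (\<lambda>x. (x, x)) ` ?F" by (auto simp: \<Omega>_def)
    also have "card \<dots> = card {w \<in> \<Omega>. map_prod g g w = w} + card ((\<lambda>x. (x, x)) ` ?F)"
      by (rule card_Un_disjoint) (auto simp: \<Omega>_def intro: finite_subset[of _ "{1..n} \<times> {1..n}"])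
    also have "card ((\<lambda>x. (x, x)) ` ?F) = fixp g"
      unfolding fixp_def by (rule card_image) (auto simp: inj_on_def)
    finally show ?thesis .
  qed
  thus ?thesis using * sum_fixp by (simp add: sum.distrib)
qed

lemma fixp_inv: "g \<in> carrier G \<Longrightarrow> fixp (inv g) = fixp g"
  unfolding fixp_def using inv_apply by (intro arg_cong[where f = card] Collect_cong) metis

lemma fixp_id: "fixp id = n"
proof -
  have "{x \<in> {1..n}. id x = x} = {1..n}" by auto
  thus ?thesis by (simp add: fixp_def)
qed

text \<open>If x is moved then g x is moved as well, so at least two points are not fixed.\<close>

lemma fixp_less:
  assumes g: "g \<in> carrier G" "g \<noteq> id"
  shows "fixp g < n - 1"
proof -
  obtain x where x: "g x \<noteq> x" using g by (auto simp: fun_eq_iff)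
  have p: "g permutes {1..n}" by (rule carrier_permutes[OF g(1)])
  have xn: "x \<in> {1..n}" using x permutes_not_in[OF p] by auto
  have gx: "g x \<in> {1..n}" "g (g x) \<noteq> g x" using x xn carrier_in[OF g(1)] carrier_inj[OF g(1)] by auto
  have "fixp g \<le> card ({1..n} - {x, g x})"
    unfolding fixp_def using x gx by (intro card_mono) auto
  also have "\<dots> = n - 2" using x xn gx by (simp add: card_Diff_subset)
  finally show ?thesis using n5 by simp
qed

text \<open>Matrix indices start at 0 and points at 1: index j stands for the point j + 1.\<close>

definition perm_rep :: "(nat \<Rightarrow> nat) \<Rightarrow> complex mat"
  where "perm_rep g = mat n n (\<lambda>(i, j). if g (j + 1) = i + 1 then 1 else 0)"

lemma perm_rep: "representation G n perm_rep"
proof (rule representationI)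
  show "perm_rep \<one> = 1\<^sub>m n" by (intro eq_matI) (auto simp: perm_rep_def)
  fix g h assume gh: "g \<in> carrier G" "h \<in> carrier G"
  show "perm_rep (g \<otimes> h) = perm_rep g * perm_rep h"
  proof (rule eq_matI)
    fix i j assume "i < dim_row (perm_rep g * perm_rep h)" "j < dim_col (perm_rep g * perm_rep h)"
    hence ij: "i < n" "j < n" by (auto simp: perm_rep_def)
    have hj: "h (j + 1) \<in> {1..n}" using carrier_in[OF gh(2), of "j + 1"] ij by auto
    have "(perm_rep g * perm_rep h) $$ (i, j) = (\<Sum>k<n. perm_rep g $$ (i, k) * perm_rep h $$ (k, j))"
      by (rule mult_index) (use ij in \<open>auto simp: perm_rep_def\<close>)
    also have "\<dots> = (\<Sum>k<n. if k = h (j + 1) - 1 then (if g (h (j + 1)) = i + 1 then 1 else 0) else 0)"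
      using ij hj by (intro sum.cong) (auto simp: perm_rep_def)
    also have "\<dots> = perm_rep (g \<otimes> h) $$ (i, j)"
      using ij hj by (auto simp: perm_rep_def)
    finally show "perm_rep (g \<otimes> h) $$ (i, j) = (perm_rep g * perm_rep h) $$ (i, j)" by simp
  qed (auto simp: perm_rep_def)
qed (auto simp: perm_rep_def)

lemma perm_character: "g \<in> carrier G \<Longrightarrow> char perm_rep g = of_nat (fixp g)"
proof -
  assume g: "g \<in> carrier G"
  have "char perm_rep g = (\<Sum>i<n. if g (i + 1) = i + 1 then 1 else 0)"
    using g by (simp add: character_of_apply mat_trace_def perm_rep_def)
  also have "\<dots> = of_nat (card {i \<in> {..<n}. g (i + 1) = i + 1})"
    by (simp add: sum.inter_filter[symmetric])
  also have "card {i \<in> {..<n}. g (i + 1) = i + 1} = fixp g"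
    unfolding fixp_def
    by (rule bij_betw_same_card[of "\<lambda>i. i + 1"], rule bij_betw_byWitness[where f' = "\<lambda>x. x - 1"]) auto
  finally show ?thesis .
qed

definition triv :: "(nat \<Rightarrow> nat) \<Rightarrow> complex"
  where "triv g = (if g \<in> carrier G then 1 else 0)"

lemma triv_Irr: "triv \<in> Irr G"
proof (rule Irr_if_ip_self)
  have "triv = char (\<lambda>g. 1\<^sub>m 1)" by (auto simp: triv_def character_of_def)
  moreover have "representation G 1 (\<lambda>g. 1\<^sub>m 1)" by (rule representationI) auto
  ultimately show "triv \<in> characters G" unfolding characters_def by blast
  show "ip triv triv = 1" using card_pos by (simp add: ip_def triv_def)
qed

text \<open>The permutation character has norm 2 and contains the trivial character once, so
  \<gamma> has norm 1. Removing the constituent \<open>triv\<close> shows that \<gamma> is an actual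
  character and not just a difference of two; the value n - 1 at the identity rules out a zero
  remainder.\<close>

lemma \<gamma>_Irr: "\<gamma> \<in> Irr G"
proof -
  let ?\<pi> = "char perm_rep"
  have \<pi>: "?\<pi> \<in> characters G" using perm_rep n5 unfolding characters_def by fastforce
  have \<pi>\<gamma>: "?\<pi> = (\<lambda>g. triv g + \<gamma> g)"
    using perm_character by (auto simp: fun_eq_iff triv_def \<gamma>_def character_of_def)
  have ip1: "ip ?\<pi> triv = 1"
  proof -
    have "(\<Sum>g\<in>carrier G. ?\<pi> g * triv (inv g)) = of_nat (\<Sum>g\<in>carrier G. fixp g)"
      by (simp add: perm_character triv_def)
    thus ?thesis using card_pos by (simp add: ip_def sum_fixp)
  qed
  have ip2: "ip ?\<pi> ?\<pi> = 2"
  proof -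
    have "(\<Sum>g\<in>carrier G. ?\<pi> g * ?\<pi> (inv g)) = of_nat (\<Sum>g\<in>carrier G. fixp g * fixp g)"
      by (simp add: perm_character fixp_inv)
    thus ?thesis using card_pos by (simp add: ip_def sum_fixp_square)
  qed
  have t1: "ip triv triv = 1" using ip_Irr[OF triv_Irr triv_Irr] by simp
  have tg: "ip triv \<gamma> = 0" using ip1 unfolding \<pi>\<gamma> by (simp add: ip_add_left t1 ip_commute[of triv \<gamma>])
  have gg: "ip \<gamma> \<gamma> = 1" using ip2 unfolding \<pi>\<gamma>
    by (simp add: ip_add_left ip_add_right t1 tg ip_commute[of \<gamma> triv])
  have "constituent G triv ?\<pi>" by (rule constituentI[OF \<pi> triv_Irr]) (simp add: ip1)
  then obtain \<theta> where \<theta>: "\<theta> \<in> characters G \<or> \<theta> = (\<lambda>g. 0)" "?\<pi> = (\<lambda>g. triv g + \<theta> g)"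
    by (auto simp: constituent_def)
  have "\<gamma> g = \<theta> g" for g using fun_cong[OF \<theta>(2), of g] fun_cong[OF \<pi>\<gamma>, of g] by simp
  hence "\<gamma> = \<theta>" by (rule ext)
  moreover have "\<gamma> id \<noteq> 0" using n5 one_closed by (auto simp: \<gamma>_def fixp_id)
  ultimately have "\<gamma> \<in> characters G" using \<theta>(1) by auto
  thus ?thesis using gg by (rule Irr_if_ip_self)
qed

text \<open>No permutation has exactly \<open>n - 1\<close> fixed points, so a polynomial of degree \<open>n - 1\<close> separates
  the identity.\<close>

lemma burnside_brauer:
  assumes "\<chi> \<in> Irr G" "\<psi> \<in> Irr G"
  obtains k where "k \<le> n - 1" "ip (\<lambda>g. \<gamma> g ^ k * \<chi> g) \<psi> \<noteq> 0"
proof -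
  have "\<exists>k\<le>n - 1. ip (\<lambda>g. \<gamma> g ^ k * \<chi> g) \<psi> \<noteq> 0"
  proof (rule ccontr)
    assume "\<not> ?thesis"
    hence z: "(\<Sum>g\<in>carrier G. \<gamma> g ^ k * \<chi> g * \<psi> (inv g)) = 0" if "k \<le> n - 1" for k
      using that card_pos by (auto simp: ip_def)
    \<comment> \<open>The roots are m - 1 for m \<le> n - 2, that is, the values \<gamma> can take
      off the identity. At the identity \<gamma> is n - 1, and the factors there are n - m.\<close>
    define p where "p = (\<Prod>m<n - 1. [:1 - of_nat m, 1:] :: complex poly)"
    have deg: "degree p \<le> n - 1"
      using degree_prod_sum_le[of "{..<n - 1}" "\<lambda>m. [:1 - of_nat m, 1 :: complex:]"]
      by (simp add: p_def)
    have "(\<Sum>g\<in>carrier G. poly p (\<gamma> g) * (\<chi> g * \<psi> (inv g))) =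
      (\<Sum>g\<in>carrier G. \<Sum>k\<le>degree p. coeff p k * (\<gamma> g ^ k * \<chi> g * \<psi> (inv g)))"
      by (simp add: poly_altdef sum_distrib_right mult.assoc)
    also have "\<dots> = (\<Sum>k\<le>degree p. \<Sum>g\<in>carrier G. coeff p k * (\<gamma> g ^ k * \<chi> g * \<psi> (inv g)))"
      by (rule sum.swap)
    also have "\<dots> = (\<Sum>k\<le>degree p. coeff p k * (\<Sum>g\<in>carrier G. \<gamma> g ^ k * \<chi> g * \<psi> (inv g)))"
      by (simp add: sum_distrib_left)
    also have "\<dots> = 0" using z deg by (intro sum.neutral) auto
    finally have "(\<Sum>g\<in>carrier G. poly p (\<gamma> g) * (\<chi> g * \<psi> (inv g))) = 0" .
    moreover have "poly p (\<gamma> g) = 0" if "g \<in> carrier G" "g \<noteq> id" for g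
      using fixp_less[OF that] that by (auto simp: p_def poly_prod \<gamma>_def intro!: bexI[of _ "fixp g"])
    hence "(\<Sum>g\<in>carrier G. poly p (\<gamma> g) * (\<chi> g * \<psi> (inv g))) =
      (\<Sum>g\<in>{id}. poly p (\<gamma> g) * (\<chi> g * \<psi> (inv g)))"
      using one_closed fin by (intro sum.mono_neutral_right) auto
    moreover have "poly p (\<gamma> id) \<noteq> 0"
    proof -
      have "id \<in> carrier G" using one_closed by simp
      hence "poly p (\<gamma> id) = (\<Prod>m<n - 1. of_nat n - of_nat m)"
        by (simp add: p_def poly_prod \<gamma>_def fixp_id)
      also have "\<dots> \<noteq> (0 :: complex)" by (auto simp: prod_zero_iff)
      finally show ?thesis .
    qed
    moreover have "inv id = id" using inv_one by simp
    moreover have "\<chi> id \<noteq> 0" "\<psi> id \<noteq> 0"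
      using character_one_nonzero assms Irr_characters by (auto simp: subset_iff)
    ultimately show False by simp
  qed
  thus thesis using that by auto
qed

subsection \<open>Transferring invariance from a point stabiliser to the whole group\<close>

lemma stabiliser_subgroup: "subgroup (stab x) G"
proof (rule subgroupI)
  show "stab x \<noteq> {}" using one_closed by (auto intro!: exI[of _ id])
  show "inv a \<in> stab x" if "a \<in> stab x" for a
    using that inv_apply(1)[of a x] by auto
  show "a \<otimes> b \<in> stab x"
    if "a \<in> stab x" "b \<in> stab x" for a b
    using that m_closed[of a b] by auto
qed auto

text \<open>Frobenius reciprocity for the permutation character. Exchanging the sums over g and over
  its fixed points gives one sum per point stabiliser; the stabilisers are conjugate, so these sums
  are equal.\<close>

lemma stabiliser_character_sum:
  assumes r: "representation G N S" and x: "x \<in> {1..n}"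
  shows "(\<Sum>g\<in>carrier G. char S g * of_nat (fixp g)) =
    of_nat n * (\<Sum>g\<in>stab x. char S g)"
proof -
  let ?c = "char S"
  have "(\<Sum>g\<in>carrier G. ?c g * of_nat (fixp g)) = (\<Sum>g\<in>carrier G. \<Sum>y\<in>{1..n}. if g y = y then ?c g else 0)"
    by (intro sum.cong refl) (simp add: fixp_def sum.inter_filter[symmetric])
  also have "\<dots> = (\<Sum>y\<in>{1..n}. \<Sum>g\<in>carrier G. if g y = y then ?c g else 0)" by (rule sum.swap)
  also have "\<dots> = (\<Sum>y\<in>{1..n}. \<Sum>g\<in>stab y. ?c g)"
    using fin by (simp add: sum.inter_filter)
  also have "\<dots> = (\<Sum>y\<in>{1..n}. \<Sum>g\<in>stab x. ?c g)"
  proof (rule sum.cong[OF refl])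
    fix y assume y: "y \<in> {1..n}"
    obtain h where h: "h \<in> carrier G" "h x = y" using transitive[OF x y] by metis
    have hy: "(inv h) y = x" using inv_apply(1)[OF h(1), of x] h by simp
    have "bij_betw (\<lambda>g. h \<otimes> g \<otimes> inv h) (stab x) (stab y)"
    proof (rule bij_betw_byWitness[where f' = "\<lambda>g. inv h \<otimes> g \<otimes> h"])
      show "\<forall>a\<in>stab x. inv h \<otimes> (h \<otimes> a \<otimes> inv h) \<otimes> h = a"
        using h by (auto simp: fun_eq_iff inv_apply)
      show "\<forall>a\<in>stab y. h \<otimes> (inv h \<otimes> a \<otimes> h) \<otimes> inv h = a"
        using h by (auto simp: fun_eq_iff inv_apply)
      show "(\<lambda>g. h \<otimes> g \<otimes> inv h) ` stab x \<subseteq> stab y"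
      proof clarify
        fix g assume g: "g \<in> carrier G" "g x = x"
        have "h \<otimes> g \<otimes> inv h \<in> carrier G" using g h by (intro m_closed inv_closed)
        thus "h \<otimes> g \<otimes> inv h \<in> carrier G \<and> (h \<otimes> g \<otimes> inv h) y = y" using g h hy by simp
      qed
      show "(\<lambda>g. inv h \<otimes> g \<otimes> h) ` stab y \<subseteq> stab x"
      proof clarify
        fix g assume g: "g \<in> carrier G" "g y = y"
        have "inv h \<otimes> g \<otimes> h \<in> carrier G" using g h by (intro m_closed inv_closed)
        thus "inv h \<otimes> g \<otimes> h \<in> carrier G \<and> (inv h \<otimes> g \<otimes> h) x = x" using g h hy by simp
      qed
    qed
    from sum.reindex_bij_betw[OF this, of ?c]
    show "(\<Sum>g\<in>stab y. ?c g) = (\<Sum>g\<in>stab x. ?c g)"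
      using character_of_conj[OF r _ h(1)] by simp
  qed
  finally show ?thesis by simp
qed

text \<open>Multiplicity zero for \<gamma> makes the mean of the character over the stabiliser equal
  to its mean over G. The two fixed spaces thus have equal dimension, and one contains the
  other.\<close>

lemma stabiliser_fixed_vector:
  assumes r: "representation G N S" and z: "ip (char S) \<gamma> = 0" and x: "x \<in> {1..n}"
    and v: "v \<in> carrier_vec N" and fix_v: "\<And>h. h \<in> carrier G \<Longrightarrow> h x = x \<Longrightarrow> S h *\<^sub>v v = v"
    and g: "g \<in> carrier G"
  shows "S g *\<^sub>v v = v"
proof (rule fixed_vector_transfer[OF r stabiliser_subgroup[of x] _ v _ g])
  let ?c = "char S" and ?H = "stab x"
  have "(\<Sum>g\<in>carrier G. ?c g * (of_nat (fixp g) - 1)) = 0"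
  proof -
    have "(\<Sum>g\<in>carrier G. ?c g * (of_nat (fixp g) - 1)) = (\<Sum>g\<in>carrier G. ?c g * \<gamma> (inv g))"
      by (intro sum.cong) (auto simp: \<gamma>_def fixp_inv)
    thus ?thesis using z card_pos by (simp add: ip_def)
  qed
  hence e: "(\<Sum>g\<in>carrier G. ?c g) = of_nat n * (\<Sum>g\<in>?H. ?c g)"
    by (simp add: right_diff_distrib sum_subtractf stabiliser_character_sum[OF r x])
  have cn: "of_nat (card (carrier G)) = (of_nat n * of_nat (card ?H) :: complex)"
    unfolding card_stabiliser[OF x, symmetric] by (rule of_nat_mult)
  show "(\<Sum>g\<in>?H. ?c g) / of_nat (card ?H) = (\<Sum>g\<in>carrier G. ?c g) / of_nat (card (carrier G))"
    unfolding e cn using n5 by simp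
qed (use fix_v in auto)

text \<open>Vectorised, \<open>Y x\<close> lies in the tensor product of \<open>R\<close> with the
  dual of \<open>R'\<close>. Equivariance makes it fixed by the stabiliser of x, hence by G; but an
  element carrying x to y sends it to \<open>Y y\<close>.\<close>

lemma point_family_constant:
  assumes R: "representation G N R" and R': "representation G N' R'"
    and z: "ip (\<lambda>g. char R g * char R' (inv g)) \<gamma> = 0"
    and Y: "\<And>x. x \<in> {1..n} \<Longrightarrow> Y x \<in> carrier_mat N N'"
    and equi: "\<And>g x. g \<in> carrier G \<Longrightarrow> x \<in> {1..n} \<Longrightarrow> R g * Y x * R' (inv g) = Y (g x)"
    and xy: "x \<in> {1..n}" "y \<in> {1..n}"
  shows "Y x = Y y"
proof -
  define S where "S g = kron (R g) ((R' (inv g))\<^sup>T)" for g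
  have S: "representation G (N * N') S"
    unfolding S_def by (rule representation_kron[OF R character_inv_apply(1)[OF R']])
  have "char S g = char R g * char R' (inv g)" if "g \<in> carrier G" for g
    using fun_cong[OF character_of_kron[OF R character_inv_apply(1)[OF R']], of g]
      character_inv_apply(2)[OF R' that] unfolding S_def by simp
  hence "ip (char S) \<gamma> = 0" using z by (simp add: ip_def)
  note fixed = stabiliser_fixed_vector[OF S this xy(1) vectorise_carrier[OF Y[OF xy(1)]]]
  have act: "S g *\<^sub>v vectorise (Y x) = vectorise (Y (g x))" if g: "g \<in> carrier G" for g
  proof -
    have c: "R g \<in> carrier_mat N N" "R' (inv g) \<in> carrier_mat N' N'"
      using representationD(1)[OF R] representationD(1)[OF R'] g by auto
    show ?thesis unfolding S_def
      using kron_vectorise[OF c(1) transpose_carrier_mat[THEN iffD2, OF c(2)] Y[OF xy(1)]]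
        equi[OF g xy(1)] by simp
  qed
  obtain g where g: "g \<in> carrier G" "g x = y" using transitive[OF xy] by metis
  have "S g *\<^sub>v vectorise (Y x) = vectorise (Y x)"
    by (rule fixed[OF _ g(1)]) (use act in auto)
  hence "vectorise (Y y) = vectorise (Y x)" using act[OF g(1)] g(2) by simp
  thus ?thesis using vectorise_inj[OF Y[OF xy(2)] Y[OF xy(1)]] by simp
qed

end

subsection \<open>Transpositions, three-cycles and inverses\<close>

abbreviation swap :: "nat \<Rightarrow> nat \<Rightarrow> nat \<Rightarrow> nat"
  where "swap \<equiv> Transposition.transpose"

text \<open>Composition is read from right to left, so for distinct points this is the cycle a to b
  to c to a.\<close>

definition cyc3 :: "nat \<Rightarrow> nat \<Rightarrow> nat \<Rightarrow> nat \<Rightarrow> nat"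
  where "cyc3 a b c = swap a b \<circ> swap b c"

lemma cyc3_apply:
  assumes "a \<noteq> b" "a \<noteq> c" "b \<noteq> c"
  shows "cyc3 a b c x = (if x = a then b else if x = b then c else if x = c then a else x)"
  using assms by (auto simp: cyc3_def Transposition.transpose_def)

lemma cyc3_permutes: "a \<in> X \<Longrightarrow> b \<in> X \<Longrightarrow> c \<in> X \<Longrightarrow> cyc3 a b c permutes X"
  unfolding cyc3_def by (intro permutes_compose permutes_swap_id)

lemma cyc3_even: "a \<noteq> b \<Longrightarrow> b \<noteq> c \<Longrightarrow> evenperm (cyc3 a b c)"
  by (simp add: cyc3_def evenperm_comp permutation_swap_id evenperm_swap)

lemma swap_conj: "inj g \<Longrightarrow> g \<circ> swap a b = swap (g a) (g b) \<circ> g"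
  by (auto simp: fun_eq_iff Transposition.transpose_def dest: injD)

lemma cyc3_conj: "inj g \<Longrightarrow> g \<circ> cyc3 a b c = cyc3 (g a) (g b) (g c) \<circ> g"
  by (auto simp: fun_eq_iff cyc3_def Transposition.transpose_def dest: injD)

text \<open>On each cycle of \<open>p\<close>, choose a base point \<open>r\<close> and reflect: \<open>p\<^sup>k r\<close> goes to \<open>p\<^sup>-\<^sup>k r\<close>.\<close>

lemma permutes_conj_inv:
  assumes p: "p permutes X" and X: "finite X"
  obtains s where "s permutes X" "s \<circ> p = inv' p \<circ> s"
proof -
  have "permutation p" using p X permutation_permutes by blast
  then obtain N where N: "p ^^ N = id" "N > 0" by (rule permutation_is_nilpotent)
  define q where "q = inv' p"
  have qp: "q (p x) = x" "p (q x) = x" for x using permutes_inverses[OF p] by (auto simp: q_def)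
  have qpk: "(q ^^ k) ((p ^^ k) x) = x" for k x
    by (induction k arbitrary: x) (simp_all add: funpow_swap1 qp)
  have pqk: "(p ^^ k) ((q ^^ k) x) = x" for k x
    by (induction k arbitrary: x) (simp_all add: funpow_swap1 qp)
  have qN: "q ^^ N = id" using qpk[of N] N by (auto simp: fun_eq_iff)
  \<comment> \<open>Since \<open>p\<close> has finite order, powers of the inverse are also powers
    of \<open>p\<close>; forward orbits are therefore whole cycles.\<close>
  have q_as_p: "\<exists>m. (q ^^ k) x = (p ^^ m) x" for k x
  proof -
    have "p ^^ (N * k) = id" using N by (simp add: funpow_mult[symmetric] mult.commute id_funpow)
    moreover have "N * k = (N * k - k) + k" using N by simp
    ultimately have e: "(p ^^ k) ((p ^^ (N * k - k)) x) = x"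
      by (metis add.commute funpow_add comp_apply id_apply)
    have "(q ^^ k) x = (p ^^ (N * k - k)) x" using qpk[of k "(p ^^ (N * k - k)) x"] unfolding e .
    thus ?thesis by blast
  qed
  define O' where "O' x = {(p ^^ k) x | k. True}" for x
  have O_step: "O' (p x) = O' x" for x
  proof
    show "O' (p x) \<subseteq> O' x" unfolding O'_def by (auto simp: funpow_swap1 intro: exI[of _ "Suc _"])
    show "O' x \<subseteq> O' (p x)"
    proof
      fix y assume "y \<in> O' x"
      then obtain k where y: "y = (p ^^ k) x" by (auto simp: O'_def)
      obtain m where "(q ^^ 1) x = (p ^^ m) x" using q_as_p by blast
      hence qx: "(p ^^ m) x = q x" by simp
      have "p ((p ^^ m) x) = x" unfolding qx by (rule qp(2))
      hence "y = (p ^^ (k + m)) (p x)" by (simp add: y funpow_add funpow_swap1)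
      thus "y \<in> O' (p x)" by (auto simp: O'_def)
    qed
  qed
  have O_pow: "O' ((p ^^ k) x) = O' x" for k x
    by (induction k) (simp_all add: O_step)
  define r where "r x = (SOME y. y \<in> O' x)" for x
  have "x \<in> O' x" for x unfolding O'_def by (auto intro: exI[of _ 0])
  hence r_in: "r x \<in> O' x" for x unfolding r_def by (rule someI)
  have r_pow: "r ((p ^^ k) x) = r x" for k x by (simp add: r_def O_pow)
  have "\<exists>k. (p ^^ k) (r x) = x" for x
  proof -
    obtain k where k: "r x = (p ^^ k) x" using r_in by (auto simp: O'_def)
    obtain m where "(q ^^ k) (r x) = (p ^^ m) (r x)" using q_as_p by blast
    hence "(p ^^ m) (r x) = x" using qpk by (simp add: k)
    thus ?thesis by blast
  qed
  then obtain e where e: "\<And>x. (p ^^ e x) (r x) = x" by metis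
  define s where "s x = (q ^^ e x) (r x)" for x
  \<comment> \<open>The reflection does not depend on the exponent chosen for x: any k that takes
    the base point to x may replace \<open>e x\<close>.\<close>
  have s_pow: "s x = (q ^^ k) (r x)" if k: "(p ^^ k) (r x) = x" for x k
  proof -
    have "(q ^^ (k + e x)) ((p ^^ e x) (r x)) = (q ^^ k) (r x)" by (simp add: funpow_add qpk)
    moreover have "(q ^^ (e x + k)) ((p ^^ k) (r x)) = (q ^^ e x) (r x)" by (simp add: funpow_add qpk)
    ultimately show ?thesis by (simp add: e k s_def add.commute)
  qed
  have r_s: "r (s x) = r x" for x
  proof -
    obtain m where "s x = (p ^^ m) (r x)" using q_as_p by (auto simp: s_def)
    moreover have "r (r x) = r x" using r_pow[of "e x" "r x"] by (simp add: e)
    ultimately show ?thesis by (simp add: r_pow)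
  qed
  have invol: "s (s x) = x" for x
  proof -
    obtain m where m: "s x = (p ^^ m) (r x)" using q_as_p by (auto simp: s_def)
    have "s (s x) = (q ^^ m) (r (s x))" by (rule s_pow, unfold r_s, rule m[symmetric])
    also have "\<dots> = (q ^^ m) ((p ^^ e x) ((q ^^ e x) (r x)))" by (simp add: r_s pqk)
    also have "(q ^^ e x) (r x) = (p ^^ m) (r x)" using m by (simp add: s_def)
    also have "(p ^^ e x) ((p ^^ m) (r x)) = (p ^^ m) ((p ^^ e x) (r x))"
      by (metis add.commute comp_apply funpow_add)
    finally show ?thesis by (simp add: qpk e)
  qed
  have "s (p x) = q (s x)" for x
  proof -
    have rp: "r (p x) = r x" using r_pow[of 1 x] by simp
    have "s (p x) = (q ^^ Suc (e x)) (r (p x))" by (rule s_pow) (simp add: rp e)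
    thus ?thesis by (simp add: rp s_def)
  qed
  moreover have "s permutes X"
  proof -
    have "s x = x" if "x \<notin> X" for x
    proof -
      have "p x = x" using permutes_not_in[OF p that] .
      hence fx: "(p ^^ k) x = x" for k by (induction k) auto
      have "r x = x" using r_in[of x] fx by (auto simp: O'_def)
      thus ?thesis using s_pow[of 0 x] by simp
    qed
    moreover have "bij s" by (rule involuntory_imp_bij) (rule invol)
    ultimately show ?thesis by (auto simp: permutes_def bij_iff)
  qed
  ultimately show thesis by (intro that[of s]) (auto simp: q_def fun_eq_iff)
qed

subsection \<open>Functions on pairs and triples with a constant conjugation sum\<close>

lemma sum_off_diagonal:
  fixes g :: "'a \<Rightarrow> 'a \<Rightarrow> 'b :: ab_group_add"
  assumes "finite A"
  shows "(\<Sum>i\<in>A. \<Sum>j\<in>A - {i}. g i j) = (\<Sum>i\<in>A. \<Sum>j\<in>A. g i j) - (\<Sum>i\<in>A. g i i)"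
  using assms by (simp add: sum_diff1 sum_subtractf cong: sum.cong)

text \<open>Serves to split off the points a, b, c one at a time from a sum over ordered
  pairs.\<close>

lemma sum_off_diagonal_insert:
  fixes g :: "'a \<Rightarrow> 'a \<Rightarrow> 'b :: ab_group_add"
  assumes "finite A" "a \<notin> A"
  shows "(\<Sum>i\<in>insert a A. \<Sum>j\<in>insert a A - {i}. g i j) =
    (\<Sum>i\<in>A. \<Sum>j\<in>A - {i}. g i j) + (\<Sum>i\<in>A. g i a + g a i)"
  using assms by (simp add: sum_off_diagonal sum.distrib)

text \<open>\<open>D x\<close> is the sum over the three-cycles through \<open>x\<close> acting on \<open>v\<close>. If it does not depend on \<open>x\<close>,
  comparing \<open>x\<close> inside and outside \<open>{a, b, c}\<close> yields a linear relation between \<open>v a b c\<close> and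
  \<open>F a b c x\<close>, see \<open>constant_sum\<close>.\<close>

locale conjugation_sum =
  fixes X :: "nat set" and v :: "nat \<Rightarrow> nat \<Rightarrow> nat \<Rightarrow> complex" and e :: complex
  assumes fin: "finite X"
    and cyc: "\<lbrakk>a \<in> X; b \<in> X; c \<in> X; a \<noteq> b; a \<noteq> c; b \<noteq> c\<rbrakk> \<Longrightarrow> v b c a = v a b c"
    and alt: "\<lbrakk>a \<in> X; b \<in> X; c \<in> X; a \<noteq> b; a \<noteq> c; b \<noteq> c\<rbrakk> \<Longrightarrow> v b a c = e * v a b c"
begin

definition D :: "nat \<Rightarrow> nat \<Rightarrow> nat \<Rightarrow> nat \<Rightarrow> complex"
  where "D x a b c =
    (\<Sum>i\<in>X - {x}. \<Sum>j\<in>X - {x} - {i}. v (cyc3 x i j a) (cyc3 x i j b) (cyc3 x i j c))"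

definition F :: "nat \<Rightarrow> nat \<Rightarrow> nat \<Rightarrow> nat \<Rightarrow> complex"
  where "F a b c x = v x b c + v a x c + v a b x"

definition triple :: "nat \<Rightarrow> nat \<Rightarrow> nat \<Rightarrow> bool"
  where "triple a b c \<longleftrightarrow> a \<in> X \<and> b \<in> X \<and> c \<in> X \<and> a \<noteq> b \<and> a \<noteq> c \<and> b \<noteq> c"

lemma perm:
  assumes "triple a b c"
  shows "v b c a = v a b c" "v c a b = v a b c" "v b a c = e * v a b c" "v c b a = e * v a b c"
    "v a c b = e * v a b c"
  using assms cyc[of a b c] cyc[of c a b] cyc[of b a c] cyc[of c b a] cyc[of a c b] alt[of a b c]
  by (auto simp: triple_def)

text \<open>The pairs (i, j) are sorted by how many entries lie in {a, b, c}. With none, the triple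
  is untouched, which happens (n - 4)(n - 5) times for n = \<open>card X\<close>. With one, that
  entry is replaced by x or by the other member of the pair, according to the order. With both, x
  enters the triple and two entries change places up to rotation; the six terms give each summand of
  \<open>F a b c x\<close> twice, with factor \<open>e\<close>.\<close>

lemma D_outside:
  assumes t: "triple a b c" and x: "x \<in> X - {a, b, c}"
  shows "D x a b c = (of_nat (card X) - 4) * (of_nat (card X) - 5) * v a b c
    + (\<Sum>i\<in>X - {a, b, c}. F a b c i) + (of_nat (card X) - 5 + 2 * e) * F a b c x"
proof -
  define Y where "Y = X - {x, a, b, c}"
  have Y: "finite Y" "a \<notin> insert b (insert c Y)" "b \<notin> insert c Y" "c \<notin> Y" "x \<notin> Y"
    and Xx: "X - {x} = insert a (insert b (insert c Y))"
    and Xabc: "X - {a, b, c} = insert x Y"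
    using fin t x by (auto simp: Y_def triple_def)
  have fY: "finite (insert b (insert c Y))" "finite (insert c Y)" using Y(1) by auto
  have "card X = card (insert x (insert a (insert b (insert c Y))))"
    using Xx x by (metis Diff_iff insert_Diff)
  hence cY: "card X = card Y + 4" using Y x t by (simp add: triple_def)
  have d: "a \<noteq> b" "a \<noteq> c" "b \<noteq> c" "x \<noteq> a" "x \<noteq> b" "x \<noteq> c" using t x by (auto simp: triple_def)
  define g where "g i j = v (cyc3 x i j a) (cyc3 x i j b) (cyc3 x i j c)" for i j
  have "D x a b c = (\<Sum>i\<in>Y. \<Sum>j\<in>Y - {i}. g i j) + (\<Sum>i\<in>Y. g i c + g c i)
    + (\<Sum>i\<in>insert c Y. g i b + g b i) + (\<Sum>i\<in>insert b (insert c Y). g i a + g a i)"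
    unfolding D_def Xx g_def[symmetric] sum_off_diagonal_insert[OF fY(1) Y(2)]
      sum_off_diagonal_insert[OF fY(2) Y(3)] sum_off_diagonal_insert[OF Y(1,4)] ..
  also have "(\<Sum>i\<in>Y. \<Sum>j\<in>Y - {i}. g i j) = (\<Sum>i\<in>Y. \<Sum>j\<in>Y - {i}. v a b c)"
  proof (intro sum.cong refl)
    fix i j assume "i \<in> Y" "j \<in> Y - {i}"
    hence "x \<noteq> i" "x \<noteq> j" "i \<noteq> j" "a \<noteq> i" "a \<noteq> j" "b \<noteq> i" "b \<noteq> j" "c \<noteq> i" "c \<noteq> j"
      using Y by auto
    thus "g i j = v a b c" using d by (simp add: g_def cyc3_apply)
  qed
  also have "(\<Sum>i\<in>Y. \<Sum>j\<in>Y - {i}. v a b c) = of_nat (card Y) * (of_nat (card Y) - 1) * v a b c"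
    unfolding sum_off_diagonal[OF Y(1)] by (simp add: algebra_simps)
  also have "(\<Sum>i\<in>insert b (insert c Y). g i a + g a i) =
    (g b a + g a b) + (g c a + g a c) + (\<Sum>i\<in>Y. g i a + g a i)"
    using Y by simp
  also have "(\<Sum>i\<in>insert c Y. g i b + g b i) = (g c b + g b c) + (\<Sum>i\<in>Y. g i b + g b i)"
    using Y by simp
  finally have "D x a b c = of_nat (card Y) * (of_nat (card Y) - 1) * v a b c
    + (\<Sum>i\<in>Y. (g i a + g a i) + (g i b + g b i) + (g i c + g c i))
    + (g a b + g a c + (g b a + g b c) + (g c a + g c b))"
    by (simp add: sum.distrib algebra_simps)
  also have "(\<Sum>i\<in>Y. (g i a + g a i) + (g i b + g b i) + (g i c + g c i)) = (\<Sum>i\<in>Y. F a b c x + F a b c i)"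
  proof (intro sum.cong refl)
    fix i assume "i \<in> Y"
    hence "x \<noteq> i" "a \<noteq> i" "b \<noteq> i" "c \<noteq> i" using Y by auto
    thus "(g i a + g a i) + (g i b + g b i) + (g i c + g c i) = F a b c x + F a b c i"
      using d by (simp add: g_def cyc3_apply F_def)
  qed
  finally have 1: "D x a b c = of_nat (card Y) * (of_nat (card Y) - 1) * v a b c
    + of_nat (card Y) * F a b c x + (\<Sum>i\<in>Y. F a b c i)
    + (g a b + g a c + (g b a + g b c) + (g c a + g c b))"
    by (simp add: sum.distrib algebra_simps)
  have "g a b = v b x c" "g a c = v c b x" "g b a = v x a c" "g b c = v a c x" "g c a = v x b a" "g c b = v a x b"
    using d by (simp_all add: g_def cyc3_apply)
  moreover have "triple x b c" "triple a x c" "triple a b x" using t x by (auto simp: triple_def)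
  ultimately have 2: "g a b + g a c + (g b a + g b c) + (g c a + g c b) = 2 * e * F a b c x"
    using perm[of x b c] perm[of a x c] perm[of a b x] by (simp add: F_def algebra_simps)
  have 3: "(\<Sum>i\<in>X - {a, b, c}. F a b c i) = F a b c x + (\<Sum>i\<in>Y. F a b c i)"
    unfolding Xabc using Y by simp
  show ?thesis unfolding 1 2 3 cY by (simp add: algebra_simps)
qed

text \<open>The cycle now starts at the entry a. If i and j avoid b and c, the entry a is replaced
  by i, and each i occurs n - 4 times for n = \<open>card X\<close>. Pairs with exactly one of b, c
  produce the terms with factor \<open>e\<close>, and the two cycles on {a, b, c} itself only rotate
  the triple.\<close>

lemma D_inside:
  assumes t: "triple a b c"
  shows "D a a b c = (of_nat (card X) - 4) * (\<Sum>i\<in>X - {a, b, c}. v i b c)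
    + e * ((\<Sum>i\<in>X - {a, b, c}. F a b c i) + (\<Sum>i\<in>X - {a, b, c}. v i b c)) + 2 * v a b c"
proof -
  define Y where "Y = X - {a, b, c}"
  have Y: "finite Y" "b \<notin> insert c Y" "c \<notin> Y" "a \<notin> Y" and Xa: "X - {a} = insert b (insert c Y)"
    using fin t by (auto simp: Y_def triple_def)
  have fY: "finite (insert c Y)" using Y(1) by auto
  have "card X = card (insert a (insert b (insert c Y)))"
    using Xa t by (metis insert_Diff triple_def)
  hence cY: "card X = card Y + 3" using Y t by (simp add: triple_def)
  have d: "a \<noteq> b" "a \<noteq> c" "b \<noteq> c" using t by (auto simp: triple_def)
  define g where "g i j = v (cyc3 a i j a) (cyc3 a i j b) (cyc3 a i j c)" for i j
  have "D a a b c = (\<Sum>i\<in>Y. \<Sum>j\<in>Y - {i}. g i j) + (\<Sum>i\<in>Y. g i c + g c i)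
    + (\<Sum>i\<in>insert c Y. g i b + g b i)"
    unfolding D_def Xa g_def[symmetric] sum_off_diagonal_insert[OF fY Y(2)]
      sum_off_diagonal_insert[OF Y(1,3)] ..
  also have "(\<Sum>i\<in>Y. \<Sum>j\<in>Y - {i}. g i j) = (\<Sum>i\<in>Y. \<Sum>j\<in>Y - {i}. v i b c)"
  proof (intro sum.cong refl)
    fix i j assume "i \<in> Y" "j \<in> Y - {i}"
    hence "i \<noteq> j" "a \<noteq> i" "a \<noteq> j" "b \<noteq> i" "b \<noteq> j" "c \<noteq> i" "c \<noteq> j" using Y by auto
    thus "g i j = v i b c" using d by (simp add: g_def cyc3_apply)
  qed
  also have "(\<Sum>i\<in>Y. \<Sum>j\<in>Y - {i}. v i b c) = (of_nat (card Y) - 1) * (\<Sum>i\<in>Y. v i b c)"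
    unfolding sum_off_diagonal[OF Y(1)] by (simp add: algebra_simps sum_distrib_left sum_subtractf)
  also have "(\<Sum>i\<in>insert c Y. g i b + g b i) = (g c b + g b c) + (\<Sum>i\<in>Y. g i b + g b i)"
    using Y by simp
  also have "(\<Sum>i\<in>Y. g i b + g b i) = (\<Sum>i\<in>Y. e * v a i c + e * v i b c)"
  proof (intro sum.cong refl)
    fix i assume i: "i \<in> Y"
    hence n: "a \<noteq> i" "b \<noteq> i" "c \<noteq> i" using Y by auto
    have "triple a i c" "triple i b c" using t i by (auto simp: Y_def triple_def)
    thus "g i b + g b i = e * v a i c + e * v i b c"
      using d n perm[of a i c] perm[of i b c] by (simp add: g_def cyc3_apply)
  qed
  also have "(\<Sum>i\<in>Y. g i c + g c i) = (\<Sum>i\<in>Y. e * v a b i + e * v i b c)"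
  proof (intro sum.cong refl)
    fix i assume i: "i \<in> Y"
    hence n: "a \<noteq> i" "b \<noteq> i" "c \<noteq> i" using Y by auto
    have "triple a b i" "triple i b c" using t i by (auto simp: Y_def triple_def)
    thus "g i c + g c i = e * v a b i + e * v i b c"
      using d n perm[of a b i] perm[of i b c] by (simp add: g_def cyc3_apply)
  qed
  also have "g c b + g b c = 2 * v a b c"
    using d perm[OF t] by (simp add: g_def cyc3_apply)
  finally show ?thesis
    unfolding Y_def[symmetric] cY by (simp add: F_def sum.distrib sum_distrib_left algebra_simps)
qed

lemma D_rotate:
  assumes t: "triple a b c" and x: "x \<in> X"
  shows "D x b c a = D x a b c"
  unfolding D_def
proof (intro sum.cong refl)
  fix i j assume ij: "i \<in> X - {x}" "j \<in> X - {x} - {i}"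
  have p: "cyc3 x i j permutes X" using ij x by (intro cyc3_permutes) auto
  have "triple (cyc3 x i j a) (cyc3 x i j b) (cyc3 x i j c)"
    using t permutes_in_image[OF p] inj_eq[OF permutes_inj[OF p]] by (simp add: triple_def)
  from perm(1)[OF this]
  show "v (cyc3 x i j b) (cyc3 x i j c) (cyc3 x i j a) = v (cyc3 x i j a) (cyc3 x i j b) (cyc3 x i j c)" .
qed

text \<open>Comparing two points outside the triple in \<open>D_outside\<close> shows that
  \<open>F a b c\<close> is constant there, provided its coefficient n - 5 + 2e does not vanish,
  where n = \<open>card X\<close>. Comparing an outside point with a, b and c then leaves one
  relation between \<open>v a b c\<close> and that constant.\<close>

lemma constant_sum:
  assumes n: "card X \<ge> 5" and const: "\<And>x y. x \<in> X \<Longrightarrow> y \<in> X \<Longrightarrow> D x a b c = D y a b c"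
    and t: "triple a b c" and x: "x \<in> X - {a, b, c}"
    and k: "of_nat (card X) - 5 + 2 * e \<noteq> 0"
  shows "3 * ((of_nat (card X) - 4) * (of_nat (card X) - 5) - 2) * v a b c =
    ((of_nat (card X) - 4 + 4 * e) * (of_nat (card X) - 3)
       - 3 * (of_nat (card X) - 3) - 3 * (of_nat (card X) - 5 + 2 * e)) * F a b c x"
proof -
  let ?n = "of_nat (card X) :: complex" and ?Z = "X - {a, b, c}"
  have abc: "a \<in> X" "b \<in> X" "c \<in> X" "a \<noteq> b" "a \<noteq> c" "b \<noteq> c" "x \<in> X" using t x by (auto simp: triple_def)
  have Fx: "F a b c y = F a b c x" if y: "y \<in> ?Z" for y
  proof -
    have "D x a b c = D y a b c" using const x y by auto
    hence "(?n - 5 + 2 * e) * F a b c y = (?n - 5 + 2 * e) * F a b c x"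
      unfolding D_outside[OF t x] D_outside[OF t y] by auto
    thus ?thesis using k by simp
  qed
  have "card ?Z = card X - 3" using abc fin by (simp add: card_Diff_subset)
  hence cZ: "of_nat (card ?Z) = ?n - 3" using n by (simp add: of_nat_diff)
  have S: "(\<Sum>i\<in>?Z. F a b c i) = (?n - 3) * F a b c x"
    using Fx cZ by simp
  have t2: "triple b c a" "triple c a b" using t by (auto simp: triple_def)
  have Z2: "X - {b, c, a} = ?Z" "X - {c, a, b} = ?Z" by auto
  have Fr: "(\<Sum>i\<in>?Z. F b c a i) = (\<Sum>i\<in>?Z. F a b c i)" "(\<Sum>i\<in>?Z. F c a b i) = (\<Sum>i\<in>?Z. F a b c i)"
  proof -
    have "F b c a i = F a b c i \<and> F c a b i = F a b c i" if "i \<in> ?Z" for i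
    proof -
      have "triple i b c" "triple a i c" "triple a b i" using that t by (auto simp: triple_def)
      thus ?thesis using perm[of i b c] perm[of a i c] perm[of a b i] by (simp add: F_def)
    qed
    thus "(\<Sum>i\<in>?Z. F b c a i) = (\<Sum>i\<in>?Z. F a b c i)" "(\<Sum>i\<in>?Z. F c a b i) = (\<Sum>i\<in>?Z. F a b c i)"
      by auto
  qed
  have Db: "D b a b c = (?n - 4) * (\<Sum>i\<in>?Z. v a i c)
    + e * ((\<Sum>i\<in>?Z. F a b c i) + (\<Sum>i\<in>?Z. v a i c)) + 2 * v a b c"
  proof -
    have "(\<Sum>i\<in>?Z. v i c a) = (\<Sum>i\<in>?Z. v a i c)"
    proof (intro sum.cong refl)
      fix i assume "i \<in> ?Z"
      hence "triple a i c" using t by (auto simp: triple_def)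
      thus "v i c a = v a i c" by (rule perm(1))
    qed
    thus ?thesis
      using D_inside[OF t2(1)] D_rotate[OF t abc(2)] perm(1)[OF t] unfolding Z2 Fr by simp
  qed
  have Dc: "D c a b c = (?n - 4) * (\<Sum>i\<in>?Z. v a b i)
    + e * ((\<Sum>i\<in>?Z. F a b c i) + (\<Sum>i\<in>?Z. v a b i)) + 2 * v a b c"
  proof -
    have "(\<Sum>i\<in>?Z. v i a b) = (\<Sum>i\<in>?Z. v a b i)"
    proof (intro sum.cong refl)
      fix i assume "i \<in> ?Z"
      hence "triple a b i" using t by (auto simp: triple_def)
      thus "v i a b = v a b i" by (rule perm(2))
    qed
    thus ?thesis
      using D_inside[OF t2(2)] D_rotate[OF t abc(3)] D_rotate[OF t2(1) abc(3)] perm(2)[OF t]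
      unfolding Z2 Fr by simp
  qed
  have split: "(\<Sum>i\<in>?Z. v i b c) + (\<Sum>i\<in>?Z. v a i c) + (\<Sum>i\<in>?Z. v a b i) = (\<Sum>i\<in>?Z. F a b c i)"
    by (simp add: F_def sum.distrib)
  \<comment> \<open>\<open>D_inside\<close> singles out one entry of the triple. Adding its versions
    for all three entries turns the three partial sums into the sum of \<open>F\<close>.\<close>
  have "3 * D x a b c = D a a b c + D b a b c + D c a b c"
    using const[OF abc(7,1)] const[OF abc(7,2)] const[OF abc(7,3)] by simp
  also have "\<dots> = (?n - 4 + e) * ((\<Sum>i\<in>?Z. v i b c) + (\<Sum>i\<in>?Z. v a i c) + (\<Sum>i\<in>?Z. v a b i))
      + 3 * e * (\<Sum>i\<in>?Z. F a b c i) + 6 * v a b c"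
    unfolding D_inside[OF t] Db Dc by (simp add: algebra_simps)
  also have "\<dots> = (?n - 4 + 4 * e) * ((?n - 3) * F a b c x) + 6 * v a b c"
    unfolding split S by (simp add: algebra_simps)
  finally have "3 * ((?n - 4) * (?n - 5) * v a b c + (?n - 3) * F a b c x + (?n - 5 + 2 * e) * F a b c x)
     = (?n - 4 + 4 * e) * ((?n - 3) * F a b c x) + 6 * v a b c"
    unfolding D_outside[OF t x] S .
  thus ?thesis by (simp add: algebra_simps)
qed

text \<open>For e = 1 the relation of \<open>constant_sum\<close> reads (n - 3)(n - 6) F = 3 (n -
  3)(n - 6) v with n = \<open>card X\<close>, so F = 3 v. Writing this for \<open>a b c\<close> with
  x and for \<open>x b c\<close> with a, where F shares two of its three terms, yields the
  claim.\<close>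

lemma symmetric_constant:
  assumes n: "card X \<ge> 5" "card X \<noteq> 6" and e: "e = 1"
    and const: "\<And>x y a b c. x \<in> X \<Longrightarrow> y \<in> X \<Longrightarrow> triple a b c \<Longrightarrow> D x a b c = D y a b c"
    and t: "triple a b c" and x: "x \<in> X - {a, b, c}"
  shows "v x b c = v a b c"
proof -
  let ?n = "of_nat (card X) :: complex"
  have n3: "?n - 3 \<noteq> 0" and n6: "?n - 6 \<noteq> 0"
  proof -
    have "?n \<noteq> of_nat 3" "?n \<noteq> of_nat 6" using n unfolding of_nat_eq_iff by auto
    thus "?n - 3 \<noteq> 0" "?n - 6 \<noteq> 0" by auto
  qed
  have F: "F p q r y = 3 * v p q r" if tp: "triple p q r" and y: "y \<in> X - {p, q, r}" for p q r y
  proof -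
    have k: "?n - 5 + 2 * e \<noteq> 0" using n3 by (simp add: e)
    have "(?n - 3) * (?n - 6) * (3 * v p q r) = (?n - 3) * (?n - 6) * F p q r y"
      using constant_sum[OF n(1) const[OF _ _ tp] tp y k] unfolding e by (simp add: algebra_simps)
    thus ?thesis using n3 n6 by simp
  qed
  have t': "triple x b c" "a \<in> X - {x, b, c}" using t x by (auto simp: triple_def)
  have "triple a x c" "triple a b x" using t x by (auto simp: triple_def)
  hence "F x b c a = v a b c + v a x c + v a b x"
    using perm[of a x c] perm[of a b x] by (simp add: F_def e)
  moreover have "F a b c x = v x b c + v a x c + v a b x" by (simp add: F_def)
  ultimately have "3 * v x b c - v a b c = 3 * v a b c - v x b c"
    using F[OF t x] F[OF t'] by (simp add: algebra_simps)
  hence "4 * v x b c = 4 * v a b c" by (simp add: algebra_simps)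
  thus ?thesis by simp
qed

text \<open>For e = -1 and six points the coefficient of v in \<open>constant_sum\<close> is 0 and
  that of F is -12, so F vanishes. Hence replacing one entry of a triple by an outside point changes
  the sign.\<close>

lemma alternating_zero:
  assumes n: "card X = 6" and e: "e = -1"
    and const: "\<And>x y a b c. x \<in> X \<Longrightarrow> y \<in> X \<Longrightarrow> triple a b c \<Longrightarrow> D x a b c = D y a b c"
    and t: "triple a b c"
  shows "v a b c = 0"
proof -
  have F: "F p q r y = 0" if tp: "triple p q r" and y: "y \<in> X - {p, q, r}" for p q r y
  proof -
    have "card X \<ge> 5" "of_nat (card X) - 5 + 2 * e \<noteq> (0 :: complex)" by (simp_all add: n e)
    from constant_sum[OF this(1) const[OF _ _ tp] tp y this(2)] show ?thesis by (simp add: n e)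
  qed
  have flip: "v y q r = - v p q r" if tp: "triple p q r" and y: "y \<in> X - {p, q, r}" for p q r y
  proof -
    have t': "triple y q r" "p \<in> X - {y, q, r}" using tp y by (auto simp: triple_def)
    have "triple p y r" "triple p q y" using tp y by (auto simp: triple_def)
    hence "F y q r p = v p q r - v p y r - v p q y"
      using perm[of p y r] perm[of p q y] by (simp add: F_def e)
    moreover have "F p q r y = v y q r + v p y r + v p q y" by (simp add: F_def)
    ultimately have "v y q r + v p q r = F p q r y + F y q r p" by simp
    hence "v y q r + v p q r = 0" using F[OF tp y] F[OF t'] by simp
    thus ?thesis by (simp add: eq_neg_iff_add_eq_0)
  qed
  have "card (X - {a, b, c}) = 3" using n t fin by (simp add: card_Diff_subset triple_def)
  hence "\<not> card (X - {a, b, c}) \<le> Suc 0" by simp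
  then obtain x y where xy: "x \<in> X - {a, b, c}" "y \<in> X - {a, b, c}" "x \<noteq> y"
    unfolding card_le_Suc0_iff_eq[OF finite_Diff[OF fin]] by blast
  have tx: "triple x b c" "y \<in> X - {x, b, c}" and ty: "triple y b c" "a \<in> X - {y, b, c}"
    using t xy by (auto simp: triple_def)
  \<comment> \<open>Replacing a by x, x by y and y by a is an odd number of sign changes that
    returns to the same triple.\<close>
  have "v a b c = - v a b c"
    using flip[OF t xy(1)] flip[OF tx] flip[OF ty] by simp
  thus ?thesis by simp
qed

end

text \<open>For z outside {p, q} the sum is (n - 3) f p q + f z p + f z q with n =
  \<open>card X\<close>. Comparing z = x with z = y shows that the difference f x p - f y p changes
  sign from p to any other q outside {x, y}. Three such points force it to be zero.\<close>

lemma swap_sum_constant: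
  fixes f :: "nat \<Rightarrow> nat \<Rightarrow> complex"
  assumes X: "finite X" "card X \<ge> 5"
    and sym: "\<And>a b. f a b = f b a"
    and const: "\<And>x y a b. \<lbrakk>x \<in> X; y \<in> X; a \<in> X; b \<in> X; a \<noteq> b\<rbrakk> \<Longrightarrow>
      (\<Sum>i\<in>X - {x}. f (swap x i a) (swap x i b)) = (\<Sum>i\<in>X - {y}. f (swap y i a) (swap y i b))"
    and xya: "x \<in> X" "y \<in> X" "a \<in> X" "x \<noteq> y" "x \<noteq> a" "y \<noteq> a"
  shows "f x a = f y a"
proof -
  have pair: "f x p - f y p = - (f x q - f y q)"
    if pq: "p \<in> X - {x, y}" "q \<in> X - {x, y}" "p \<noteq> q" for p q
  proof -
    have val: "(\<Sum>i\<in>X - {z}. f (swap z i p) (swap z i q)) =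
        (of_nat (card X) - 3) * f p q + f z q + f z p" if z: "z \<in> X - {p, q}" for z
    proof -
      define Y where "Y = X - {z, p, q}"
      have Y: "finite Y" "p \<notin> insert q Y" "q \<notin> Y" and Xz: "X - {z} = insert p (insert q Y)"
        using X z pq by (auto simp: Y_def)
      have "card Y = card X - 3" using X z pq by (simp add: Y_def card_Diff_subset)
      hence cY: "of_nat (card Y) = (of_nat (card X) - 3 :: complex)" using X by (simp add: of_nat_diff)
      have "(\<Sum>i\<in>Y. f (swap z i p) (swap z i q)) = (\<Sum>i\<in>Y. f p q)"
        using z by (intro sum.cong) (auto simp: Y_def Transposition.transpose_def)
      moreover have "f (swap z p p) (swap z p q) = f z q" "f (swap z q p) (swap z q q) = f z p"
        using z pq sym[of p z] by (auto simp: Transposition.transpose_def)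
      ultimately show ?thesis unfolding Xz using Y cY by simp
    qed
    have px: "p \<in> X" "q \<in> X" "x \<in> X - {p, q}" "y \<in> X - {p, q}" using pq xya by auto
    have "f x q + f x p = f y q + f y p"
      using const[OF xya(1,2) px(1,2) pq(3)] unfolding val[OF px(3)] val[OF px(4)] by simp
    thus ?thesis by (simp add: algebra_simps)
  qed
  have "card (X - {x, y, a}) \<ge> 2" using X xya by (simp add: card_Diff_subset)
  hence "\<not> card (X - {x, y, a}) \<le> Suc 0" by simp
  then obtain p q where pq: "p \<in> X - {x, y, a}" "q \<in> X - {x, y, a}" "p \<noteq> q"
    unfolding card_le_Suc0_iff_eq[OF finite_Diff[OF X(1)]] by blast
  have "f x a - f y a = - (f x p - f y p)" "f x p - f y p = - (f x q - f y q)"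
    "f x q - f y q = - (f x a - f y a)"
    by (rule pair; use pq xya in auto)+
  thus ?thesis by (simp add: algebra_simps)
qed

context alt_or_sym
begin

section \<open>Faithfulness and conjugation of cycles\<close>

lemma faithful_inj:
  assumes r: "representation G d \<rho>" and f: "faithful_character G (char \<rho>)"
    and gh: "g \<in> carrier G" "h \<in> carrier G" "\<rho> g = \<rho> h"
  shows "g = h"
proof -
  note R = representationD[OF r]
  have c: "g \<otimes> inv h \<in> carrier G" using gh by (intro m_closed inv_closed)
  have "\<rho> (g \<otimes> inv h) = \<rho> \<one>"
    using R(2)[OF gh(1) inv_closed[OF gh(2)]] representation_inverse(1)[OF r gh(2)] gh(3) R(3) by simp
  hence "char \<rho> (g \<otimes> inv h) = char \<rho> \<one>"
    using character_of_apply[OF c, of \<rho>] character_of_apply[OF one_closed, of \<rho>] by simp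
  hence "g \<otimes> inv h \<in> character_kernel G (char \<rho>)"
    using c by (simp add: character_kernel_def)
  hence "g \<otimes> inv h = \<one>" using f by (simp add: faithful_character_def)
  hence "(g \<otimes> inv h) \<otimes> h = \<one> \<otimes> h" by simp
  moreover have "(g \<otimes> inv h) \<otimes> h = g" using inv_apply(1)[OF gh(2)] by (simp add: fun_eq_iff)
  ultimately show ?thesis by simp
qed

lemma cyc3_carrier:
  "\<lbrakk>a \<in> {1..n}; b \<in> {1..n}; c \<in> {1..n}; a \<noteq> b; b \<noteq> c\<rbrakk> \<Longrightarrow> cyc3 a b c \<in> carrier G"
  by (rule even_carrier[OF cyc3_permutes cyc3_even])

lemma conj_inv:
  assumes "g \<in> carrier G" "g \<circ> a = b \<circ> g"
  shows "g \<otimes> a \<otimes> inv g = b"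
proof
  fix x
  have "(g \<otimes> a \<otimes> inv g) x = (g \<circ> a) ((inv g) x)" by simp
  also have "\<dots> = b (g ((inv g) x))" unfolding assms(2) by simp
  finally show "(g \<otimes> a \<otimes> inv g) x = b x" using inv_apply(2)[OF assms(1)] by simp
qed

lemma conj_cyc3: "g \<in> carrier G \<Longrightarrow> g \<otimes> cyc3 a b c \<otimes> inv g = cyc3 (g a) (g b) (g c)"
  by (rule conj_inv[OF _ cyc3_conj[OF permutes_inj[OF carrier_permutes]]])

lemma conj_swap: "g \<in> carrier G \<Longrightarrow> g \<otimes> swap a b \<otimes> inv g = swap (g a) (g b)"
  by (rule conj_inv[OF _ swap_conj[OF permutes_inj[OF carrier_permutes]]])

lemma bij_betw_minus_point:
  assumes g: "g \<in> carrier G"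
  shows "bij_betw g ({1..n} - {x}) ({1..n} - {g x})"
proof -
  have "bij_betw g {1..n} {1..n}" by (rule permutes_imp_bij[OF carrier_permutes[OF g]])
  moreover have "g ` ({1..n} - {x}) = {1..n} - {g x}"
    using permutes_image[OF carrier_permutes[OF g]] carrier_inj[OF g] by (auto simp: image_iff)
  ultimately show ?thesis by (auto simp: bij_betw_def intro: inj_on_subset)
qed

subsection \<open>Real characters\<close>

text \<open>\<open>R\<close> is the action of G on End V by conjugation; reality makes its character
  the square of that of \<rho>, so maps from End V to itself have its fourth power as character.
  \<open>Y x\<close> adds up the operators of \<open>R\<close> at the three-cycles through x. It is
  constant by \<open>point_family_constant\<close>, and applied to \<rho>(abc) it gives the sum of
  \<rho> over the conjugated three-cycles.\<close>

lemma three_cycle_sum_constant: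
  assumes r: "representation G d \<rho>"
    and real: "\<And>g. g \<in> carrier G \<Longrightarrow> char \<rho> (inv g) = char \<rho> g"
    and z: "ip (\<lambda>g. char \<rho> g ^ 4) \<gamma> = 0"
    and abc: "a \<in> {1..n}" "b \<in> {1..n}" "c \<in> {1..n}" "a \<noteq> b" "a \<noteq> c" "b \<noteq> c"
    and xy: "x \<in> {1..n}" "y \<in> {1..n}" and k: "k < d * d"
  defines "f \<equiv> \<lambda>a b c. vectorise (\<rho> (cyc3 a b c)) $ k"
  shows "(\<Sum>i\<in>{1..n} - {x}. \<Sum>j\<in>{1..n} - {x} - {i}. f (cyc3 x i j a) (cyc3 x i j b) (cyc3 x i j c)) =
    (\<Sum>i\<in>{1..n} - {y}. \<Sum>j\<in>{1..n} - {y} - {i}. f (cyc3 y i j a) (cyc3 y i j b) (cyc3 y i j c))"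
proof -
  note \<rho> = representationD[OF r]
  define R where "R g = kron (\<rho> g) ((\<rho> (inv g))\<^sup>T)" for g
  have R: "representation G (d * d) R"
    unfolding R_def by (rule representation_kron[OF r character_inv_apply(1)[OF r]])
  note RD = representationD[OF R]
  have charR: "char R g = char \<rho> g ^ 2" if "g \<in> carrier G" for g
    using fun_cong[OF character_of_kron[OF r character_inv_apply(1)[OF r]], of g]
      character_inv_apply(2)[OF r that] real[OF that] unfolding R_def by (simp add: power2_eq_square)
  have "(\<Sum>g\<in>carrier G. char R g * char R (inv g) * \<gamma> (inv g)) =
    (\<Sum>g\<in>carrier G. char \<rho> g ^ 4 * \<gamma> (inv g))"
    by (intro sum.cong refl) (simp add: charR real power2_eq_square power4_eq_xxxx)
  hence zR: "ip (\<lambda>g. char R g * char R (inv g)) \<gamma> = 0"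
    using z by (simp add: ip_def)
  \<comment> \<open>Ordered pairs, so that each three-cycle through x is \<open>cyc3 x i j\<close>
    for exactly one (i, j).\<close>
  define I where "I x = (SIGMA i:{1..n} - {x}. {1..n} - {x} - {i})" for x
  have Ic: "cyc3 x (fst s) (snd s) \<in> carrier G" if "x \<in> {1..n}" "s \<in> I x" for x s
    using that by (intro cyc3_carrier) (auto simp: I_def)
  define Y where "Y x = msum (d * d) (d * d) (\<lambda>s. R (cyc3 x (fst s) (snd s))) (I x)" for x
  have "R g * Y u * R (inv g) = Y (g u)" if g: "g \<in> carrier G" and u: "u \<in> {1..n}" for g u
  proof -
    have gi: "inv g \<in> carrier G" using g by simp
    have c: "R (cyc3 u (fst s) (snd s)) \<in> carrier_mat (d * d) (d * d)" if "s \<in> I u" for s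
      by (rule RD(1)[OF Ic[OF u that]])
    have "R g * Y u = msum (d * d) (d * d) (\<lambda>s. R g * R (cyc3 u (fst s) (snd s))) (I u)"
      unfolding Y_def by (rule mult_msum[OF RD(1)[OF g]]) (rule c)
    also have "\<dots> * R (inv g) =
      msum (d * d) (d * d) (\<lambda>s. R g * R (cyc3 u (fst s) (snd s)) * R (inv g)) (I u)"
      by (rule msum_mult[OF RD(1)[OF gi]]) (rule mult_carrier_mat[OF RD(1)[OF g] c])
    also have "\<dots> = msum (d * d) (d * d) (\<lambda>s. R (cyc3 (g u) (fst (map_prod g g s)) (snd (map_prod g g s)))) (I u)"
    proof (rule msum_cong[OF refl])
      fix s assume "s \<in> I u"
      note cs = Ic[OF u this]
      have "R g * R (cyc3 u (fst s) (snd s)) * R (inv g) = R (g \<otimes> cyc3 u (fst s) (snd s) \<otimes> inv g)"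
        using RD(2)[OF g cs] RD(2)[OF m_closed[OF g cs] gi] by (simp only:)
      thus "R g * R (cyc3 u (fst s) (snd s)) * R (inv g) =
        R (cyc3 (g u) (fst (map_prod g g s)) (snd (map_prod g g s)))"
        unfolding conj_cyc3[OF g] by simp
    qed
    also have "bij_betw (map_prod g g) (I u) (I (g u))"
    proof (rule bij_betw_byWitness[where f' = "map_prod (inv g) (inv g)"])
      show "map_prod g g ` I u \<subseteq> I (g u)"
        using carrier_in[OF g] carrier_inj[OF g] by (auto simp: I_def)
      show "map_prod (inv g) (inv g) ` I (g u) \<subseteq> I u"
      proof
        fix s assume "s \<in> map_prod (inv g) (inv g) ` I (g u)"
        then obtain p q where s: "s = ((inv g) p, (inv g) q)" and pq: "(p, q) \<in> I (g u)" by auto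
        have "(inv g) p \<in> {1..n}" "(inv g) q \<in> {1..n}"
          using carrier_in[OF gi] pq by (auto simp: I_def)
        moreover have "(inv g) p \<noteq> u" "(inv g) q \<noteq> u" "(inv g) q \<noteq> (inv g) p"
          using pq inv_apply[OF g] by (auto simp: I_def) (metis inv_apply(2)[OF g])+
        ultimately show "s \<in> I u" by (auto simp: s I_def)
      qed
    qed (auto simp: inv_apply[OF g])
    hence "msum (d * d) (d * d) (\<lambda>s. R (cyc3 (g u) (fst (map_prod g g s)) (snd (map_prod g g s)))) (I u) = Y (g u)"
      unfolding Y_def by (rule msum_reindex[where f = "\<lambda>s. R (cyc3 (g u) (fst s) (snd s))"])
    finally show ?thesis .
  qed
  hence Yxy: "Y x = Y y"
    by (intro point_family_constant[OF R R zR _ _ xy]) (auto simp: Y_def)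
  have abcG: "cyc3 a b c \<in> carrier G" using abc by (intro cyc3_carrier)
  have val: "(Y u *\<^sub>v vectorise (\<rho> (cyc3 a b c))) $ k =
     (\<Sum>i\<in>{1..n} - {u}. \<Sum>j\<in>{1..n} - {u} - {i}. f (cyc3 u i j a) (cyc3 u i j b) (cyc3 u i j c))"
    if u: "u \<in> {1..n}" for u
  proof -
    have v: "vectorise (\<rho> (cyc3 a b c)) \<in> carrier_vec (d * d)" by (rule vectorise_carrier[OF \<rho>(1)[OF abcG]])
    have "(Y u *\<^sub>v vectorise (\<rho> (cyc3 a b c))) $ k =
      (\<Sum>s\<in>I u. (R (cyc3 u (fst s) (snd s)) *\<^sub>v vectorise (\<rho> (cyc3 a b c))) $ k)"
    proof -
      have "Y u *\<^sub>v vectorise (\<rho> (cyc3 a b c)) =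
        vec (d * d) (\<lambda>l. \<Sum>s\<in>I u. (R (cyc3 u (fst s) (snd s)) *\<^sub>v vectorise (\<rho> (cyc3 a b c))) $ l)"
        unfolding Y_def by (rule msum_mult_vec[OF v]) (rule RD(1)[OF Ic[OF u]])
      thus ?thesis using k by simp
    qed
    also have "\<dots> = (\<Sum>s\<in>I u. (case s of (i, j) \<Rightarrow> f (cyc3 u i j a) (cyc3 u i j b) (cyc3 u i j c)))"
    proof (rule sum.cong[OF refl])
      fix s assume s: "s \<in> I u"
      define h where "h = cyc3 u (fst s) (snd s)"
      have h: "h \<in> carrier G" unfolding h_def by (rule Ic[OF u s])
      have hi: "inv h \<in> carrier G" using h by simp
      have "R h *\<^sub>v vectorise (\<rho> (cyc3 a b c)) = vectorise (\<rho> h * \<rho> (cyc3 a b c) * \<rho> (inv h))"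
        unfolding R_def using kron_vectorise[OF \<rho>(1)[OF h] transpose_carrier_mat[THEN iffD2, OF \<rho>(1)[OF hi]] \<rho>(1)[OF abcG]]
        by simp
      also have "\<rho> h * \<rho> (cyc3 a b c) * \<rho> (inv h) = \<rho> (h \<otimes> cyc3 a b c \<otimes> inv h)"
        using \<rho>(2)[OF h abcG] \<rho>(2)[OF m_closed[OF h abcG] hi] by (simp only:)
      finally show "(R (cyc3 u (fst s) (snd s)) *\<^sub>v vectorise (\<rho> (cyc3 a b c))) $ k =
        (case s of (i, j) \<Rightarrow> f (cyc3 u i j a) (cyc3 u i j b) (cyc3 u i j c))"
        unfolding conj_cyc3[OF h] unfolding h_def f_def by (cases s) simp
    qed
    also have "\<dots> = (\<Sum>i\<in>{1..n} - {u}. \<Sum>j\<in>{1..n} - {u} - {i}. f (cyc3 u i j a) (cyc3 u i j b) (cyc3 u i j c))"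
      unfolding I_def by (rule sum.Sigma[symmetric]) auto
    finally show ?thesis .
  qed
  show ?thesis using val[OF xy(1)] val[OF xy(2)] Yxy by simp
qed

lemma cyc3_rotate: "a \<noteq> b \<Longrightarrow> a \<noteq> c \<Longrightarrow> b \<noteq> c \<Longrightarrow> cyc3 b c a = cyc3 a b c"
  by (auto simp: fun_eq_iff cyc3_apply)

text \<open>The four terms of (abc + acb)(abe + aeb): two double transpositions and two
  three-cycles.\<close>

lemma cyc3_products:
  assumes "distinct [a, b, c, e]"
  shows "cyc3 a b c \<circ> cyc3 a b e = swap a c \<circ> swap b e"
    and "cyc3 a b c \<circ> cyc3 a e b = cyc3 a e c"
    and "cyc3 a c b \<circ> cyc3 a b e = cyc3 b e c"
    and "cyc3 a c b \<circ> cyc3 a e b = swap a e \<circ> swap b c"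
proof -
  have ne: "a \<noteq> b" "a \<noteq> c" "a \<noteq> e" "b \<noteq> c" "b \<noteq> e" "c \<noteq> e"
    "b \<noteq> a" "c \<noteq> a" "e \<noteq> a" "c \<noteq> b" "e \<noteq> b" "e \<noteq> c" using assms by auto
  have cases: "f = g" if "f a = g a" "f b = g b" "f c = g c" "f e = g e"
    "\<And>x. x \<noteq> a \<Longrightarrow> x \<noteq> b \<Longrightarrow> x \<noteq> c \<Longrightarrow> x \<noteq> e \<Longrightarrow> f x = g x" for f g :: "nat \<Rightarrow> nat"
    using that by (metis ext)
  show "cyc3 a b c \<circ> cyc3 a b e = swap a c \<circ> swap b e"
    by (rule cases) (simp_all add: ne cyc3_apply Transposition.transpose_def)
  show "cyc3 a b c \<circ> cyc3 a e b = cyc3 a e c"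
    by (rule cases) (simp_all add: ne cyc3_apply)
  show "cyc3 a c b \<circ> cyc3 a b e = cyc3 b e c"
    by (rule cases) (simp_all add: ne cyc3_apply)
  show "cyc3 a c b \<circ> cyc3 a e b = swap a e \<circ> swap b c"
    by (rule cases) (simp_all add: ne cyc3_apply Transposition.transpose_def)
qed

text \<open>Used entrywise: \<open>m\<close> is an entry of the matrix called M in
  \<open>klein\<close>, \<open>M\<close> the entry of its square, and \<open>V\<close>,
  \<open>W\<close> are entries at the double transpositions. Adding the two expansions of the square
  pairs every three-cycle with its inverse.\<close>

lemma klein_arith:
  fixes V :: complex
  assumes "a + a' = m" "b + b' = m" "M = m + 2 * u" "M = V + a' + (b' + W)" "M = W + a + (b + V)"
  shows "V + W = 2 * u"
proof -
  have "2 * (V + W) = (V + a' + (b' + W)) + (W + a + (b + V)) - ((a + a') + (b + b'))" by simp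
  also have "\<dots> = (m + 2 * u) + (m + 2 * u) - (m + m)" using assms by simp
  also have "\<dots> = 2 * (2 * u)" by simp
  finally show ?thesis unfolding mult_cancel_left by simp
qed

lemma pairwise_sums:
  fixes V1 :: complex
  assumes "V1 + V2 = 2 * u" "V3 + V2 = 2 * u" "V1 + V3 = 2 * u"
  shows "V1 = u"
proof -
  have "2 * V1 = (V1 + V2) + (V1 + V3) - (V3 + V2)" by simp
  also have "\<dots> = 2 * u" unfolding assms by simp
  finally show ?thesis by simp
qed

lemma mult_add_expand:
  assumes "A \<in> carrier_mat d d" "B \<in> carrier_mat d d" "C \<in> carrier_mat d d" "E \<in> carrier_mat d d"
  shows "(A + B) * (C + E) = A * C + A * E + (B * C + B * (E :: complex mat))"
proof -
  have "(A + B) * (C + E) = A * (C + E) + B * (C + E)"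
    by (rule add_mult_distrib_mat[OF assms(1,2)]) (use assms in auto)
  thus ?thesis
    unfolding mult_add_distrib_mat[OF assms(1,3,4)] mult_add_distrib_mat[OF assms(2,3,4)] .
qed

lemma fourth_power_real:
  assumes r: "representation G d \<rho>"
    and f: "faithful_character G (char \<rho>)"
    and real: "\<And>g. g \<in> carrier G \<Longrightarrow> char \<rho> (inv g) = char \<rho> g"
  shows "ip (\<lambda>g. char \<rho> g ^ 4) \<gamma> \<noteq> 0"
proof
  assume z: "ip (\<lambda>g. char \<rho> g ^ 4) \<gamma> = 0"
  note \<rho> = representationD[OF r] and inj = faithful_inj[OF r f]
  let ?X = "{1..n}"
  define w where "w k a b c = vectorise (\<rho> (cyc3 a b c)) $ k" for k a b c
  \<comment> \<open>Entries of \<rho> at three-cycles are invariant under rotating the triple only.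
    Combining a cycle with its inverse gives a part that is symmetric (e = 1) or antisymmetric (e =
    -1) in the triple.\<close>
  define v where "v e k a b c = w k a b c + e * w k a c b" for e k a b c
  have cs: "conjugation_sum ?X (v e k) e" if "e = 1 \<or> e = -1" for e k
  proof unfold_locales
    fix a b c :: nat assume d: "a \<noteq> b" "a \<noteq> c" "b \<noteq> c"
    have "cyc3 b c a = cyc3 a b c" "cyc3 b a c = cyc3 a c b"
      using cyc3_rotate[of a b c] cyc3_rotate[of c b a] cyc3_rotate[of b a c] d by auto
    thus "v e k b c a = v e k a b c" "v e k b a c = e * v e k a b c"
      using that cyc3_rotate[of a b c] d unfolding v_def w_def by (auto simp: algebra_simps)
  qed auto
  have const: "conjugation_sum.D ?X (v e k) x a b c = conjugation_sum.D ?X (v e k) y a b c"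
    if e: "e = 1 \<or> e = -1" and k: "k < d * d" and xy: "x \<in> ?X" "y \<in> ?X"
      and t: "conjugation_sum.triple ?X a b c" for e k x y a b c
  proof -
    have abc: "a \<in> ?X" "b \<in> ?X" "c \<in> ?X" "a \<noteq> b" "a \<noteq> c" "b \<noteq> c"
      using t unfolding conjugation_sum.triple_def[OF cs[OF e, of k]] by auto
    \<comment> \<open>\<open>D\<close> is linear in \<open>v\<close>, so the two orientations of the
      cycle can be treated separately.\<close>
    define W where "W u a b c = (\<Sum>i\<in>?X - {u}. \<Sum>j\<in>?X - {u} - {i}.
      w k (cyc3 u i j a) (cyc3 u i j b) (cyc3 u i j c))" for u a b c
    have "conjugation_sum.D ?X (v e k) u a b c = W u a b c + e * W u a c b" for u
      unfolding conjugation_sum.D_def[OF cs[OF e]] v_def W_def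
      by (simp add: sum.distrib sum_distrib_left)
    moreover have "W x a b c = W y a b c"
      unfolding W_def w_def by (rule three_cycle_sum_constant[OF r real z abc xy k])
    moreover have "W x a c b = W y a c b"
      unfolding W_def w_def
      by (rule three_cycle_sum_constant[OF r real z abc(1,3,2,5,4) abc(6)[symmetric] xy k])
    ultimately show ?thesis by simp
  qed
  have triple: "conjugation_sum.triple ?X a b c \<longleftrightarrow>
      a \<in> ?X \<and> b \<in> ?X \<and> c \<in> ?X \<and> a \<noteq> b \<and> a \<noteq> c \<and> b \<noteq> c" for a b c
    using conjugation_sum.triple_def[OF cs[of 1 0]] by simp
  have cG: "cyc3 a b c \<in> carrier G" if "conjugation_sum.triple ?X a b c" for a b c
    using that unfolding triple by (intro cyc3_carrier) auto
  have n4: "1 \<in> ?X" "2 \<in> ?X" "3 \<in> ?X" "4 \<in> ?X" using n5 by auto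
  show False
  \<comment> \<open>At n = 6 the relation for the symmetric part degenerates to 0 = 0, and the
    antisymmetric part is used instead: its vanishing identifies a three-cycle with its
    inverse.\<close>
  proof (cases "n = 6")
    case True
    have t: "conjugation_sum.triple ?X 1 2 3" "conjugation_sum.triple ?X 1 3 2"
      unfolding triple using n4 by auto
    have "v (-1) k 1 2 3 = 0" if k: "k < d * d" for k
    proof (rule conjugation_sum.alternating_zero[OF cs _ refl _ t(1)])
      show "conjugation_sum.D ?X (v (-1) k) x a b c = conjugation_sum.D ?X (v (-1) k) y a b c"
        if "x \<in> ?X" "y \<in> ?X" "conjugation_sum.triple ?X a b c" for x y a b c
        by (rule const[OF _ k that]) simp
    qed (use True in simp_all)
    hence "vectorise (\<rho> (cyc3 1 2 3)) $ k = vectorise (\<rho> (cyc3 1 3 2)) $ k" if "k < d * d" for k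
      using that by (simp add: v_def w_def)
    hence "vectorise (\<rho> (cyc3 1 2 3)) = vectorise (\<rho> (cyc3 1 3 2))"
      using vectorise_carrier[OF \<rho>(1)[OF cG[OF t(1)]]] vectorise_carrier[OF \<rho>(1)[OF cG[OF t(2)]]]
      by (intro eq_vecI) auto
    hence "\<rho> (cyc3 1 2 3) = \<rho> (cyc3 1 3 2)"
      by (rule vectorise_inj[OF \<rho>(1)[OF cG[OF t(1)]] \<rho>(1)[OF cG[OF t(2)]]])
    hence "cyc3 1 2 3 = cyc3 1 3 2" by (rule inj[OF cG[OF t(1)] cG[OF t(2)]])
    hence "cyc3 1 2 3 1 = cyc3 1 3 2 1" by simp
    thus False by (simp add: cyc3_apply)
  next
    case False
    define s where "s a b c = \<rho> (cyc3 a b c) + \<rho> (cyc3 a c b)" for a b c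
    have first: "s x b c = s a b c" if t: "conjugation_sum.triple ?X a b c" and x: "x \<in> ?X - {a, b, c}" for a b c x
    proof -
      have ts: "conjugation_sum.triple ?X a c b" "conjugation_sum.triple ?X x b c" "conjugation_sum.triple ?X x c b"
        using t x unfolding triple by auto
      note cc = \<rho>(1)[OF cG[OF t]] \<rho>(1)[OF cG[OF ts(1)]] \<rho>(1)[OF cG[OF ts(2)]] \<rho>(1)[OF cG[OF ts(3)]]
      have sc: "s x b c \<in> carrier_mat d d" "s a b c \<in> carrier_mat d d" using cc by (auto simp: s_def)
      have vs: "vectorise (A + B) $ k = vectorise A $ k + vectorise B $ k"
        if "A \<in> carrier_mat d d" "B \<in> carrier_mat d d" "k < d * d" for A B :: "complex mat" and k
        using that vectorise_index[OF that(1,3)] vectorise_index[OF that(2,3)]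
          vectorise_index[OF add_carrier_mat[OF that(2)] that(3), of A] div_mod_less[OF that(3)] by simp
      have "vectorise (s x b c) $ k = vectorise (s a b c) $ k" if k: "k < d * d" for k
      proof -
        have "v 1 k x b c = v 1 k a b c"
        proof (rule conjugation_sum.symmetric_constant[OF cs _ _ refl _ t x])
          show "conjugation_sum.D ?X (v 1 k) x a b c = conjugation_sum.D ?X (v 1 k) y a b c"
            if "x \<in> ?X" "y \<in> ?X" "conjugation_sum.triple ?X a b c" for x y a b c
            by (rule const[OF _ k that]) simp
        qed (use False n5 in simp_all)
        thus ?thesis using vs[OF cc(1,2) k] vs[OF cc(3,4) k] by (simp add: v_def w_def s_def)
      qed
      hence "vectorise (s x b c) = vectorise (s a b c)"
        using vectorise_carrier[OF sc(1)] vectorise_carrier[OF sc(2)] by (intro eq_vecI) auto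
      thus ?thesis by (rule vectorise_inj[OF sc])
    qed
    have srot: "s b c a = s a b c" if t: "conjugation_sum.triple ?X a b c" for a b c
    proof -
      have "cyc3 b c a = cyc3 a b c" "cyc3 b a c = cyc3 a c b"
        using t cyc3_rotate[of a b c] cyc3_rotate[of a c b] cyc3_rotate[of c b a] unfolding triple by auto
      thus ?thesis by (simp add: s_def)
    qed
    have sflip: "s a c b = s a b c" if t: "conjugation_sum.triple ?X a b c" for a b c
    proof -
      have "conjugation_sum.triple ?X a c b" using t unfolding triple by auto
      thus ?thesis using comm_add_mat[OF \<rho>(1)[OF cG[OF t]] \<rho>(1)[OF cG]] by (simp add: s_def)
    qed
    have dG: "swap a c \<circ> swap b e \<in> carrier G"
      if "a \<in> ?X" "b \<in> ?X" "c \<in> ?X" "e \<in> ?X" "a \<noteq> c" "b \<noteq> e" for a b c e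
    proof (rule even_carrier)
      show "swap a c \<circ> swap b e permutes ?X"
        by (intro permutes_compose permutes_swap_id) (use that in auto)
      show "evenperm (swap a c \<circ> swap b e)"
        using that by (simp add: evenperm_comp permutation_swap_id evenperm_swap)
    qed
    \<comment> \<open>\<open>M\<close> is the common value of \<open>s\<close>. Its square is M + 2,
      since a three-cycle squares to its inverse. Multiplying the values of \<open>s\<close> on two
      triples that share a and b, in both orders, gives two more expressions for the same
      square.\<close>
    have klein: "\<rho> (swap a c \<circ> swap b e) $$ (p, q) + \<rho> (swap a e \<circ> swap b c) $$ (p, q) = 2 * 1\<^sub>m d $$ (p, q)"
      if m: "a \<in> ?X" "b \<in> ?X" "c \<in> ?X" "e \<in> ?X" and ne: "distinct [a, b, c, e]" and pq: "p < d" "q < d"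
      for a b c e p q
    proof -
      have ne': "a \<noteq> b" "a \<noteq> c" "a \<noteq> e" "b \<noteq> c" "b \<noteq> e" "c \<noteq> e"
        "b \<noteq> a" "c \<noteq> a" "e \<noteq> a" "c \<noteq> b" "e \<noteq> b" "e \<noteq> c" using ne by auto
      have T: "conjugation_sum.triple ?X x y z" if "distinct [x, y, z]" "{x, y, z} \<subseteq> {a, b, c, e}" for x y z
        using that m unfolding triple by auto
      have G3: "cyc3 x y z \<in> carrier G" if "distinct [x, y, z]" "{x, y, z} \<subseteq> {a, b, c, e}" for x y z
        by (rule cG[OF T[OF that]])
      define M where "M = s a b c"
      have s1: "s a b e = M"
      proof -
        have "s a b e = s e a b" using srot[OF T[of e a b]] ne' by simp
        also have "\<dots> = s c a b" using first[OF T[of c a b], of e] ne' m by simp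
        also have "\<dots> = M" using srot[OF T[of c a b]] ne' by (simp add: M_def)
        finally show ?thesis .
      qed
      have s2: "s a c e = M"
      proof -
        have "s a c e = s e a c" using srot[OF T[of e a c]] ne' by simp
        also have "\<dots> = s b a c" using first[OF T[of b a c], of e] ne' m by simp
        also have "\<dots> = s a c b" using srot[OF T[of b a c]] ne' by simp
        also have "\<dots> = M" using sflip[OF T[of a b c]] ne' by (simp add: M_def)
        finally show ?thesis .
      qed
      have s3: "s b c e = M"
      proof -
        have "s b c e = s e b c" using srot[OF T[of e b c]] ne' by simp
        also have "\<dots> = M" using first[OF T[of a b c], of e] ne' m by (simp add: M_def)
        finally show ?thesis .
      qed
      have prod: "\<rho> g * \<rho> h = \<rho> (g \<circ> h)" if "g \<in> carrier G" "h \<in> carrier G" for g h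
        using \<rho>(2)[OF that] by simp
      have G: "cyc3 a b c \<in> carrier G" "cyc3 a c b \<in> carrier G" "cyc3 a b e \<in> carrier G"
        "cyc3 a e b \<in> carrier G" "cyc3 a c e \<in> carrier G" "cyc3 a e c \<in> carrier G"
        "cyc3 b c e \<in> carrier G" "cyc3 b e c \<in> carrier G"
        using ne' by (auto intro!: G3)
      have P: "swap a c \<circ> swap b e \<in> carrier G" "swap a e \<circ> swap b c \<in> carrier G"
        using m ne' by (auto intro!: dG)
      have idG: "id \<in> carrier G" using one_closed by simp
      have \<rho>id: "\<rho> id = 1\<^sub>m d" using \<rho>(3) by simp
      note C = \<rho>(1)[OF G(1)] \<rho>(1)[OF G(2)] \<rho>(1)[OF G(3)] \<rho>(1)[OF G(4)] \<rho>(1)[OF G(5)] \<rho>(1)[OF G(6)]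
        \<rho>(1)[OF G(7)] \<rho>(1)[OF G(8)] \<rho>(1)[OF P(1)] \<rho>(1)[OF P(2)]
      have pr1: "cyc3 a b c \<circ> cyc3 a b c = cyc3 a c b" "cyc3 a b c \<circ> cyc3 a c b = id"
        "cyc3 a c b \<circ> cyc3 a b c = id" "cyc3 a c b \<circ> cyc3 a c b = cyc3 a b c"
        using ne' by (auto simp: fun_eq_iff cyc3_apply)
      note pr2 = cyc3_products[OF ne]
      have ne_swap: "distinct [a, b, e, c]" using ne' by simp
      note pr3 = cyc3_products[OF ne_swap]
      have "M * M = \<rho> (cyc3 a c b) + \<rho> id + (\<rho> id + \<rho> (cyc3 a b c))"
        unfolding M_def s_def mult_add_expand[OF C(1,2,1,2)] using G by (simp only: prod pr1)
      hence e1: "(M * M) $$ (p, q) = M $$ (p, q) + 2 * 1\<^sub>m d $$ (p, q)"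
        using C pq by (simp add: M_def s_def \<rho>id)
      have "s a b c * s a b e = \<rho> (swap a c \<circ> swap b e) + \<rho> (cyc3 a e c)
          + (\<rho> (cyc3 b e c) + \<rho> (swap a e \<circ> swap b c))"
        unfolding s_def mult_add_expand[OF C(1,2,3,4)] using G by (simp only: prod pr2)
      hence e2: "(M * M) $$ (p, q) = \<rho> (swap a c \<circ> swap b e) $$ (p, q) + \<rho> (cyc3 a e c) $$ (p, q)
          + (\<rho> (cyc3 b e c) $$ (p, q) + \<rho> (swap a e \<circ> swap b c) $$ (p, q))"
        unfolding s1 M_def[symmetric] using C pq by simp
      have "s a b e * s a b c = \<rho> (swap a e \<circ> swap b c) + \<rho> (cyc3 a c e)
          + (\<rho> (cyc3 b c e) + \<rho> (swap a c \<circ> swap b e))"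
        unfolding s_def mult_add_expand[OF C(3,4,1,2)] using G by (simp only: prod pr3)
      hence e3: "(M * M) $$ (p, q) = \<rho> (swap a e \<circ> swap b c) $$ (p, q) + \<rho> (cyc3 a c e) $$ (p, q)
          + (\<rho> (cyc3 b c e) $$ (p, q) + \<rho> (swap a c \<circ> swap b e) $$ (p, q))"
        unfolding s1 M_def[symmetric] using C pq by simp
      have "\<rho> (cyc3 a c e) $$ (p, q) + \<rho> (cyc3 a e c) $$ (p, q) = M $$ (p, q)"
        unfolding s2[symmetric] s_def using C pq by simp
      moreover have "\<rho> (cyc3 b c e) $$ (p, q) + \<rho> (cyc3 b e c) $$ (p, q) = M $$ (p, q)"
        unfolding s3[symmetric] s_def using C pq by simp
      ultimately show ?thesis using e1 e2 e3 by (rule klein_arith)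
    qed
    \<comment> \<open>Three labellings of 1, 2, 3, 4 give the three pairs of double transpositions;
      each pair sums to 2, so every single one is the identity.\<close>
    have one: "\<rho> (swap 1 3 \<circ> swap 2 4) $$ (p, q) = 1\<^sub>m d $$ (p, q)" if pq: "p < d" "q < d" for p q
    proof -
      have "\<rho> (swap 1 3 \<circ> swap 2 4) $$ (p, q) + \<rho> (swap 1 4 \<circ> swap 2 3) $$ (p, q) = 2 * 1\<^sub>m d $$ (p, q)"
        by (rule klein) (use n4 pq in auto)
      moreover have "\<rho> (swap 1 2 \<circ> swap 3 4) $$ (p, q) + \<rho> (swap 1 4 \<circ> swap 3 2) $$ (p, q) = 2 * 1\<^sub>m d $$ (p, q)"
        by (rule klein) (use n4 pq in auto)
      moreover have "\<rho> (swap 1 3 \<circ> swap 4 2) $$ (p, q) + \<rho> (swap 1 2 \<circ> swap 4 3) $$ (p, q) = 2 * 1\<^sub>m d $$ (p, q)"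
        by (rule klein) (use n4 pq in auto)
      ultimately show ?thesis
        unfolding transpose_commute[of 3 2] transpose_commute[of 4 2] transpose_commute[of 4 3]
        by (rule pairwise_sums)
    qed
    have dd: "swap 1 3 \<circ> swap 2 4 \<in> carrier G" using n4 by (intro dG) auto
    have "\<rho> (swap 1 3 \<circ> swap 2 4) = \<rho> id"
      using one \<rho>(1)[OF dd] \<rho>(3) by (intro eq_matI) auto
    hence "swap 1 3 \<circ> swap 2 4 = id" using inj[OF dd] one_closed by simp
    hence "(swap 1 3 \<circ> swap 2 4) 1 = id 1" by simp
    thus False by (simp add: Transposition.transpose_def)
  qed
qed

subsection \<open>Characters of the alternating group dual to their odd conjugates\<close>

text \<open>A representative of the odd coset; on the alternating group, conjugation by it is an
  outer automorphism.\<close>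

definition t :: "nat \<Rightarrow> nat"
  where "t = swap 1 2"

lemma tt: "t (t x) = x" "t \<circ> t = id"
  by (simp_all add: t_def)

lemma t_permutes: "t permutes {1..n}"
  unfolding t_def by (rule permutes_swap_id) (use n5 in auto)

lemma t_conj_carrier:
  assumes "g \<in> carrier G"
  shows "t \<circ> g \<circ> t \<in> carrier G"
proof -
  have g: "g permutes {1..n}" by (rule carrier_permutes[OF assms])
  have p: "t \<circ> g \<circ> t permutes {1..n}" by (intro permutes_compose g t_permutes)
  have "permutation g" using g permutation_permutes by blast
  hence "evenperm (t \<circ> g \<circ> t) \<longleftrightarrow> evenperm g"
    by (simp add: t_def evenperm_comp permutation_compose permutation_swap_id evenperm_swap)
  thus ?thesis using p assms G_cases by (auto simp: alt_group_carrier sym_group_carrier)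
qed

text \<open>An odd permutation may lie outside G, so it is represented by its product with
  \<open>t\<close>, to which \<rho> applies.\<close>

lemma odd_t_carrier:
  assumes "s permutes {1..n}" "\<not> evenperm s"
  shows "s \<circ> t \<in> carrier G" "t \<circ> s \<in> carrier G"
proof -
  have s: "permutation s" using assms(1) permutation_permutes by blast
  show "s \<circ> t \<in> carrier G" "t \<circ> s \<in> carrier G"
    by (rule even_carrier; use assms s t_permutes in
      \<open>simp add: t_def evenperm_comp permutation_swap_id evenperm_swap permutes_compose\<close>)+
qed

lemma swap_odd: "a \<in> {1..n} \<Longrightarrow> b \<in> {1..n} \<Longrightarrow> a \<noteq> b \<Longrightarrow> swap a b permutes {1..n} \<and> \<not> evenperm (swap a b)"
  by (simp add: permutes_swap_id evenperm_swap)

lemma t_conj_representation: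
  assumes r: "representation G d \<rho>"
  shows "representation G d (\<lambda>g. \<rho> (t \<circ> g \<circ> t))"
proof (rule representationI)
  note \<rho> = representationD[OF r]
  show "\<rho> (t \<circ> g \<circ> t) \<in> carrier_mat d d" if "g \<in> carrier G" for g
    by (rule \<rho>(1)[OF t_conj_carrier[OF that]])
  have "t \<circ> \<one> \<circ> t = \<one>" by (simp add: tt)
  thus "\<rho> (t \<circ> \<one> \<circ> t) = 1\<^sub>m d" using \<rho>(3) by (simp only:)
  fix g h assume gh: "g \<in> carrier G" "h \<in> carrier G"
  have "t \<circ> (g \<otimes> h) \<circ> t = (t \<circ> g \<circ> t) \<otimes> (t \<circ> h \<circ> t)" by (simp add: fun_eq_iff tt)
  thus "\<rho> (t \<circ> (g \<otimes> h) \<circ> t) = \<rho> (t \<circ> g \<circ> t) * \<rho> (t \<circ> h \<circ> t)"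
    using \<rho>(2)[OF t_conj_carrier[OF gh(1)] t_conj_carrier[OF gh(2)]] by (simp only:)
qed

lemma inv_t_conj: "g \<in> carrier G \<Longrightarrow> inv (t \<circ> g \<circ> t) = t \<circ> inv g \<circ> t"
proof (rule inv_equality)
  assume g: "g \<in> carrier G"
  show "(t \<circ> inv g \<circ> t) \<otimes> (t \<circ> g \<circ> t) = \<one>" by (simp add: fun_eq_iff tt inv_apply[OF g])
  show "t \<circ> inv g \<circ> t \<in> carrier G" by (intro t_conj_carrier inv_closed g)
qed (rule t_conj_carrier)

lemma dual_ip:
  assumes r: "representation G d \<rho>"
  shows "ip (char (\<lambda>g. (\<rho> (inv g))\<^sup>T)) (char (\<lambda>g. (\<rho> (inv g))\<^sup>T)) =
    ip (char \<rho>) (char \<rho>)"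
  using character_inv_apply(2)[OF r] by (simp add: ip_def mult.commute)

lemma t_conj_ip:
  assumes r: "representation G d \<rho>"
  shows "ip (char (\<lambda>g. \<rho> (t \<circ> g \<circ> t))) (char (\<lambda>g. \<rho> (t \<circ> g \<circ> t))) =
    ip (char \<rho>) (char \<rho>)"
proof -
  let ?c = "char \<rho>"
  have bij: "bij_betw (\<lambda>g. t \<circ> g \<circ> t) (carrier G) (carrier G)"
    by (rule bij_betw_byWitness[where f' = "\<lambda>g. t \<circ> g \<circ> t"])
      (use t_conj_carrier in \<open>auto simp: fun_eq_iff tt\<close>)
  have "(\<Sum>g\<in>carrier G. ?c (t \<circ> g \<circ> t) * ?c (inv (t \<circ> g \<circ> t))) = (\<Sum>g\<in>carrier G. ?c g * ?c (inv g))"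
    by (rule sum.reindex_bij_betw[OF bij])
  thus ?thesis
    using t_conj_carrier by (simp add: ip_def character_of_apply inv_t_conj)
qed

lemma fourth_power_twisted:
  assumes irr: "irreducible_representation G d \<rho>"
    and f: "faithful_character G (char \<rho>)"
    and tw: "\<And>g. g \<in> carrier G \<Longrightarrow> char \<rho> (inv g) = char \<rho> (t \<circ> g \<circ> t)"
  shows "ip (\<lambda>g. char \<rho> g ^ 4) \<gamma> \<noteq> 0"
proof
  assume z: "ip (\<lambda>g. char \<rho> g ^ 4) \<gamma> = 0"
  have r: "representation G d \<rho>" and d: "d > 0" using irr by (auto simp: irreducible_representation_def)
  note \<rho> = representationD[OF r]
  let ?X = "{1..n}"
  define \<sigma> where "\<sigma> g = (\<rho> (inv g))\<^sup>T" for g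
  define \<tau> where "\<tau> g = \<rho> (t \<circ> g \<circ> t)" for g
  have r\<sigma>: "representation G d \<sigma>" unfolding \<sigma>_def by (rule character_inv_apply(1)[OF r])
  have r\<tau>: "representation G d \<tau>" unfolding \<tau>_def by (rule t_conj_representation[OF r])
  note \<sigma> = representationD[OF r\<sigma>] and \<tau> = representationD[OF r\<tau>]
  have self: "ip (char \<rho>) (char \<rho>) = 1" by (rule ip_irreducible_self[OF irr])
  have irr\<sigma>: "irreducible_representation G d \<sigma>"
    by (rule irreducible_if_ip_self[OF r\<sigma> d]) (unfold \<sigma>_def dual_ip[OF r], rule self)
  have irr\<tau>: "irreducible_representation G d \<tau>"
    by (rule irreducible_if_ip_self[OF r\<tau> d]) (unfold \<tau>_def t_conj_ip[OF r], rule self)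
  have "char \<sigma> g = char \<tau> g" for g
  proof (cases "g \<in> carrier G")
    case True
    have "char \<sigma> g = char \<rho> (inv g)"
      unfolding \<sigma>_def by (rule character_inv_apply(2)[OF r True])
    thus ?thesis using tw[OF True] character_of_apply[OF True] character_of_apply[OF t_conj_carrier[OF True]]
      by (simp add: \<tau>_def)
  qed (simp add: character_of_def)
  hence "char \<sigma> = char \<tau>" by (rule ext)
  hence "ip (char \<sigma>) (char \<tau>) \<noteq> 0" using ip_irreducible_self[OF irr\<tau>] by simp
  \<comment> \<open>The hypothesis equates the character of the dual with that of the twist by
    \<open>t\<close>; as both are irreducible, they are isomorphic by \<open>J\<close>, with inverse
    \<open>K\<close>.\<close>
  then obtain J where J: "J \<in> carrier_mat d d" "J \<noteq> 0\<^sub>m d d"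
    and Jint: "\<And>g. g \<in> carrier G \<Longrightarrow> \<sigma> g * J = J * \<tau> g"
    using nonzero_intertwiner[OF r\<tau> r\<sigma>] by metis
  obtain K where K: "K \<in> carrier_mat d d" "J * K = 1\<^sub>m d" "K * J = 1\<^sub>m d"
    using schur[OF irr\<tau> irr\<sigma> J(1) Jint J(2)] by metis
  have Kint: "K * \<sigma> g = \<tau> g * K" if g: "g \<in> carrier G" for g
  proof -
    have "K * \<sigma> g = K * \<sigma> g * (J * K)" using K \<sigma>(1)[OF g] by simp
    also have "\<dots> = K * (\<sigma> g * J) * K"
      using K(1) J(1) \<sigma>(1)[OF g] by (simp add: assoc_mult_mat[of _ d d _ d _ d])
    also have "\<dots> = (K * J) * \<tau> g * K" unfolding Jint[OF g]
      using K(1) J(1) \<tau>(1)[OF g] by (simp add: assoc_mult_mat[of _ d d _ d _ d])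
    finally show ?thesis using K \<tau>(1)[OF g] by simp
  qed
  \<comment> \<open>This extends \<rho> to odd permutations, as a map from the dual of V to V. The
    intertwining property of \<open>K\<close> yields \<open>Econj\<close>: acting with g on both
    sides conjugates s.\<close>
  define E where "E s = \<rho> (s \<circ> t) * K" for s
  have E: "E s \<in> carrier_mat d d" if "s permutes ?X" "\<not> evenperm s" for s
    using \<rho>(1)[OF odd_t_carrier(1)[OF that]] K(1) by (simp add: E_def)
  have prod: "\<rho> g * \<rho> h = \<rho> (g \<circ> h)" if "g \<in> carrier G" "h \<in> carrier G" for g h
    using \<rho>(2)[OF that] by simp
  have comp: "g \<circ> h \<in> carrier G" if "g \<in> carrier G" "h \<in> carrier G" for g h
    using m_closed[OF that] by simp
  have Econj: "\<rho> g * E s * (\<rho> g)\<^sup>T = E (g \<otimes> s \<otimes> inv g)"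
    if g: "g \<in> carrier G" and s: "s permutes ?X" "\<not> evenperm s" for g s
  proof -
    have gi: "inv g \<in> carrier G" using g by simp
    note st = odd_t_carrier(1)[OF s]
    have "(\<rho> g)\<^sup>T = \<sigma> (inv g)" using g by (simp add: \<sigma>_def)
    hence "\<rho> g * E s * (\<rho> g)\<^sup>T = \<rho> g * \<rho> (s \<circ> t) * (K * \<sigma> (inv g))"
      using \<rho>(1)[OF g] \<rho>(1)[OF st] K(1) \<sigma>(1)[OF gi]
      by (simp add: E_def assoc_mult_mat[of _ d d _ d _ d])
    also have "\<dots> = \<rho> g * \<rho> (s \<circ> t) * \<rho> (t \<circ> inv g \<circ> t) * K"
      unfolding Kint[OF gi] unfolding \<tau>_def
      using \<rho>(1)[OF g] \<rho>(1)[OF st] K(1) \<rho>(1)[OF t_conj_carrier[OF gi]]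
      by (simp add: assoc_mult_mat[of _ d d _ d _ d])
    also have "\<rho> g * \<rho> (s \<circ> t) * \<rho> (t \<circ> inv g \<circ> t) = \<rho> (g \<circ> (s \<circ> t) \<circ> (t \<circ> inv g \<circ> t))"
      unfolding prod[OF g st] by (rule prod[OF comp[OF g st] t_conj_carrier[OF gi]])
    also have "g \<circ> (s \<circ> t) \<circ> (t \<circ> inv g \<circ> t) = g \<otimes> s \<otimes> inv g \<circ> t" by (simp add: fun_eq_iff tt)
    finally show ?thesis by (simp only: E_def)
  qed
  \<comment> \<open>Operators from the dual of V \<otimes> V to V \<otimes> V. Their character is
    the product of the squares of the characters of V and V, the fourth power, with no appeal to
    reality.\<close>
  define R where "R g = kron (\<rho> g) (\<rho> g)" for g
  define R' where "R' g = kron (\<sigma> g) (\<sigma> g)" for g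
  have R: "representation G (d * d) R" unfolding R_def by (rule representation_kron[OF r r])
  have R': "representation G (d * d) R'" unfolding R'_def by (rule representation_kron[OF r\<sigma> r\<sigma>])
  note RD = representationD[OF R] and RD' = representationD[OF R']
  have "(\<Sum>g\<in>carrier G. char R g * char R' (inv g) * \<gamma> (inv g)) =
    (\<Sum>g\<in>carrier G. char \<rho> g ^ 4 * \<gamma> (inv g))"
  proof (intro sum.cong refl)
    fix g assume g: "g \<in> carrier G"
    have "char R g = char \<rho> g * char \<rho> g"
      using fun_cong[OF character_of_kron[OF r r], of g] unfolding R_def by simp
    moreover have "char R' (inv g) = char \<rho> g * char \<rho> g"
      using fun_cong[OF character_of_kron[OF r\<sigma> r\<sigma>], of "inv g"] g
        character_inv_apply(2)[OF r, of "inv g", folded \<sigma>_def] unfolding R'_def by simp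
    ultimately show "char R g * char R' (inv g) * \<gamma> (inv g) = char \<rho> g ^ 4 * \<gamma> (inv g)"
      by (simp add: power4_eq_xxxx)
  qed
  hence zR: "ip (\<lambda>g. char R g * char R' (inv g)) \<gamma> = 0"
    using z by (simp add: ip_def)
  \<comment> \<open>By \<open>kron_vectorise\<close> this operator sends a matrix A to E A E; the
    second factor is transposed to make it so.\<close>
  define Z where "Z x i = kron (E (swap x i)) ((E (swap x i))\<^sup>T)" for x i
  have Zc: "Z x i \<in> carrier_mat (d * d) (d * d)" if "x \<in> ?X" "i \<in> ?X - {x}" for x i
    unfolding Z_def using E[of "swap x i"] swap_odd[of x i] that by (intro kron_carrier) auto
  define Y where "Y x = msum (d * d) (d * d) (Z x) (?X - {x})" for x
  have "R g * Y x * R' (inv g) = Y (g x)" if g: "g \<in> carrier G" and x: "x \<in> ?X" for g x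
  proof -
    have gi: "inv g \<in> carrier G" using g by simp
    have "R g * Y x = msum (d * d) (d * d) (\<lambda>i. R g * Z x i) (?X - {x})"
      unfolding Y_def by (rule mult_msum[OF RD(1)[OF g]]) (rule Zc[OF x])
    also have "\<dots> * R' (inv g) = msum (d * d) (d * d) (\<lambda>i. R g * Z x i * R' (inv g)) (?X - {x})"
      by (rule msum_mult[OF RD'(1)[OF gi]]) (rule mult_carrier_mat[OF RD(1)[OF g] Zc[OF x]])
    also have "\<dots> = msum (d * d) (d * d) (\<lambda>i. Z (g x) (g i)) (?X - {x})"
    proof (rule msum_cong[OF refl])
      fix i assume i: "i \<in> ?X - {x}"
      have o: "swap x i permutes ?X" "\<not> evenperm (swap x i)" using swap_odd[of x i] i x by auto
      let ?E = "E (swap x i)"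
      note Ec = E[OF o]
      have \<sigma>g: "\<sigma> (inv g) = (\<rho> g)\<^sup>T" using g by (simp add: \<sigma>_def)
      have rt: "(\<rho> g)\<^sup>T \<in> carrier_mat d d" and et: "?E\<^sup>T \<in> carrier_mat d d"
        using \<rho>(1)[OF g] Ec by auto
      have "R g * Z x i * R' (inv g) = kron (\<rho> g * ?E * (\<rho> g)\<^sup>T) (\<rho> g * ?E\<^sup>T * (\<rho> g)\<^sup>T)"
        unfolding R_def Z_def R'_def \<sigma>g
        unfolding kron_mult[OF \<rho>(1)[OF g] Ec \<rho>(1)[OF g] et]
        by (rule kron_mult[OF mult_carrier_mat[OF \<rho>(1)[OF g] Ec] rt mult_carrier_mat[OF \<rho>(1)[OF g] et] rt])
      also have "\<rho> g * ?E\<^sup>T * (\<rho> g)\<^sup>T = (\<rho> g * ?E * (\<rho> g)\<^sup>T)\<^sup>T"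
        using \<rho>(1)[OF g] Ec by (simp add: transpose_mult[of _ d d _ d] assoc_mult_mat[of _ d d _ d _ d])
      also have "\<rho> g * ?E * (\<rho> g)\<^sup>T = E (swap (g x) (g i))"
        unfolding Econj[OF g o] conj_swap[OF g] ..
      finally show "R g * Z x i * R' (inv g) = Z (g x) (g i)" by (simp only: Z_def)
    qed
    also have "\<dots> = Y (g x)" unfolding Y_def by (rule msum_reindex[OF bij_betw_minus_point[OF g]])
    finally show ?thesis .
  qed
  note Yconst = point_family_constant[OF R R' zR _ this]
  have Ysum: "(\<Sum>i\<in>?X - {x}. vectorise (E (swap (swap x i a) (swap x i b))) $ k) =
     (\<Sum>i\<in>?X - {y}. vectorise (E (swap (swap y i a) (swap y i b))) $ k)"
    if k: "k < d * d" and xy: "x \<in> ?X" "y \<in> ?X" and ab: "a \<in> ?X" "b \<in> ?X" "a \<noteq> b" for k x y a b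
  proof -
    have o: "swap a b permutes ?X" "\<not> evenperm (swap a b)" using swap_odd[OF ab] by auto
    note tab = odd_t_carrier(2)[OF o]
    \<comment> \<open>The counterpart of \<rho>(abc) in the real case: the odd permutation (a b) as
      a map from V to its dual. The product E(s) A E(s) is then E at the conjugate of (a b) by
      s.\<close>
    define A where "A = J * \<rho> (t \<circ> swap a b)"
    have A: "A \<in> carrier_mat d d" using J(1) \<rho>(1)[OF tab] by (simp add: A_def)
    have val: "(Y u *\<^sub>v vectorise A) $ k = (\<Sum>i\<in>?X - {u}. vectorise (E (swap (swap u i a) (swap u i b))) $ k)"
      if u: "u \<in> ?X" for u
    proof -
      have "(Y u *\<^sub>v vectorise A) $ k = (\<Sum>i\<in>?X - {u}. (Z u i *\<^sub>v vectorise A) $ k)"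
      proof -
        have "Y u *\<^sub>v vectorise A = vec (d * d) (\<lambda>l. \<Sum>i\<in>?X - {u}. (Z u i *\<^sub>v vectorise A) $ l)"
          unfolding Y_def by (rule msum_mult_vec[OF vectorise_carrier[OF A]]) (rule Zc[OF u])
        thus ?thesis using k by simp
      qed
      also have "\<dots> = (\<Sum>i\<in>?X - {u}. vectorise (E (swap (swap u i a) (swap u i b))) $ k)"
      proof (rule sum.cong[OF refl])
        fix i assume i: "i \<in> ?X - {u}"
        define s where "s = swap u i"
        have os: "s permutes ?X" "\<not> evenperm s" using swap_odd[of u i] i u by (auto simp: s_def)
        note st = odd_t_carrier(1)[OF os]
        have "Z u i *\<^sub>v vectorise A = vectorise (E s * A * E s)"
          unfolding Z_def s_def[symmetric] using kron_vectorise[OF E[OF os] _ A, of "(E s)\<^sup>T" d] E[OF os] by simp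
        also have "E s * A * E s = \<rho> (s \<circ> t) * (K * J) * \<rho> (t \<circ> swap a b) * \<rho> (s \<circ> t) * K"
          using \<rho>(1)[OF st] \<rho>(1)[OF tab] K(1) J(1)
          by (simp add: E_def A_def assoc_mult_mat[of _ d d _ d _ d])
        also have "\<dots> = \<rho> (s \<circ> t) * \<rho> (t \<circ> swap a b) * \<rho> (s \<circ> t) * K"
          unfolding K(3) using \<rho>(1)[OF st] by simp
        also have "\<rho> (s \<circ> t) * \<rho> (t \<circ> swap a b) * \<rho> (s \<circ> t) = \<rho> ((s \<circ> t) \<circ> (t \<circ> swap a b) \<circ> (s \<circ> t))"
          unfolding prod[OF st tab] by (rule prod[OF comp[OF st tab] st])
        also have "(s \<circ> t) \<circ> (t \<circ> swap a b) \<circ> (s \<circ> t) = swap (s a) (s b) \<circ> t"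
        proof -
          have "s \<circ> swap a b = swap (s a) (s b) \<circ> s" by (rule swap_conj[OF permutes_inj[OF os(1)]])
          hence "s (swap a b x) = swap (s a) (s b) (s x)" for x by (simp add: fun_eq_iff)
          moreover have "s (s x) = x" for x by (simp add: s_def)
          ultimately show ?thesis by (simp add: fun_eq_iff tt)
        qed
        finally show "(Z u i *\<^sub>v vectorise A) $ k = vectorise (E (swap (swap u i a) (swap u i b))) $ k"
          by (simp only: E_def s_def)
      qed
      finally show ?thesis .
    qed
    have "Y x = Y y" by (rule Yconst[OF _ _ _ xy]) (simp_all add: Y_def)
    thus ?thesis using val[OF xy(1)] val[OF xy(2)] by simp
  qed
  have n3: "1 \<in> ?X" "2 \<in> ?X" "3 \<in> ?X" using n5 by auto
  have "vectorise (E (swap 1 3)) $ k = vectorise (E (swap 2 3)) $ k" if k: "k < d * d" for k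
  proof (rule swap_sum_constant[where f = "\<lambda>a b. vectorise (E (swap a b)) $ k" and X = ?X])
    show "vectorise (E (swap a b)) $ k = vectorise (E (swap b a)) $ k" for a b
      by (simp only: transpose_commute)
    show "(\<Sum>i\<in>?X - {x}. vectorise (E (swap (swap x i a) (swap x i b))) $ k) =
        (\<Sum>i\<in>?X - {y}. vectorise (E (swap (swap y i a) (swap y i b))) $ k)"
      if "x \<in> ?X" "y \<in> ?X" "a \<in> ?X" "b \<in> ?X" "a \<noteq> b" for x y a b
      by (rule Ysum[OF k that])
  qed (use n5 n3 in simp_all)
  moreover have o: "swap 1 3 permutes ?X" "\<not> evenperm (swap 1 3)" "swap 2 3 permutes ?X" "\<not> evenperm (swap 2 3)"
    using swap_odd n3 by auto
  ultimately have "vectorise (E (swap 1 3)) = vectorise (E (swap 2 3))"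
    using vectorise_carrier[OF E[OF o(1,2)]] vectorise_carrier[OF E[OF o(3,4)]]
    by (intro eq_vecI) auto
  hence EE: "E (swap 1 3) = E (swap 2 3)" by (rule vectorise_inj[OF E[OF o(1,2)] E[OF o(3,4)]])
  have EJ: "E s * J = \<rho> (s \<circ> t)" if "s permutes ?X" "\<not> evenperm s" for s
    using assoc_mult_mat[OF \<rho>(1)[OF odd_t_carrier(1)[OF that]] K(1) J(1)] K(3)
      \<rho>(1)[OF odd_t_carrier(1)[OF that]] by (simp add: E_def)
  have "\<rho> (swap 1 3 \<circ> t) = \<rho> (swap 2 3 \<circ> t)"
    using EJ[OF o(1,2)] EJ[OF o(3,4)] EE by simp
  hence "swap 1 3 \<circ> t = swap 2 3 \<circ> t"
    by (rule faithful_inj[OF r f odd_t_carrier(1)[OF o(1,2)] odd_t_carrier(1)[OF o(3,4)]])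
  hence "(swap 1 3 \<circ> t) 3 = (swap 2 3 \<circ> t) 3" by simp
  thus False by (simp add: t_def Transposition.transpose_def)
qed

text \<open>Every permutation is conjugate to its inverse in the symmetric group, so the sum of the
  character and its twist by \<open>t\<close> is invariant under inversion. The dual character
  therefore occurs in this sum, and being irreducible it equals one of the two summands.\<close>

lemma real_or_twisted:
  assumes irr: "irreducible_representation G d \<rho>"
  shows "(\<forall>g\<in>carrier G. char \<rho> (inv g) = char \<rho> g) \<or>
    (\<forall>g\<in>carrier G. char \<rho> (inv g) = char \<rho> (t \<circ> g \<circ> t))"
proof -
  have r: "representation G d \<rho>" and d: "d > 0" using irr by (auto simp: irreducible_representation_def)
  let ?c = "char \<rho>"
  define \<sigma> where "\<sigma> g = (\<rho> (inv g))\<^sup>T" for g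
  define \<tau> where "\<tau> g = \<rho> (t \<circ> g \<circ> t)" for g
  have r\<sigma>: "representation G d \<sigma>" unfolding \<sigma>_def by (rule character_inv_apply(1)[OF r])
  have r\<tau>: "representation G d \<tau>" unfolding \<tau>_def by (rule t_conj_representation[OF r])
  have c\<sigma>: "char \<sigma> g = ?c (inv g)" if "g \<in> carrier G" for g
    unfolding \<sigma>_def by (rule character_inv_apply(2)[OF r that])
  have c\<tau>: "char \<tau> g = ?c (t \<circ> g \<circ> t)" if "g \<in> carrier G" for g
    using that t_conj_carrier[OF that] by (simp add: \<tau>_def character_of_apply)
  have self: "ip ?c ?c = 1" by (rule ip_irreducible_self[OF irr])
  have irr\<sigma>: "irreducible_representation G d \<sigma>"
    by (rule irreducible_if_ip_self[OF r\<sigma> d]) (unfold \<sigma>_def dual_ip[OF r], rule self)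
  have irr\<tau>: "irreducible_representation G d \<tau>"
    by (rule irreducible_if_ip_self[OF r\<tau> d]) (unfold \<tau>_def t_conj_ip[OF r], rule self)
  have I: "?c \<in> Irr G" "char \<sigma> \<in> Irr G" "char \<tau> \<in> Irr G"
    using irr irr\<sigma> irr\<tau> by (auto simp: Irr_def)
  define \<tau>' where "\<tau>' g = (\<tau> (inv g))\<^sup>T" for g
  have r\<tau>': "representation G d \<tau>'" unfolding \<tau>'_def by (rule character_inv_apply(1)[OF r\<tau>])
  have c\<tau>': "char \<tau>' g = ?c (t \<circ> inv g \<circ> t)" if "g \<in> carrier G" for g
    unfolding \<tau>'_def character_inv_apply(2)[OF r\<tau> that] by (rule c\<tau>[OF inv_closed[OF that]])
  have orbit: "?c g + ?c (t \<circ> g \<circ> t) = ?c (inv g) + ?c (t \<circ> inv g \<circ> t)" if g: "g \<in> carrier G" for g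
  proof -
    obtain s where s: "s permutes {1..n}" "s \<circ> g = inv' g \<circ> s"
      using permutes_conj_inv[OF carrier_permutes[OF g]] by auto
    have sg: "s (g x) = (inv g) (s x)" for x using fun_cong[OF s(2), of x] inv_eq[OF g] by simp
    note tg = t_conj_carrier[OF g]
    show ?thesis
    proof (cases "s \<in> carrier G")
      case True
      have ts: "t \<circ> s \<circ> t \<in> carrier G" by (rule t_conj_carrier[OF True])
      have "s \<otimes> g \<otimes> inv s = inv g" by (rule conj_inv[OF True]) (simp add: fun_eq_iff sg)
      moreover have "(t \<circ> s \<circ> t) \<otimes> (t \<circ> g \<circ> t) \<otimes> inv (t \<circ> s \<circ> t) = t \<circ> inv g \<circ> t"
        by (rule conj_inv[OF ts]) (simp add: fun_eq_iff tt sg)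
      ultimately show ?thesis
        using character_of_conj[OF r g True] character_of_conj[OF r tg ts] by simp
    next
      \<comment> \<open>An odd \<open>s\<close> interchanges the roles of the two summands: its
        products with \<open>t\<close> conjugate the twist of g to the inverse of g, and g to the
        twist of that inverse.\<close>
      case False
      have "\<not> evenperm s" using False even_carrier s(1) by blast
      note st = odd_t_carrier[OF s(1) this]
      have "(s \<circ> t) \<otimes> (t \<circ> g \<circ> t) \<otimes> inv (s \<circ> t) = inv g"
        by (rule conj_inv[OF st(1)]) (simp add: fun_eq_iff tt sg)
      moreover have "(t \<circ> s) \<otimes> g \<otimes> inv (t \<circ> s) = t \<circ> inv g \<circ> t"
        by (rule conj_inv[OF st(2)]) (simp add: fun_eq_iff tt sg)
      ultimately show ?thesis
        using character_of_conj[OF r tg st(1)] character_of_conj[OF r g st(2)] by simp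
    qed
  qed
  let ?s = "char \<sigma>"
  \<comment> \<open>The right-hand side is 1 plus a multiplicity, hence positive, so one of the two
    pairings on the left is nonzero.\<close>
  have "ip ?c ?s + ip (char \<tau>) ?s = ip ?s ?s + ip (char \<tau>') ?s"
  proof -
    have "(\<Sum>g\<in>carrier G. (?c g + char \<tau> g) * ?s (inv g)) =
      (\<Sum>g\<in>carrier G. (?s g + char \<tau>' g) * ?s (inv g))"
    proof (intro sum.cong refl)
      fix g assume g: "g \<in> carrier G"
      show "(?c g + char \<tau> g) * ?s (inv g) = (?s g + char \<tau>' g) * ?s (inv g)"
        unfolding c\<sigma>[OF g] c\<tau>[OF g] c\<tau>'[OF g] orbit[OF g] ..
    qed
    thus ?thesis unfolding ip_add_left[symmetric] by (simp add: ip_def)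
  qed
  moreover obtain m :: nat where "ip (char \<tau>') ?s = of_nat m"
    using ip_character_Irr[OF _ I(2)] r\<tau>' d unfolding characters_def by blast
  ultimately have eq: "ip ?c ?s + ip (char \<tau>) ?s = of_nat (Suc m)"
    using ip_Irr[OF I(2,2)] by simp
  have "?c = ?s \<or> char \<tau> = ?s"
  proof (rule ccontr)
    assume "\<not> ?thesis"
    hence "ip ?c ?s + ip (char \<tau>) ?s = 0" using ip_Irr[OF I(1,2)] ip_Irr[OF I(3,2)] by simp
    hence "of_nat (Suc m) = (0 :: complex)" unfolding eq .
    thus False unfolding of_nat_eq_0_iff by simp
  qed
  thus ?thesis
  proof
    assume "?c = ?s"
    thus ?thesis using c\<sigma> by metis
  next
    assume "char \<tau> = ?s"
    hence "?c (inv g) = ?c (t \<circ> g \<circ> t)" if "g \<in> carrier G" for g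
      using c\<sigma>[OF that] c\<tau>[OF that] by simp
    thus ?thesis by blast
  qed
qed

section \<open>The diameter bound\<close>

lemma mckay_diameter:
  assumes \<alpha>: "\<alpha> \<in> Irr G" and f: "faithful_character G \<alpha>"
  shows "digraph_diameter (mckay_graph G \<alpha>) \<le> enat (4 * n - 4)"
proof -
  obtain d \<rho> where irr: "irreducible_representation G d \<rho>" and eq: "\<alpha> = char \<rho>"
    using \<alpha> by (auto simp: Irr_def)
  have r: "representation G d \<rho>" using irr by (auto simp: irreducible_representation_def)
  have nz: "ip (\<lambda>g. \<alpha> g ^ 4) \<gamma> \<noteq> 0"
    using real_or_twisted[OF irr] fourth_power_real[OF r] fourth_power_twisted[OF irr] f
    unfolding eq by blast
  have \<alpha>c: "\<alpha> \<in> characters G" and \<gamma>c: "\<gamma> \<in> characters G" using \<alpha> \<gamma>_Irr Irr_characters by auto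
  have "(\<lambda>g. \<alpha> g ^ 3 * \<alpha> g) \<in> characters G" by (rule characters_power_mult[OF \<alpha>c \<alpha>c])
  hence "(\<lambda>g. \<alpha> g ^ 4) \<in> characters G" by (simp add: power3_eq_cube power4_eq_xxxx)
  from constituentI[OF this \<gamma>_Irr nz] obtain \<beta> where
    \<beta>: "\<beta> \<in> characters G \<or> \<beta> = (\<lambda>g. 0)" "(\<lambda>g. \<alpha> g ^ 4) = (\<lambda>g. \<gamma> g + \<beta> g)"
    by (auto simp: constituent_def)
  have "\<exists>p. pre_digraph.apath (mckay_graph G \<alpha>) u p v \<and> length p \<le> 4 * n - 4"
    if uv: "u \<in> Irr G" "v \<in> Irr G" for u v
  proof -
    obtain k where k: "k \<le> n - 1" "ip (\<lambda>g. \<gamma> g ^ k * u g) v \<noteq> 0"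
      using burnside_brauer[OF uv] by metis
    obtain p where p: "pre_digraph.awalk (mckay_graph G \<alpha>) u p v" "length p = 4 * k"
      using mckay_walk_power[OF \<alpha>c \<gamma>c \<beta> uv k(2)] by auto
    obtain q where "pre_digraph.apath (mckay_graph G \<alpha>) u q v" "length q \<le> length p"
      using wf_digraph.shorter_apath[OF wf_mckay_graph p(1)] by auto
    thus ?thesis using p(2) k(1) by (intro exI[of _ q]) auto
  qed
  thus ?thesis
    unfolding digraph_diameter_def by (intro Inf_lower) (auto simp: mckay_graph_def)
qed

end

theorem theorem5:
  fixes n :: nat and G :: "(nat \<Rightarrow> nat) monoid" and \<alpha> :: "(nat \<Rightarrow> nat) \<Rightarrow> complex"
  assumes "n \<ge> 5"
    and "G = alt_group n \<or> G = sym_group n"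
    and "\<alpha> \<in> Irr G"
    and "faithful_character G \<alpha>"
  shows "digraph_diameter (mckay_graph G \<alpha>) \<le> enat (4 * n - 4)"
proof -
  interpret alt_or_sym n G by unfold_locales (use assms in auto)
  show ?thesis by (rule mckay_diameter[OF assms(3,4)])
qed

end
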